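(* Let $L$ be an LMI-minimal hermitian monic pencil in $g$ variables. Then there exists $n_0\in\mathbb{N}$ such that $\partial^1\mathcal{D}_n(L)$ is Zariski dense in $\mathscr{Z}_n(L)$ for all $n\ge n_0$.
   Context: A hermitian monic pencil of size $d$ is $L=I_d-\sum_{j=1}^gA_jx_j$ with $A_j$ hermitian $d\times d$ complex matrices; for $X\in M_n(\mathbb{C})^g$, $L(X)=I_{dn}-\sum_jA_j\otimes X_j$ (Kronecker product). Let $H_n(\mathbb{C})$ be the set of $n\times n$ hermitian matrices. The free spectrahedron (LMI domain) of $L$ is $\mathcal{D}(L)=\bigcup_n\mathcal{D}_n(L)$, $\mathcal{D}_n(L)=\{X\in H_n(\mathbb{C})^g: L(X)\succeq0\}$. $L$ is LMI-minimal if it is of minimal size among all hermitian monic pencils $L'$ with $\mathcal{D}(L')=\mathcal{D}(L)$. Further, $\mathscr{Z}_n(L)=\{X\in M_n(\mathbb{C})^g:\det L(X)=0\}$ and $\partial^1\mathcal{D}_n(L)=\{X\in\mathcal{D}_n(L):\dim\ker L(X)=1\}$. Zariski density refers to the Zariski topology of the complex affine space $M_n(\mathbb{C})^g$. *)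

theory Defs
  imports
    "Jordan_Normal_Form.Schur_Decomposition"
    "Jordan_Normal_Form.Matrix_Kernel"
    "HOL-Analysis.Abstract_Topology"
begin

text \<open>
  Matrices are those of the theory \<open>Jordan_Normal_Form.Matrix\<close>, whose size is part of the value.
  A tuple of matrices is a list, and the \<open>j\<close>-th entry of the list \<open>X\<close> is \<open>X ! j\<close> with \<open>j < g\<close>.
\<close>

definition mat_tuples :: "nat \<Rightarrow> nat \<Rightarrow> complex mat list set" where
  "mat_tuples g n = {X. length X = g \<and> set X \<subseteq> carrier_mat n n}"

definition hermitian_mats :: "nat \<Rightarrow> complex mat set" where
  "hermitian_mats n = {A \<in> carrier_mat n n. mat_adjoint A = A}"

definition hermitian_tuples :: "nat \<Rightarrow> nat \<Rightarrow> complex mat list set" where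
  "hermitian_tuples g n = {X. length X = g \<and> set X \<subseteq> hermitian_mats n}"

text \<open>Here \<open>(M *\<^sub>v v) \<bullet>c v\<close> is \<open>v\<^sup>* M v\<close>, and \<open>0 \<le> z\<close> on \<open>complex\<close> means that \<open>z\<close> is real
  and nonnegative.\<close>

definition psd :: "complex mat \<Rightarrow> bool" where
  "psd M \<longleftrightarrow> M \<in> hermitian_mats (dim_row M) \<and>
     (\<forall>v \<in> carrier_vec (dim_row M). 0 \<le> (M *\<^sub>v v) \<bullet>c v)"

definition kronecker :: "complex mat \<Rightarrow> complex mat \<Rightarrow> complex mat" where
  "kronecker A B = mat (dim_row A * dim_row B) (dim_col A * dim_col B)
     (\<lambda>(r, c). A $$ (r div dim_row B, c div dim_col B) * B $$ (r mod dim_row B, c mod dim_col B))"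


section \<open>Hermitian monic pencils and free spectrahedra\<close>

text \<open>
  The pencil \<open>I\<^sub>d - \<Sum>\<^sub>j A\<^sub>j x\<^sub>j\<close> is given by its size \<open>d\<close> and its coefficient list \<open>A\<close>. Sizes are
  positive.
\<close>

definition hermitian_monic_pencil :: "nat \<Rightarrow> nat \<Rightarrow> complex mat list \<Rightarrow> bool" where
  "hermitian_monic_pencil g d A \<longleftrightarrow> 0 < d \<and> A \<in> hermitian_tuples g d"

definition pencil_eval :: "nat \<Rightarrow> complex mat list \<Rightarrow> nat \<Rightarrow> complex mat list \<Rightarrow> complex mat" where
  "pencil_eval d A n X =
     1\<^sub>m (d * n) - foldr (+) (map2 kronecker A X) (0\<^sub>m (d * n) (d * n))"

definition lmi_domain_level :: "nat \<Rightarrow> nat \<Rightarrow> complex mat list \<Rightarrow> nat \<Rightarrow> complex mat list set" where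
  "lmi_domain_level g d A n = {X \<in> hermitian_tuples g n. psd (pencil_eval d A n X)}"

definition lmi_domain :: "nat \<Rightarrow> nat \<Rightarrow> complex mat list \<Rightarrow> complex mat list set" where
  "lmi_domain g d A = (\<Union>n\<in>{1..}. lmi_domain_level g d A n)"

definition lmi_minimal :: "nat \<Rightarrow> nat \<Rightarrow> complex mat list \<Rightarrow> bool" where
  "lmi_minimal g d A \<longleftrightarrow>
     (\<forall>d' A'. hermitian_monic_pencil g d' A' \<and> lmi_domain g d' A' = lmi_domain g d A \<longrightarrow> d \<le> d')"

definition free_locus :: "nat \<Rightarrow> nat \<Rightarrow> complex mat list \<Rightarrow> nat \<Rightarrow> complex mat list set" where
  "free_locus g d A n = {X \<in> mat_tuples g n. det (pencil_eval d A n X) = 0}"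

definition lmi_boundary1 :: "nat \<Rightarrow> nat \<Rightarrow> complex mat list \<Rightarrow> nat \<Rightarrow> complex mat list set" where
  "lmi_boundary1 g d A n =
     {X \<in> lmi_domain_level g d A n. kernel_dim (pencil_eval d A n X) = 1}"


section \<open>The Zariski topology on tuples of matrices\<close>

text \<open>Polynomial functions in the \<open>g * n\<^sup>2\<close> entries of a tuple of matrices.\<close>

inductive entry_polynomial :: "nat \<Rightarrow> nat \<Rightarrow> (complex mat list \<Rightarrow> complex) \<Rightarrow> bool"
  for g n :: nat where
  const: "entry_polynomial g n (\<lambda>X. a)"
| entry: "j < g \<Longrightarrow> r < n \<Longrightarrow> c < n \<Longrightarrow> entry_polynomial g n (\<lambda>X. X ! j $$ (r, c))"
| add: "entry_polynomial g n p \<Longrightarrow> entry_polynomial g n q \<Longrightarrow> entry_polynomial g n (\<lambda>X. p X + q X)"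
| mult: "entry_polynomial g n p \<Longrightarrow> entry_polynomial g n q \<Longrightarrow> entry_polynomial g n (\<lambda>X. p X * q X)"

definition zero_set :: "nat \<Rightarrow> nat \<Rightarrow> (complex mat list \<Rightarrow> complex) set \<Rightarrow> complex mat list set" where
  "zero_set g n P = {X \<in> mat_tuples g n. \<forall>p\<in>P. p X = 0}"

definition zariski_topology :: "nat \<Rightarrow> nat \<Rightarrow> complex mat list topology" where
  "zariski_topology g n =
     topology (\<lambda>U. \<exists>P \<subseteq> Collect (entry_polynomial g n). U = mat_tuples g n - zero_set g n P)"

lemma istopology_zariski:
  "istopology (\<lambda>U. \<exists>P \<subseteq> Collect (entry_polynomial g n). U = mat_tuples g n - zero_set g n P)"
  (is "istopology ?L")
  unfolding istopology_def
proof (intro conjI allI impI)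
  fix S T assume "?L S" "?L T"
  then obtain P Q where P: "P \<subseteq> Collect (entry_polynomial g n)" "S = mat_tuples g n - zero_set g n P"
    and Q: "Q \<subseteq> Collect (entry_polynomial g n)" "T = mat_tuples g n - zero_set g n Q" by blast
  let ?R = "{\<lambda>X. p X * q X | p q. p \<in> P \<and> q \<in> Q}"
  have "?R \<subseteq> Collect (entry_polynomial g n)"
    using P(1) Q(1) by (auto intro: entry_polynomial.mult)
  moreover have "S \<inter> T = mat_tuples g n - zero_set g n ?R"
    unfolding P(2) Q(2) zero_set_def by (auto, metis mult_eq_0_iff)
  ultimately show "?L (S \<inter> T)" by blast
next
  fix K assume "\<forall>S\<in>K. ?L S"
  then obtain P where P: "\<And>S. S \<in> K \<Longrightarrow> P S \<subseteq> Collect (entry_polynomial g n)"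
      "\<And>S. S \<in> K \<Longrightarrow> S = mat_tuples g n - zero_set g n (P S)" by metis
  have "(\<Union>S\<in>K. P S) \<subseteq> Collect (entry_polynomial g n)" using P(1) by blast
  moreover have "\<Union>K = mat_tuples g n - zero_set g n (\<Union>S\<in>K. P S)"
  proof -
    have "\<Union>K = (\<Union>S\<in>K. mat_tuples g n - zero_set g n (P S))" using P(2) by blast
    then show ?thesis unfolding zero_set_def by auto
  qed
  ultimately show "?L (\<Union>K)" by blast
qed

lemma openin_zariski:
  "openin (zariski_topology g n) U \<longleftrightarrow>
     (\<exists>P \<subseteq> Collect (entry_polynomial g n). U = mat_tuples g n - zero_set g n P)"
  unfolding zariski_topology_def using topology_inverse'[OF istopology_zariski] by simp

lemma topspace_zariski [simp]: "topspace (zariski_topology g n) = mat_tuples g n"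
proof
  show "topspace (zariski_topology g n) \<subseteq> mat_tuples g n"
    unfolding topspace_def by (auto simp: openin_zariski)
  have "openin (zariski_topology g n) (mat_tuples g n)"
    unfolding openin_zariski
    by (rule exI[of _ "{\<lambda>X. 1}"]) (auto simp: zero_set_def intro: entry_polynomial.const)
  then show "mat_tuples g n \<subseteq> topspace (zariski_topology g n)"
    by (rule openin_subset)
qed

lemma closedin_zariski:
  "closedin (zariski_topology g n) C \<longleftrightarrow>
     (\<exists>P \<subseteq> Collect (entry_polynomial g n). C = zero_set g n P)"
proof -
  have "zero_set g n P \<subseteq> mat_tuples g n" for P by (auto simp: zero_set_def)
  then show ?thesis
    unfolding closedin_def openin_zariski topspace_zariski by (metis double_diff order_refl Diff_subset)
qed

definition zariski_dense_in :: "nat \<Rightarrow> nat \<Rightarrow> complex mat list set \<Rightarrow> complex mat list set \<Rightarrow> bool" where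
  "zariski_dense_in g n S Z \<longleftrightarrow>
     S \<subseteq> Z \<and> subtopology (zariski_topology g n) Z closure_of S = Z"

end

theory Submission
  imports "HOL-Complex_Analysis.Conformal_Mappings" "HOL-Library.Function_Algebras" Defs
begin

text \<open>
  Decompose the coefficient space orthogonally into minimal invariant subspaces; the free locus is the
  union of the free loci of the irreducible compressions. Let \<open>L\<close> be one of them, of size \<open>d\<close>. A kernel
  vector of \<open>L(X)\<close> is an \<open>n \<times> d\<close> matrix \<open>V\<close> with \<open>V = \<Sum>\<^sub>j X\<^sub>j V A\<^sub>j\<^sup>T\<close>. For injective \<open>V\<close> this is an
  affine space of tuples \<open>X\<close> of constant dimension, so the tuples with an injective kernel vector are
  connected by rational curves. If \<open>V\<close> has rank \<open>k < d\<close> and row space \<open>W\<close>, irreducibility makes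
  \<open>\<Sum>\<^sub>j A\<^sub>j W\<close> strictly larger than \<open>W\<close>, and counting parameters shows that for large \<open>n\<close> the cone over these
  tuples lies in a hypersurface. Hence the tuples with an injective kernel vector are dense in the free
  locus of \<open>L\<close>, and a polynomial vanishing on it near one such tuple vanishes on all of it.

  By minimality some hermitian tuple satisfies all other components of the pencil but not \<open>L\<close>; scaling
  and perturbing it gives a boundary point of the free spectrahedron at which only \<open>L\<close> is singular, with a
  one-dimensional kernel spanned by an injective \<open>V\<close>. The kernel is one-dimensional because
  the point is chosen where the top eigenvalue is differentiable. There the eigenvalue is simple, so it is
  holomorphic on nearby complex tuples, and a polynomial vanishing on the nearby boundary vanishes on the
  nearby free locus of \<open>L\<close>.
\<close>

hide_const (open) Finite_Cartesian_Product.mat Finite_Cartesian_Product.row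
  Finite_Cartesian_Product.column Determinants.det Finite_Cartesian_Product.transpose
  Finite_Cartesian_Product.vec Finite_Cartesian_Product.vec.vec_nth

section \<open>Polynomial functions on tuples of matrices\<close>

text \<open>A complex hypersurface can have too few hermitian points to be determined by them, so
  each irreducible component of the pencil needs a smooth hermitian boundary point of its own.
  Minimality supplies it: if the complement of a component implied the component's inequality, the
  complement alone, a smaller pencil, would define the same domain; in particular repeated
  components are excluded. The kernel must be one-dimensional for the whole pencil, hence the strict
  inequality demanded of the complement at that point. The rational curves carry vanishing from a
  neighbourhood to the whole locus, the role that irreducibility of the determinant would play. The
  threshold for \<open>n\<close> has two sources: the size of the violating tuple, which is padded
  by zeros, and the parameter count, which needs n > 1 + d^2 + g d^2 for each component of size
  d.\<close>

type_synonym tuple = "nat \<times> nat \<times> nat \<Rightarrow> complex"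

text \<open>Working with total functions on (matrix, row, column) triples makes lines, scalings and
  limits pointwise; only the values on \<open>idx g n\<close> reach the matrices.\<close>

definition tup :: "nat \<Rightarrow> nat \<Rightarrow> tuple \<Rightarrow> complex mat list" where
  "tup g n x = map (\<lambda>j. mat n n (\<lambda>(i, k). x (j, i, k))) [0..<g]"

definition untup :: "complex mat list \<Rightarrow> tuple" where
  "untup X = (\<lambda>(j, i, k). X ! j $$ (i, k))"

abbreviation idx :: "nat \<Rightarrow> nat \<Rightarrow> (nat \<times> nat \<times> nat) set" where
  "idx g n \<equiv> {..<g} \<times> {..<n} \<times> {..<n}"

lemma tup_in [simp]: "tup g n x \<in> mat_tuples g n"
  by (auto simp: tup_def mat_tuples_def)

lemma tup_nth: "j < g \<Longrightarrow> i < n \<Longrightarrow> k < n \<Longrightarrow> tup g n x ! j $$ (i, k) = x (j, i, k)"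
  by (simp add: tup_def)

lemma tup_untup: "X \<in> mat_tuples g n \<Longrightarrow> tup g n (untup X) = X"
proof (rule nth_equalityI)
  assume X: "X \<in> mat_tuples g n"
  then show "length (tup g n (untup X)) = length X" by (simp add: tup_def mat_tuples_def)
  fix j assume "j < length (tup g n (untup X))"
  then have j: "j < g" by (simp add: tup_def)
  with X have "X ! j \<in> carrier_mat n n" by (auto simp: mat_tuples_def)
  with j show "tup g n (untup X) ! j = X ! j" by (auto simp: tup_def untup_def)
qed

lemma tup_cong: "(\<And>t. t \<in> idx g n \<Longrightarrow> x t = y t) \<Longrightarrow> tup g n x = tup g n y"
  unfolding tup_def by (auto intro!: eq_matI)

lemma entry_polynomial_entry_tup: "entry_polynomial g n (\<lambda>X. untup X t)" if "t \<in> idx g n"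
  using that by (auto simp: untup_def intro: entry_polynomial.entry)

lemma untup_tup: "t \<in> idx g n \<Longrightarrow> untup (tup g n x) t = x t"
  by (auto simp: untup_def tup_nth)

lemma entry_polynomial_sum:
  "(\<And>i. i \<in> I \<Longrightarrow> entry_polynomial g n (p i)) \<Longrightarrow> entry_polynomial g n (\<lambda>X. \<Sum>i\<in>I. p i X)"
  by (induction I rule: infinite_finite_induct)
    (auto intro: entry_polynomial.const entry_polynomial.add)

lemma entry_polynomial_prod:
  "(\<And>i. i \<in> I \<Longrightarrow> entry_polynomial g n (p i)) \<Longrightarrow> entry_polynomial g n (\<lambda>X. \<Prod>i\<in>I. p i X)"
  by (induction I rule: infinite_finite_induct)
    (auto intro: entry_polynomial.const entry_polynomial.mult)

lemma entry_polynomial_power: "entry_polynomial g n p \<Longrightarrow> entry_polynomial g n (\<lambda>X. p X ^ m)"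
  by (induction m) (auto intro: entry_polynomial.const entry_polynomial.mult)

lemma entry_polynomial_tendsto:
  assumes "entry_polynomial g n p"
    and "\<And>t. t \<in> idx g n \<Longrightarrow> ((\<lambda>s. f s t) \<longlongrightarrow> x t) F"
  shows "((\<lambda>s. p (tup g n (f s))) \<longlongrightarrow> p (tup g n x)) F"
  using assms by (induction rule: entry_polynomial.induct)
    (auto intro!: tendsto_add tendsto_mult simp: tup_nth)

lemma entry_polynomial_holomorphic:
  assumes "entry_polynomial g n p" and "\<And>t. t \<in> idx g n \<Longrightarrow> (\<lambda>s. f s t) holomorphic_on S"
  shows "(\<lambda>s. p (tup g n (f s))) holomorphic_on S"
  using assms by (induction rule: entry_polynomial.induct)
    (auto intro!: holomorphic_intros simp: tup_nth)

lemma entry_polynomial_poly: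
  assumes "entry_polynomial g n p" and "\<And>t. t \<in> idx g n \<Longrightarrow> \<exists>P. \<forall>s. f s t = poly P s"
  shows "\<exists>P. \<forall>s. p (tup g n (f s)) = poly P s"
  using assms
proof (induction rule: entry_polynomial.induct)
  case (const a)
  then show ?case by (auto intro: exI[of _ "[:a:]"])
next
  case (add p q)
  then show ?case by (metis poly_add)
next
  case (mult p q)
  then show ?case by (metis poly_mult)
qed (auto simp: tup_nth)

text \<open>All coordinates share the denominator \<open>D\<close>, so sums can be brought to a
  common power of it. Along a rational curve a zero of \<open>p\<close> thereby becomes a root of a
  numerator polynomial.\<close>

lemma entry_polynomial_rational:
  assumes "entry_polynomial g n p"
    and "\<And>t. t \<in> idx g n \<Longrightarrow> \<exists>P. \<forall>s. poly D s \<noteq> 0 \<longrightarrow> f s t = poly P s / poly D s"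
  shows "\<exists>P m. \<forall>s. poly D s \<noteq> 0 \<longrightarrow> p (tup g n (f s)) = poly P s / poly D s ^ m"
  using assms
proof (induction rule: entry_polynomial.induct)
  case (const a)
  show ?case by (rule exI[of _ "[:a:]"], rule exI[of _ 0]) simp
next
  case (entry j r c)
  then obtain P where "\<forall>s. poly D s \<noteq> 0 \<longrightarrow> f s (j, r, c) = poly P s / poly D s" by force
  with entry show ?case by (intro exI[of _ P] exI[of _ 1]) (simp add: tup_nth)
next
  case (add p q)
  then obtain P m Q k where "\<forall>s. poly D s \<noteq> 0 \<longrightarrow> p (tup g n (f s)) = poly P s / poly D s ^ m"
    "\<forall>s. poly D s \<noteq> 0 \<longrightarrow> q (tup g n (f s)) = poly Q s / poly D s ^ k" by blast
  then show ?case
    by (intro exI[of _ "P * D ^ k + Q * D ^ m"] exI[of _ "m + k"]) (simp add: field_simps power_add)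
next
  case (mult p q)
  then obtain P m Q k where "\<forall>s. poly D s \<noteq> 0 \<longrightarrow> p (tup g n (f s)) = poly P s / poly D s ^ m"
    "\<forall>s. poly D s \<noteq> 0 \<longrightarrow> q (tup g n (f s)) = poly Q s / poly D s ^ k" by blast
  then show ?case
    by (intro exI[of _ "P * Q"] exI[of _ "m + k"]) (simp add: power_add)
qed

definition line :: "tuple \<Rightarrow> tuple \<Rightarrow> complex \<Rightarrow> tuple" where
  "line x y s = (\<lambda>t. x t + s * y t)"

lemma entry_polynomial_line:
  assumes "entry_polynomial g n p"
  obtains P where "\<And>s. p (tup g n (line x y s)) = poly P s"
proof -
  have "\<exists>P. \<forall>s. line x y s t = poly P s" for t
    by (rule exI[of _ "[:x t, y t:]"]) (simp add: line_def algebra_simps)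
  then have "\<exists>P. \<forall>s. p (tup g n (line x y s)) = poly P s"
    by (intro entry_polynomial_poly[OF assms]) blast
  then show ?thesis using that by blast
qed

text \<open>Affine space is irreducible: on the line joining \<open>x\<close> and \<open>y\<close>
  both factors restrict to nonzero polynomials in one variable, whose product is nonzero.\<close>

lemma entry_polynomial_mult_nonzero:
  assumes "entry_polynomial g n p" "entry_polynomial g n q"
    and "p (tup g n x) \<noteq> 0" "q (tup g n y) \<noteq> 0"
  shows "\<exists>z. p (tup g n z) * q (tup g n z) \<noteq> 0"
proof -
  let ?l = "line x (\<lambda>t. y t - x t)"
  obtain P where P: "\<And>s. p (tup g n (?l s)) = poly P s" using entry_polynomial_line[OF assms(1)] by blast
  obtain Q where Q: "\<And>s. q (tup g n (?l s)) = poly Q s" using entry_polynomial_line[OF assms(2)] by blast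
  have "?l 0 = x" "?l 1 = y" by (auto simp: line_def)
  then have "P * Q \<noteq> 0" using P[of 0] Q[of 1] assms by auto
  then obtain s where "poly (P * Q) s \<noteq> 0" using poly_all_0_iff_0 by blast
  then show ?thesis using P Q by (intro exI[of _ "?l s"]) simp
qed

lemma entry_polynomial_prod_nonzero:
  assumes "finite I" "\<And>i. i \<in> I \<Longrightarrow> entry_polynomial g n (p i)"
    and "\<And>i. i \<in> I \<Longrightarrow> \<exists>x. p i (tup g n x) \<noteq> 0"
  shows "\<exists>x. (\<Prod>i\<in>I. p i (tup g n x)) \<noteq> 0"
  using assms
proof (induction I rule: finite_induct)
  case (insert i I)
  then obtain x y where "p i (tup g n x) \<noteq> 0" "(\<Prod>i\<in>I. p i (tup g n y)) \<noteq> 0" by fastforce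
  with entry_polynomial_mult_nonzero[of g n "p i" "\<lambda>X. \<Prod>i\<in>I. p i X" x y] insert show ?case
    by (auto intro: entry_polynomial_prod)
qed simp

text \<open>Finitely many roots cannot exhaust an interval. This is how genericity is reached by
  real, hence hermitian, perturbations.\<close>

lemma poly_nonzero_real:
  fixes P :: "complex poly"
  assumes "P \<noteq> 0" and "0 < e"
  obtains s :: real where "0 < s" "s < e" "poly P (of_real s) \<noteq> 0"
proof (rule ccontr)
  assume "\<not> thesis"
  with that have "\<not> (\<exists>s::real. 0 < s \<and> s < e \<and> poly P (of_real s) \<noteq> 0)" by blast
  then have zero: "poly P (of_real s) = 0" if "0 < s" "s < e" for s :: real
    using that by blast
  from \<open>P \<noteq> 0\<close> have "finite {z. poly P z = 0}" by (rule poly_roots_finite)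
  then have "finite (complex_of_real ` {0<..<e})"
    by (rule finite_subset[rotated]) (use zero in auto)
  then have "finite {0<..<e}" by (rule finite_imageD) (simp add: inj_on_def)
  with \<open>0 < e\<close> show False using infinite_Ioo by blast
qed

section \<open>Hermitian tuples\<close>

definition herm :: "nat \<Rightarrow> nat \<Rightarrow> tuple \<Rightarrow> bool" where
  "herm g n x \<longleftrightarrow> (\<forall>j<g. \<forall>i<n. \<forall>k<n. cnj (x (j, i, k)) = x (j, k, i))"

lemma herm_line: "herm g n x \<Longrightarrow> herm g n y \<Longrightarrow> herm g n (line x y (of_real s))"
  by (auto simp: herm_def line_def)

text \<open>With \<open>im_part\<close> this is the Cartesian decomposition x = H + \<i> K into
  hermitian tuples: a complex tuple is the point \<i> of a line whose real points are
  hermitian.\<close>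

definition re_part :: "tuple \<Rightarrow> tuple" where
  "re_part x = (\<lambda>(j, i, k). (x (j, i, k) + cnj (x (j, k, i))) / 2)"

definition im_part :: "tuple \<Rightarrow> tuple" where
  "im_part x = (\<lambda>(j, i, k). (x (j, i, k) - cnj (x (j, k, i))) / (2 * \<i>))"

lemma herm_re_part: "herm g n (re_part x)" and herm_im_part: "herm g n (im_part x)"
  by (auto simp: herm_def re_part_def im_part_def add.commute right_diff_distrib)

lemma line_re_im: "line (re_part x) (im_part x) \<i> = x"
  by (auto simp: line_def re_part_def im_part_def fun_eq_iff diff_divide_distrib add_divide_distrib)

text \<open>Hermitian tuples are Zariski dense. The nonzero value at \<open>y\<close> gives one at a
  real point of the line through its hermitian parts; the line from \<open>x\<close> towards that
  hermitian tuple then leaves the zero set arbitrarily close to \<open>x\<close>.\<close>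

lemma herm_nonzero_near:
  assumes q: "entry_polynomial g n q" "q (tup g n y) \<noteq> 0" and x: "herm g n x" and e: "0 < e"
  shows "\<exists>h. herm g n h \<and> (\<exists>s. 0 < s \<and> s < e \<and> q (tup g n (line x h (of_real s))) \<noteq> 0)"
proof -
  define a b where "a = re_part y" and "b = im_part y"
  obtain P where P: "\<And>s. q (tup g n (line a b s)) = poly P s" using entry_polynomial_line[OF q(1)] by blast
  have "poly P \<i> \<noteq> 0" using P[of \<i>] q(2) by (simp add: a_def b_def line_re_im)
  then have "P \<noteq> 0" by auto
  then obtain z where z: "poly P (complex_of_real z) \<noteq> 0"
    by (rule poly_nonzero_real[of P 1]) simp_all
  define h where "h = line a b (of_real z)"
  define h' where "h' = (\<lambda>t. h t - x t)"
  have h: "herm g n h" unfolding h_def a_def b_def by (intro herm_line herm_re_part herm_im_part)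
  have h': "herm g n h'" using h x by (auto simp: herm_def h'_def)
  obtain R where R: "\<And>s. q (tup g n (line x h' s)) = poly R s" using entry_polynomial_line[OF q(1)] by blast
  have "line x h' 1 = h" by (auto simp: line_def h'_def)
  then have "poly R 1 \<noteq> 0" using R[of 1] P[of "of_real z"] z by (simp add: h_def)
  then have "R \<noteq> 0" by auto
  then obtain s :: real where "0 < s" "s < e" "poly R (of_real s) \<noteq> 0"
    by (rule poly_nonzero_real[OF _ e])
  then show ?thesis using R h' by (intro exI[of _ h'] conjI exI[of _ s]) auto
qed

section \<open>Images of polynomial maps with few parameters\<close>

definition scale_fun :: "complex \<Rightarrow> ('x \<Rightarrow> complex) \<Rightarrow> 'x \<Rightarrow> complex" where
  "scale_fun c f = (\<lambda>x. c * f x)"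

global_interpretation fv: vector_space "scale_fun :: complex \<Rightarrow> ('x \<Rightarrow> complex) \<Rightarrow> 'x \<Rightarrow> complex"
  by unfold_locales (auto simp: scale_fun_def fun_eq_iff algebra_simps)

lemma sum_fun_apply: "(\<Sum>i\<in>I. f i) x = (\<Sum>i\<in>I. f i x)" for f :: "'i \<Rightarrow> 'x \<Rightarrow> complex"
  by (induction I rule: infinite_finite_induct) auto

text \<open>The family may repeat values, since the number of indices is what is compared with the
  dimension: a repetition gives the relation with coefficients 1 and -1, and an injective family is
  too large to be independent.\<close>

lemma linear_relation:
  fixes f :: "'a \<Rightarrow> 'x \<Rightarrow> complex"
  assumes "finite A" "finite B" "card B < card A" "\<And>a. a \<in> A \<Longrightarrow> f a \<in> fv.span B"
  shows "\<exists>c. (\<exists>a\<in>A. c a \<noteq> 0) \<and> (\<forall>x. (\<Sum>a\<in>A. c a * f a x) = 0)"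
proof (cases "inj_on f A")
  case True
  then have "card (f ` A) = card A" by (rule card_image)
  then have "fv.dependent (f ` A)"
    using fv.independent_span_bound[OF assms(2), of "f ` A"] assms by force
  then obtain u where u: "\<exists>v\<in>f ` A. u v \<noteq> 0" "(\<Sum>v\<in>f ` A. scale_fun (u v) v) = 0"
    unfolding fv.dependent_finite[OF finite_imageI[OF assms(1)]] by blast
  have "(\<Sum>a\<in>A. u (f a) * f a x) = 0" for x
  proof -
    have "(\<Sum>a\<in>A. u (f a) * f a x) = (\<Sum>v\<in>f ` A. scale_fun (u v) v x)"
      using True by (simp add: sum.reindex scale_fun_def)
    also have "\<dots> = 0" using u(2) by (metis sum_fun_apply zero_fun_apply)
    finally show ?thesis .
  qed
  with u(1) show ?thesis by (intro exI[of _ "u \<circ> f"]) auto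
next
  case False
  then obtain a b where ab: "a \<in> A" "b \<in> A" "a \<noteq> b" "f a = f b" by (auto simp: inj_on_def)
  define c :: "'a \<Rightarrow> complex" where "c = (\<lambda>e. if e = a then 1 else if e = b then - 1 else 0)"
  have "(\<Sum>e\<in>A. c e * f e x) = 0" for x
  proof -
    have "(\<Sum>e\<in>A. c e * f e x) = (\<Sum>e\<in>{a, b}. c e * f e x)"
      by (rule sum.mono_neutral_right) (use assms(1) ab in \<open>auto simp: c_def\<close>)
    then show ?thesis using ab by (simp add: c_def)
  qed
  with ab show ?thesis by (intro exI[of _ c]) (auto simp: c_def)
qed

definition mono_fun :: "'s set \<Rightarrow> ('s \<Rightarrow> nat) \<Rightarrow> ('s \<Rightarrow> complex) \<Rightarrow> complex" where
  "mono_fun S e = (\<lambda>\<theta>. \<Prod>s\<in>S. \<theta> s ^ e s)"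

text \<open>Degrees are bounded in each variable separately, which makes the number of monomials at
  most \<open>(D + 1) ^ card S\<close>. They are functions, not formal expressions.\<close>

definition monomials :: "'s set \<Rightarrow> nat \<Rightarrow> (('s \<Rightarrow> complex) \<Rightarrow> complex) set" where
  "monomials S D = mono_fun S ` (S \<rightarrow>\<^sub>E {..D})"

lemma finite_monomials: "finite S \<Longrightarrow> finite (monomials S D)"
  by (simp add: monomials_def finite_PiE)

lemma card_monomials_le: "finite S \<Longrightarrow> card (monomials S D) \<le> (D + 1) ^ card S"
  unfolding monomials_def
  by (rule order_trans[OF card_image_le]) (auto simp: finite_PiE card_PiE)

lemma mono_fun_in_monomials: "(\<And>s. s \<in> S \<Longrightarrow> e s \<le> D) \<Longrightarrow> mono_fun S e \<in> monomials S D"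
  unfolding monomials_def
  by (rule image_eqI[of _ _ "restrict e S"]) (auto simp: mono_fun_def)

lemma monomials_mult:
  assumes "m \<in> monomials S D" "m' \<in> monomials S D'"
  shows "(\<lambda>\<theta>. m \<theta> * m' \<theta>) \<in> monomials S (D + D')"
proof -
  obtain e e' where e: "m = mono_fun S e" "m' = mono_fun S e'" "e \<in> S \<rightarrow>\<^sub>E {..D}" "e' \<in> S \<rightarrow>\<^sub>E {..D'}"
    using assms by (auto simp: monomials_def)
  have "(\<lambda>\<theta>. m \<theta> * m' \<theta>) = mono_fun S (\<lambda>s. e s + e' s)"
    by (simp add: e mono_fun_def power_add prod.distrib)
  moreover have "e s + e' s \<le> D + D'" if "s \<in> S" for s
    using e(3,4) that by (intro add_mono) (auto simp: PiE_iff)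
  ultimately show ?thesis by (simp add: mono_fun_in_monomials)
qed

lemma span_monomials_mult:
  assumes f: "f \<in> fv.span (monomials S D)" and h: "h \<in> fv.span (monomials S D')"
  shows "(\<lambda>\<theta>. f \<theta> * h \<theta>) \<in> fv.span (monomials S (D + D'))"
proof -
  have *: "(\<lambda>\<theta>. m \<theta> * h \<theta>) \<in> fv.span (monomials S (D + D'))" if "m \<in> monomials S D" for m
    using h
  proof (induction rule: fv.span_induct_alt)
    case base
    show ?case using fv.span_zero by (simp add: zero_fun_def)
  next
    case (step c x y)
    have "(\<lambda>\<theta>. m \<theta> * (scale_fun c x + y) \<theta>) = scale_fun c (\<lambda>\<theta>. m \<theta> * x \<theta>) + (\<lambda>\<theta>. m \<theta> * y \<theta>)"
      by (auto simp: scale_fun_def algebra_simps)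
    moreover have "(\<lambda>\<theta>. m \<theta> * x \<theta>) \<in> fv.span (monomials S (D + D'))"
      by (intro fv.span_base monomials_mult that step(1))
    ultimately show ?case
      using step(2) by (auto intro: fv.span_add fv.span_scale)
  qed
  show ?thesis using f
  proof (induction rule: fv.span_induct_alt)
    case base
    show ?case using fv.span_zero by (simp add: zero_fun_def)
  next
    case (step c x y)
    have "(\<lambda>\<theta>. (scale_fun c x + y) \<theta> * h \<theta>) = scale_fun c (\<lambda>\<theta>. x \<theta> * h \<theta>) + (\<lambda>\<theta>. y \<theta> * h \<theta>)"
      by (auto simp: scale_fun_def algebra_simps)
    with *[OF step(1)] step(2) show ?case
      by (auto intro: fv.span_add fv.span_scale)
  qed
qed

lemma monomials_mono: "D \<le> D' \<Longrightarrow> monomials S D \<subseteq> monomials S D'"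
  unfolding monomials_def by (intro image_mono PiE_mono) auto

lemma span_monomials_mono: "f \<in> fv.span (monomials S D) \<Longrightarrow> D \<le> D' \<Longrightarrow> f \<in> fv.span (monomials S D')"
  using fv.span_mono[OF monomials_mono] by blast

lemma span_monomials_const: "(\<lambda>_. a) \<in> fv.span (monomials S D)"
proof -
  have "mono_fun S (\<lambda>_. 0) \<in> fv.span (monomials S D)"
    by (intro fv.span_base mono_fun_in_monomials) auto
  from fv.span_scale[OF this, of a] show ?thesis by (simp add: scale_fun_def mono_fun_def)
qed

lemma span_monomials_power:
  assumes "f \<in> fv.span (monomials S D)"
  shows "(\<lambda>\<theta>. f \<theta> ^ m) \<in> fv.span (monomials S (m * D))"
proof (induction m)
  case (Suc m)
  from span_monomials_mult[OF assms Suc] show ?case by simp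
qed (simp add: span_monomials_const)

lemma span_monomials_prod:
  assumes "finite T" "\<And>t. t \<in> T \<Longrightarrow> f t \<in> fv.span (monomials S D)"
  shows "(\<lambda>\<theta>. \<Prod>t\<in>T. f t \<theta>) \<in> fv.span (monomials S (card T * D))"
  using assms
proof (induction T rule: finite_induct)
  case (insert t T)
  then have "f t \<in> fv.span (monomials S D)" "(\<lambda>\<theta>. \<Prod>t\<in>T. f t \<theta>) \<in> fv.span (monomials S (card T * D))" by auto
  from span_monomials_mult[OF this] insert show ?case by simp
qed (simp add: span_monomials_const)

inductive param_poly :: "'s set \<Rightarrow> (('s \<Rightarrow> complex) \<Rightarrow> complex) \<Rightarrow> bool" for S where
  const: "param_poly S (\<lambda>_. a)"
| var: "s \<in> S \<Longrightarrow> param_poly S (\<lambda>\<theta>. \<theta> s)"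
| add: "param_poly S p \<Longrightarrow> param_poly S q \<Longrightarrow> param_poly S (\<lambda>\<theta>. p \<theta> + q \<theta>)"
| mult: "param_poly S p \<Longrightarrow> param_poly S q \<Longrightarrow> param_poly S (\<lambda>\<theta>. p \<theta> * q \<theta>)"

lemma param_poly_diff:
  assumes "param_poly S p" "param_poly S q"
  shows "param_poly S (\<lambda>\<theta>. p \<theta> - q \<theta>)"
proof -
  have "param_poly S (\<lambda>\<theta>. p \<theta> + (- 1) * q \<theta>)" by (intro assms param_poly.intros)
  then show ?thesis by simp
qed

lemma param_poly_sum:
  "(\<And>i. i \<in> I \<Longrightarrow> param_poly S (p i)) \<Longrightarrow> param_poly S (\<lambda>\<theta>. \<Sum>i\<in>I. p i \<theta>)"
  by (induction I rule: infinite_finite_induct) (auto intro: param_poly.intros)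

lemma param_poly_span:
  assumes "finite S" "param_poly S p"
  shows "\<exists>D. p \<in> fv.span (monomials S D)"
  using assms(2)
proof (induction rule: param_poly.induct)
  case (const a)
  show ?case using span_monomials_const by blast
next
  case (var s)
  have "(\<lambda>\<theta>. \<theta> s) = mono_fun S (\<lambda>s'. if s' = s then 1 else 0)"
  proof
    fix \<theta> :: "'a \<Rightarrow> complex"
    have "mono_fun S (\<lambda>s'. if s' = s then 1 else 0) \<theta> = (\<Prod>s'\<in>S. if s' = s then \<theta> s' else 1)"
      unfolding mono_fun_def by (rule prod.cong) auto
    also have "\<dots> = \<theta> s" using var \<open>finite S\<close> by simp
    finally show "\<theta> s = mono_fun S (\<lambda>s'. if s' = s then 1 else 0) \<theta>" by simp
  qed
  also have "\<dots> \<in> monomials S 1" by (rule mono_fun_in_monomials) auto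
  finally show ?case using fv.span_base by blast
next
  case (add p q)
  then obtain D D' where "p \<in> fv.span (monomials S D)" "q \<in> fv.span (monomials S D')" by blast
  then have "p \<in> fv.span (monomials S (max D D'))" "q \<in> fv.span (monomials S (max D D'))"
    by (auto intro: span_monomials_mono)
  from fv.span_add[OF this] show ?case by (auto simp: plus_fun_def)
next
  case (mult p q)
  then show ?case using span_monomials_mult by blast
qed

text \<open>With \<open>N\<close> coordinates depending polynomially on \<open>a < N\<close> parameters there are more monomials of
  degree at most \<open>D\<close> in the coordinates than there are dimensions for their composites.\<close>

lemma algebraic_dependence:
  fixes \<phi> :: "'t \<Rightarrow> ('s \<Rightarrow> complex) \<Rightarrow> complex"
  assumes "finite S" "finite T" "card S < card T" and \<phi>: "\<And>t. t \<in> T \<Longrightarrow> param_poly S (\<phi> t)"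
  shows "\<exists>c D. (\<exists>\<alpha>\<in>T \<rightarrow>\<^sub>E {..D}. c \<alpha> \<noteq> 0) \<and>
    (\<forall>\<theta>. (\<Sum>\<alpha>\<in>T \<rightarrow>\<^sub>E {..D}. c \<alpha> * (\<Prod>t\<in>T. \<phi> t \<theta> ^ \<alpha> t)) = 0)"
proof -
  have "\<forall>t\<in>T. \<exists>D. \<phi> t \<in> fv.span (monomials S D)" using param_poly_span[OF assms(1)] \<phi> by blast
  then obtain \<delta> where \<delta>: "\<And>t. t \<in> T \<Longrightarrow> \<phi> t \<in> fv.span (monomials S (\<delta> t))" by metis
  define \<Delta> where "\<Delta> = (\<Sum>t\<in>T. \<delta> t)"
  have \<Delta>: "\<phi> t \<in> fv.span (monomials S \<Delta>)" if "t \<in> T" for t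
    using span_monomials_mono[OF \<delta>[OF that]] member_le_sum[OF that, of \<delta>] assms(2) unfolding \<Delta>_def by simp
  \<comment> \<open>\<open>K\<close> absorbs the growth of degrees: N D \<Delta> + 1 is at most K (D
    + 1). With D = K^a the a-th power of this bound is D (D + 1)^a, which is below (D + 1)^(a + 1)
    and hence below the number of exponents.\<close>
  define N a K where "N = card T" and "a = card S" and "K = N * \<Delta> + 1"
  define D where "D = K ^ a"
  have span: "(\<lambda>\<theta>. \<Prod>t\<in>T. \<phi> t \<theta> ^ \<alpha> t) \<in> fv.span (monomials S (N * (D * \<Delta>)))"
    if "\<alpha> \<in> T \<rightarrow>\<^sub>E {..D}" for \<alpha>
    unfolding N_def
  proof (rule span_monomials_prod[OF assms(2)])
    fix t assume "t \<in> T"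
    then show "(\<lambda>\<theta>. \<phi> t \<theta> ^ \<alpha> t) \<in> fv.span (monomials S (D * \<Delta>))"
      using that by (intro span_monomials_mono[OF span_monomials_power[OF \<Delta>]]) (auto simp: PiE_iff)
  qed
  have "card (monomials S (N * (D * \<Delta>))) \<le> (N * (D * \<Delta>) + 1) ^ a"
    using card_monomials_le[OF assms(1)] unfolding a_def .
  also have "\<dots> \<le> (K * (D + 1)) ^ a"
    by (intro power_mono) (auto simp: K_def algebra_simps)
  also have "\<dots> = D * (D + 1) ^ a" by (simp only: power_mult_distrib D_def)
  also have "\<dots> < (D + 1) * (D + 1) ^ a" by simp
  also have "\<dots> = (D + 1) ^ Suc a" by simp
  also have "\<dots> \<le> (D + 1) ^ N"
    using assms(3) unfolding a_def N_def by (intro power_increasing) auto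
  also have "\<dots> = card (T \<rightarrow>\<^sub>E {..D})" using assms(2) by (simp add: card_PiE N_def)
  finally have card: "card (monomials S (N * (D * \<Delta>))) < card (T \<rightarrow>\<^sub>E {..D})" .
  have "finite (T \<rightarrow>\<^sub>E {..D})" using assms(2) by (simp add: finite_PiE)
  from linear_relation[OF this finite_monomials[OF assms(1)] card span]
  obtain c where "(\<exists>\<alpha>\<in>T \<rightarrow>\<^sub>E {..D}. c \<alpha> \<noteq> 0) \<and>
    (\<forall>\<theta>. (\<Sum>\<alpha>\<in>T \<rightarrow>\<^sub>E {..D}. c \<alpha> * (\<Prod>t\<in>T. \<phi> t \<theta> ^ \<alpha> t)) = 0)" ..
  then show ?thesis by (intro exI)
qed

text \<open>Induction on the variables: fixing the exponent \<open>e0\<close> of the new variable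
  leaves a nonzero polynomial in the others. At a point where it does not vanish, the whole is a
  nonzero polynomial \<open>P\<close> in one variable.\<close>

lemma multi_poly_nonzero:
  fixes c :: "('t \<Rightarrow> nat) \<Rightarrow> complex"
  assumes "finite T" "\<exists>\<alpha>\<in>T \<rightarrow>\<^sub>E {..D}. c \<alpha> \<noteq> 0"
  shows "\<exists>x. (\<Sum>\<alpha>\<in>T \<rightarrow>\<^sub>E {..D}. c \<alpha> * (\<Prod>t\<in>T. x t ^ \<alpha> t)) \<noteq> 0"
  using assms
proof (induction T arbitrary: c rule: finite_induct)
  case (insert t T)
  have inj: "inj_on (\<lambda>(e, \<alpha>). \<alpha>(t := e)) ({..D} \<times> (T \<rightarrow>\<^sub>E {..D}))"
    using inj_combinator[OF insert(2), of "\<lambda>_. {..D}"] by simp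
  have eq: "insert t T \<rightarrow>\<^sub>E {..D} = (\<lambda>(e, \<alpha>). \<alpha>(t := e)) ` ({..D} \<times> (T \<rightarrow>\<^sub>E {..D}))"
    by (simp add: PiE_insert_eq)
  from insert(4) obtain e0 \<alpha>0 where e0: "e0 \<le> D" "\<alpha>0 \<in> T \<rightarrow>\<^sub>E {..D}" "c (\<alpha>0(t := e0)) \<noteq> 0"
    unfolding eq by auto
  then obtain x where x: "(\<Sum>\<alpha>\<in>T \<rightarrow>\<^sub>E {..D}. c (\<alpha>(t := e0)) * (\<Prod>s\<in>T. x s ^ \<alpha> s)) \<noteq> 0"
    using insert(3)[of "\<lambda>\<alpha>. c (\<alpha>(t := e0))"] by blast
  define C where "C e = (\<Sum>\<alpha>\<in>T \<rightarrow>\<^sub>E {..D}. c (\<alpha>(t := e)) * (\<Prod>s\<in>T. x s ^ \<alpha> s))" for e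
  define P where "P = (\<Sum>e\<le>D. monom (C e) e)"
  have "coeff P e0 = C e0" using e0 by (simp add: P_def coeff_sum)
  then have "P \<noteq> 0" using x by (auto simp: C_def)
  then obtain z where z: "poly P z \<noteq> 0" using poly_all_0_iff_0 by blast
  have "(\<Sum>\<alpha>\<in>insert t T \<rightarrow>\<^sub>E {..D}. c \<alpha> * (\<Prod>s\<in>insert t T. (x(t := z)) s ^ \<alpha> s))
      = (\<Sum>(e, \<alpha>)\<in>{..D} \<times> (T \<rightarrow>\<^sub>E {..D}).
          c (\<alpha>(t := e)) * (\<Prod>s\<in>insert t T. (x(t := z)) s ^ (\<alpha>(t := e)) s))"
    unfolding eq by (subst sum.reindex[OF inj]) (simp add: case_prod_unfold)
  also have "\<dots> = (\<Sum>(e, \<alpha>)\<in>{..D} \<times> (T \<rightarrow>\<^sub>E {..D}).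
          (c (\<alpha>(t := e)) * (\<Prod>s\<in>T. x s ^ \<alpha> s)) * z ^ e)"
  proof (rule sum.cong[OF refl], clarify)
    fix e \<alpha>
    have "(\<Prod>s\<in>T. (x(t := z)) s ^ (\<alpha>(t := e)) s) = (\<Prod>s\<in>T. x s ^ \<alpha> s)"
      using insert(2) by (intro prod.cong) auto
    then show "c (\<alpha>(t := e)) * (\<Prod>s\<in>insert t T. (x(t := z)) s ^ (\<alpha>(t := e)) s) =
        c (\<alpha>(t := e)) * (\<Prod>s\<in>T. x s ^ \<alpha> s) * z ^ e"
      using insert(1,2) by simp
  qed
  also have "\<dots> = (\<Sum>e\<le>D. C e * z ^ e)"
    by (simp add: sum.cartesian_product[symmetric] C_def sum_distrib_right)
  also have "\<dots> = poly P z" by (simp add: P_def poly_sum poly_monom)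
  finally show ?case using z by metis
qed auto

text \<open>The algebraic dependence among the coordinates is itself the equation of the
  hypersurface, and \<open>multi_poly_nonzero\<close> keeps it from being the zero function.\<close>

lemma image_in_hypersurface:
  assumes "finite S" "card S < g * n\<^sup>2" and "\<And>t. t \<in> idx g n \<Longrightarrow> param_poly S (\<phi> t)"
  shows "\<exists>q. entry_polynomial g n q \<and> (\<exists>x. q (tup g n x) \<noteq> 0) \<and>
    (\<forall>\<theta>. q (tup g n (\<lambda>t. \<phi> t \<theta>)) = 0)"
proof -
  have "card (idx g n) = g * n\<^sup>2" by (simp add: card_cartesian_product power2_eq_square)
  then have "card S < card (idx g n)" using assms(2) by (simp add: power2_eq_square)
  from algebraic_dependence[where \<phi> = \<phi>, OF assms(1) _ this assms(3)]
  obtain c D where c: "\<exists>\<alpha>\<in>idx g n \<rightarrow>\<^sub>E {..D}. c \<alpha> \<noteq> 0"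
    "\<And>\<theta>. (\<Sum>\<alpha>\<in>idx g n \<rightarrow>\<^sub>E {..D}. c \<alpha> * (\<Prod>t\<in>idx g n. \<phi> t \<theta> ^ \<alpha> t)) = 0"
    by (auto simp del: mem_Sigma_iff)
  define q where "q X = (\<Sum>\<alpha>\<in>idx g n \<rightarrow>\<^sub>E {..D}. c \<alpha> * (\<Prod>t\<in>idx g n. untup X t ^ \<alpha> t))" for X
  have q: "q (tup g n x) = (\<Sum>\<alpha>\<in>idx g n \<rightarrow>\<^sub>E {..D}. c \<alpha> * (\<Prod>t\<in>idx g n. x t ^ \<alpha> t))" for x
    unfolding q_def by (intro sum.cong refl arg_cong2[where f = "(*)"] prod.cong) (simp add: untup_tup)
  have "entry_polynomial g n q" unfolding q_def
    by (intro entry_polynomial_sum entry_polynomial.mult entry_polynomial.const entry_polynomial_prod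
        entry_polynomial_power entry_polynomial_entry_tup)
  moreover have "\<exists>x. q (tup g n x) \<noteq> 0"
    unfolding q by (rule multi_poly_nonzero) (use c(1) in auto)
  ultimately show ?thesis using c(2) q by (intro exI[of _ q]) auto
qed

section \<open>Minimal invariant subspaces of hermitian tuples\<close>

text \<open>Functions supported below \<open>d\<close> model vectors of length \<open>d\<close>, so
  that subspaces for every \<open>d\<close> share one type and one scalar action.\<close>

definition vecs :: "nat \<Rightarrow> (nat \<Rightarrow> complex) set" where
  "vecs d = {v. \<forall>a\<ge>d. v a = 0}"

definition cinner :: "nat \<Rightarrow> (nat \<Rightarrow> complex) \<Rightarrow> (nat \<Rightarrow> complex) \<Rightarrow> complex" where
  "cinner d u v = (\<Sum>a<d. u a * cnj (v a))"

definition act :: "nat \<Rightarrow> (nat \<Rightarrow> nat \<Rightarrow> complex) \<Rightarrow> (nat \<Rightarrow> complex) \<Rightarrow> nat \<Rightarrow> complex" where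
  "act d B v = (\<lambda>a. if a < d then \<Sum>b<d. B a b * v b else 0)"

definition invariant :: "nat \<Rightarrow> nat \<Rightarrow> (nat \<Rightarrow> nat \<Rightarrow> nat \<Rightarrow> complex) \<Rightarrow> (nat \<Rightarrow> complex) set \<Rightarrow> bool" where
  "invariant g d \<alpha> S \<longleftrightarrow> fv.subspace S \<and> S \<subseteq> vecs d \<and> (\<forall>j<g. \<forall>v\<in>S. act d (\<alpha> j) v \<in> S)"

definition irred :: "nat \<Rightarrow> nat \<Rightarrow> (nat \<Rightarrow> nat \<Rightarrow> nat \<Rightarrow> complex) \<Rightarrow> bool" where
  "irred g d \<alpha> \<longleftrightarrow> (\<forall>S. invariant g d \<alpha> S \<longrightarrow> S = {0} \<or> S = vecs d)"

definition herm_coeff :: "nat \<Rightarrow> nat \<Rightarrow> (nat \<Rightarrow> nat \<Rightarrow> nat \<Rightarrow> complex) \<Rightarrow> bool" where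
  "herm_coeff g d \<alpha> \<longleftrightarrow> (\<forall>j<g. \<forall>a<d. \<forall>b<d. cnj (\<alpha> j a b) = \<alpha> j b a)"

lemma subspace_vecs: "fv.subspace (vecs d)"
  by (auto simp: fv.subspace_def vecs_def scale_fun_def)

lemma act_vecs [simp]: "act d B v \<in> vecs d"
  by (simp add: act_def vecs_def)

lemma invariant_vecs: "invariant g d \<alpha> (vecs d)"
  by (simp add: invariant_def subspace_vecs)

lemma act_scale: "act d B (scale_fun c v) = scale_fun c (act d B v)"
  by (auto simp: act_def fun_eq_iff scale_fun_def sum_distrib_left mult_ac)

lemma act_sum: "act d B (\<Sum>i\<in>I. f i) = (\<Sum>i\<in>I. act d B (f i))"
  by (auto simp: act_def fun_eq_iff sum_fun_apply sum_distrib_left sum.swap[of _ I])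

lemma cinner_add_left: "cinner d (u + v) w = cinner d u w + cinner d v w"
  by (simp add: cinner_def algebra_simps sum.distrib)

lemma cinner_diff_left: "cinner d (u - v) w = cinner d u w - cinner d v w"
  by (simp add: cinner_def algebra_simps sum_subtractf)

lemma cinner_scale_left: "cinner d (scale_fun c v) w = c * cinner d v w"
  by (simp add: cinner_def scale_fun_def sum_distrib_left mult_ac)

lemma cinner_zero_left [simp]: "cinner d 0 w = 0"
  by (simp add: cinner_def)

lemma cinner_sum_left: "cinner d (\<Sum>i\<in>I. f i) w = (\<Sum>i\<in>I. cinner d (f i) w)"
  by (simp add: cinner_def sum_fun_apply sum_distrib_right sum.swap[of _ I])

lemma cinner_commute: "cinner d v w = cnj (cinner d w v)"
  by (simp add: cinner_def mult.commute)

lemma cinner_scale_right: "cinner d v (scale_fun c w) = cnj c * cinner d v w"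
  by (subst cinner_commute) (simp add: cinner_scale_left cinner_commute[of d v w])

lemma cinner_self: "cinner d v v = of_real (\<Sum>a<d. (cmod (v a))\<^sup>2)"
  by (simp add: cinner_def complex_norm_square[symmetric])

lemma cinner_self_zero_iff: "v \<in> vecs d \<Longrightarrow> cinner d v v = 0 \<longleftrightarrow> v = 0"
  unfolding cinner_self of_real_eq_0_iff
  by (subst sum_nonneg_eq_0_iff) (auto simp: vecs_def fun_eq_iff, metis lessThan_iff not_less)

lemma cinner_act_herm:
  assumes "herm_coeff g d \<alpha>" "j < g"
  shows "cinner d (act d (\<alpha> j) v) w = cinner d v (act d (\<alpha> j) w)"
proof -
  have "cinner d (act d (\<alpha> j) v) w = (\<Sum>a<d. \<Sum>b<d. \<alpha> j a b * v b * cnj (w a))"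
    by (simp add: cinner_def act_def sum_distrib_right)
  also have "\<dots> = (\<Sum>b<d. \<Sum>a<d. \<alpha> j a b * v b * cnj (w a))" by (rule sum.swap)
  also have "\<dots> = cinner d v (act d (\<alpha> j) w)"
    using assms by (auto simp: cinner_def act_def sum_distrib_left herm_coeff_def intro!: sum.cong)
  finally show ?thesis .
qed

section \<open>Orthonormal families and the dimension of a subspace\<close>

definition onf :: "nat \<Rightarrow> (nat \<Rightarrow> complex) list \<Rightarrow> bool" where
  "onf d us \<longleftrightarrow> (\<forall>i<length us. \<forall>j<length us. cinner d (us ! i) (us ! j) = (if i = j then 1 else 0))"

definition proj :: "nat \<Rightarrow> (nat \<Rightarrow> complex) list \<Rightarrow> (nat \<Rightarrow> complex) \<Rightarrow> nat \<Rightarrow> complex" where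
  "proj d us v = (\<Sum>i<length us. scale_fun (cinner d v (us ! i)) (us ! i))"

lemma vecs_span: "\<exists>B. finite B \<and> card B \<le> d \<and> vecs d \<subseteq> fv.span B"
proof -
  define e :: "nat \<Rightarrow> nat \<Rightarrow> complex" where "e = (\<lambda>a b. if b = a then 1 else 0)"
  define B where "B = e ` {..<d}"
  have "v \<in> fv.span B" if "v \<in> vecs d" for v
  proof -
    have "v = (\<Sum>a<d. scale_fun (v a) (e a))"
    proof
      fix b
      have "(\<Sum>a<d. v a * e a b) = (\<Sum>a<d. if a = b then v b else 0)"
        by (rule sum.cong) (auto simp: e_def)
      then show "v b = (\<Sum>a<d. scale_fun (v a) (e a)) b"
        using that by (auto simp: sum_fun_apply scale_fun_def vecs_def)
    qed
    also have "\<dots> \<in> fv.span B"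
      by (intro fv.span_sum fv.span_scale fv.span_base) (auto simp: B_def)
    finally show ?thesis .
  qed
  moreover have "finite B" "card B \<le> d" using card_image_le[of "{..<d}" e] by (auto simp: B_def)
  ultimately show ?thesis by blast
qed

lemma onf_length_le:
  assumes "onf d us" "set us \<subseteq> vecs d"
  shows "length us \<le> d"
proof (rule ccontr)
  assume "\<not> length us \<le> d"
  obtain B where B: "finite B" "card B \<le> d" "vecs d \<subseteq> fv.span B" using vecs_span by blast
  have "\<exists>c. (\<exists>a\<in>{..<length us}. c a \<noteq> 0) \<and> (\<forall>x. (\<Sum>a\<in>{..<length us}. c a * (us ! a) x) = 0)"
    using B \<open>\<not> length us \<le> d\<close> assms(2) by (intro linear_relation[where B = B]) (auto simp: subset_iff)
  then obtain c where c: "\<exists>a\<in>{..<length us}. c a \<noteq> 0"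
    "\<And>x. (\<Sum>a\<in>{..<length us}. c a * (us ! a) x) = 0" by blast
  then obtain k where k: "k < length us" "c k \<noteq> 0" by auto
  have "(\<Sum>i<length us. scale_fun (c i) (us ! i)) = 0"
    using c(2) by (simp add: fun_eq_iff sum_fun_apply scale_fun_def)
  then have "(\<Sum>i<length us. c i * cinner d (us ! i) (us ! k)) = 0"
    by (metis (no_types, lifting) cinner_sum_left cinner_scale_left cinner_zero_left sum.cong)
  moreover have "(\<Sum>i<length us. c i * cinner d (us ! i) (us ! k)) = (\<Sum>i<length us. if i = k then c k else 0)"
    using assms(1) k by (intro sum.cong) (auto simp: onf_def)
  ultimately show False using k by simp
qed

lemma proj_in: "fv.subspace S \<Longrightarrow> set us \<subseteq> S \<Longrightarrow> proj d us v \<in> S"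
  unfolding proj_def by (intro fv.subspace_sum fv.subspace_scale) auto

lemma cinner_proj:
  assumes "onf d us" "j < length us"
  shows "cinner d (proj d us v) (us ! j) = cinner d v (us ! j)"
proof -
  have "cinner d (proj d us v) (us ! j) = (\<Sum>i<length us. if i = j then cinner d v (us ! j) else 0)"
    unfolding proj_def cinner_sum_left cinner_scale_left
    using assms by (intro sum.cong) (auto simp: onf_def)
  then show ?thesis using assms(2) by simp
qed

lemma onf_extend:
  assumes "onf d us" "fv.subspace T" "T \<subseteq> vecs d" "set us \<subseteq> T" "v \<in> T" "v \<noteq> proj d us v"
  shows "\<exists>u\<in>T. onf d (us @ [u])"
proof -
  define r where "r = v - proj d us v"
  have r: "r \<in> T" "r \<noteq> 0"
    using assms fv.subspace_diff[OF assms(2,5) proj_in[OF assms(2,4)]] by (auto simp: r_def)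
  have orth: "cinner d r (us ! j) = 0" if "j < length us" for j
    using cinner_proj[OF assms(1) that] by (simp add: r_def cinner_diff_left)
  define s where "s = (\<Sum>a<d. (cmod (r a))\<^sup>2)"
  have s: "cinner d r r = of_real s" by (simp add: cinner_self s_def)
  have "s \<noteq> 0" using cinner_self_zero_iff[of r d] r assms(3) s by auto
  then have "s > 0" unfolding s_def by (metis less_eq_real_def sum_nonneg zero_le_power2)
  define u where "u = scale_fun (of_real (1 / sqrt s)) r"
  have "u \<in> T" unfolding u_def by (intro fv.subspace_scale assms r)
  moreover have "cinner d u u = 1"
    using \<open>s > 0\<close> by (simp add: u_def cinner_scale_left cinner_scale_right s flip: of_real_mult)
  moreover have u: "cinner d u (us ! j) = 0" if "j < length us" for j
    using orth[OF that] by (simp add: u_def cinner_scale_left)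
  moreover have "cinner d (us ! j) u = 0" if "j < length us" for j
    using u[OF that] by (subst cinner_commute) simp
  ultimately show ?thesis using assms(1)
    by (intro bexI[of _ u]) (auto simp: onf_def nth_append less_Suc_eq)
qed

text \<open>For a subspace this is the dimension, measured by the longest orthonormal list. It is
  the induction measure for invariant subspaces.\<close>

definition rk :: "nat \<Rightarrow> (nat \<Rightarrow> complex) set \<Rightarrow> nat" where
  "rk d S = Max {length us | us. onf d us \<and> set us \<subseteq> S}"

lemma rk_props:
  assumes "S \<subseteq> vecs d"
  shows "\<exists>us. onf d us \<and> set us \<subseteq> S \<and> length us = rk d S"
    and "onf d us \<Longrightarrow> set us \<subseteq> S \<Longrightarrow> length us \<le> rk d S"
proof -
  let ?L = "{length us | us. onf d us \<and> set us \<subseteq> S}"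
  have "?L \<subseteq> {..d}" using onf_length_le assms by auto
  then have fin: "finite ?L" by (rule finite_subset) simp
  have "onf d [] \<and> set [] \<subseteq> S" by (simp add: onf_def)
  then have "?L \<noteq> {}" by blast
  from Max_in[OF fin this] show "\<exists>us. onf d us \<and> set us \<subseteq> S \<and> length us = rk d S"
    unfolding rk_def by auto
  show "onf d us \<Longrightarrow> set us \<subseteq> S \<Longrightarrow> length us \<le> rk d S"
    unfolding rk_def using Max_ge[OF fin] by blast
qed

lemma onb_exists:
  assumes "fv.subspace S" "S \<subseteq> vecs d"
  obtains us where "onf d us" "set us \<subseteq> S" "length us = rk d S" "\<And>v. v \<in> S \<Longrightarrow> v = proj d us v"
proof -
  obtain us where us: "onf d us" "set us \<subseteq> S" "length us = rk d S" using rk_props(1)[OF assms(2)] by blast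
  have "v = proj d us v" if "v \<in> S" for v
  proof (rule ccontr)
    assume "v \<noteq> proj d us v"
    from onf_extend[OF us(1) assms us(2) that this] obtain u where "u \<in> S" "onf d (us @ [u])" by blast
    then have "length (us @ [u]) \<le> rk d S" using us(2) by (intro rk_props(2)[OF assms(2)]) auto
    then show False using us(3) by simp
  qed
  with us that show thesis by blast
qed

lemma rk_less:
  assumes "fv.subspace S" "fv.subspace T" "T \<subseteq> vecs d" "S \<subset> T"
  shows "rk d S < rk d T"
proof -
  have S: "S \<subseteq> vecs d" using assms by auto
  obtain us where us: "onf d us" "set us \<subseteq> S" "length us = rk d S" using rk_props(1)[OF S] by blast
  obtain v where v: "v \<in> T" "v \<notin> S" using assms(4) by auto
  then have "v \<noteq> proj d us v" using proj_in[OF assms(1) us(2)] by metis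
  from onf_extend[OF us(1) assms(2,3) _ v(1) this] us(2) assms(4)
  obtain u where "u \<in> T" "onf d (us @ [u])" by blast
  then have "length (us @ [u]) \<le> rk d T" using us(2) assms(4) by (intro rk_props(2)[OF assms(3)]) auto
  with us(3) show ?thesis by simp
qed

definition perp :: "nat \<Rightarrow> (nat \<Rightarrow> complex) set \<Rightarrow> (nat \<Rightarrow> complex) set" where
  "perp d S = {v \<in> vecs d. \<forall>w\<in>S. cinner d v w = 0}"

lemma subspace_perp: "fv.subspace (perp d S)"
  using subspace_vecs[of d]
  by (auto simp: perp_def fv.subspace_def cinner_add_left cinner_scale_left)

lemma subspace_Int: "fv.subspace S \<Longrightarrow> fv.subspace T \<Longrightarrow> fv.subspace (S \<inter> T)"
  by (auto simp: fv.subspace_def)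

lemma invariant_perp:
  assumes "herm_coeff g d \<alpha>" "invariant g d \<alpha> S"
  shows "invariant g d \<alpha> (perp d S)"
  using assms unfolding invariant_def
  by (auto simp: subspace_perp) (auto simp: perp_def cinner_act_herm[OF assms(1)])

text \<open>Take \<open>W\<close> of least rank among the invariant subspaces not orthogonal to
  \<open>v\<close>. A proper nonzero invariant \<open>S\<close> in \<open>W\<close> and its
  complement in \<open>W\<close> both have smaller rank, so both are orthogonal to \<open>v\<close>,
  and then so is their sum \<open>W\<close>.\<close>

lemma minimal_invariant:
  assumes h: "herm_coeff g d \<alpha>" and v: "v \<in> vecs d" "v \<noteq> 0"
  shows "\<exists>W. invariant g d \<alpha> W \<and> v \<notin> perp d W \<and>
    (\<forall>S. invariant g d \<alpha> S \<longrightarrow> S \<subseteq> W \<longrightarrow> S = {0} \<or> S = W)"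
proof -
  let ?P = "\<lambda>W. invariant g d \<alpha> W \<and> v \<notin> perp d W"
  have "?P (vecs d)" using v cinner_self_zero_iff[of v d] by (auto simp: invariant_vecs perp_def)
  from exists_least_iff[of "\<lambda>m. \<exists>W. ?P W \<and> rk d W = m"] this
  obtain W where W: "?P W" and min: "\<And>S. ?P S \<Longrightarrow> \<not> rk d S < rk d W" by (metis (no_types, lifting))
  have "S = {0} \<or> S = W" if S: "invariant g d \<alpha> S" "S \<subseteq> W" for S
  proof (rule ccontr)
    assume n: "\<not> ?thesis"
    note inv = invariant_def
    define S' where "S' = W \<inter> perp d S"
    have S': "invariant g d \<alpha> S'"
      using W invariant_perp[OF h S(1)] by (auto simp: S'_def inv subspace_Int)
    from n S(1) obtain w where w: "w \<in> S" "w \<noteq> 0" by (auto simp: inv dest: fv.subspace_0)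
    have "w \<notin> S'" using w S(1) cinner_self_zero_iff[of w d] by (auto simp: S'_def perp_def inv)
    then have "S' \<subset> W" using w S(2) by (auto simp: S'_def)
    then have "rk d S' < rk d W" using W S' by (intro rk_less) (auto simp: inv)
    then have p1: "v \<in> perp d S'" using min S' by blast
    have "S \<subset> W" using n S(2) by auto
    then have "rk d S < rk d W" using W S by (intro rk_less) (auto simp: inv)
    then have p2: "v \<in> perp d S" using min S(1) by blast
    \<comment> \<open>\<open>x\<close> is its projection \<open>y\<close> onto \<open>S\<close> plus
      a remainder in \<open>S'\<close>, and \<open>v\<close> is orthogonal to both.\<close>
    have "cinner d v x = 0" if x: "x \<in> W" for x
    proof -
      have Ssub: "fv.subspace S" "S \<subseteq> vecs d" using S(1) by (auto simp: inv)
      obtain us where us: "onf d us" "set us \<subseteq> S" "length us = rk d S" "\<And>v. v \<in> S \<Longrightarrow> v = proj d us v"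
        using onb_exists[OF Ssub] by blast
      define y where "y = proj d us x"
      have y: "y \<in> S" unfolding y_def by (rule proj_in[OF Ssub(1) us(2)])
      have xy: "x - y \<in> W" using W x y S(2) by (auto simp: inv intro: fv.subspace_diff)
      have "cinner d (x - y) w = 0" if "w \<in> S" for w
      proof -
        have "cinner d w (x - y) = cinner d (proj d us w) (x - y)"
          by (rule arg_cong[OF us(4)[OF that]])
        also have "\<dots> = (\<Sum>i<length us. cinner d w (us ! i) * cinner d (us ! i) (x - y))"
          unfolding proj_def cinner_sum_left cinner_scale_left ..
        also have "\<dots> = 0"
        proof (rule sum.neutral, clarify)
          fix i assume "i < length us"
          then have "cinner d (x - y) (us ! i) = 0"
            using cinner_proj[OF us(1)] by (simp add: y_def cinner_diff_left)
          then have "cinner d (us ! i) (x - y) = 0" by (subst cinner_commute) simp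
          then show "cinner d w (us ! i) * cinner d (us ! i) (x - y) = 0" by simp
        qed
        finally have "cinner d w (x - y) = 0" .
        then show ?thesis by (subst cinner_commute) simp
      qed
      then have "x - y \<in> S'" using xy W by (auto simp: S'_def perp_def inv)
      then have "cinner d v (x - y) = 0" using p1 by (auto simp: perp_def)
      moreover have "cinner d v y = 0" using p2 y by (auto simp: perp_def)
      ultimately have "cinner d (x - y) v = 0" "cinner d y v = 0" by (auto simp: cinner_commute[of d _ v])
      then have "cinner d x v = 0" by (simp add: cinner_diff_left)
      then show ?thesis by (subst cinner_commute) simp
    qed
    then show False using W v by (auto simp: perp_def)
  qed
  with W show ?thesis by blast
qed

definition minimal_inv :: "nat \<Rightarrow> nat \<Rightarrow> (nat \<Rightarrow> nat \<Rightarrow> nat \<Rightarrow> complex) \<Rightarrow> (nat \<Rightarrow> complex) set \<Rightarrow> bool" where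
  "minimal_inv g d \<alpha> W \<longleftrightarrow> invariant g d \<alpha> W \<and> W \<noteq> {0} \<and>
    (\<forall>S. invariant g d \<alpha> S \<longrightarrow> S \<subseteq> W \<longrightarrow> S = {0} \<or> S = W)"

text \<open>The last property ensures that a kernel vector of the pencil has a nonzero component
  along some member. Passing from \<open>T\<close> to the part of \<open>T\<close> orthogonal to a
  new minimal \<open>W\<close> lowers the rank, so finitely many members suffice.\<close>

lemma finite_minimal_cover:
  assumes h: "herm_coeff g d \<alpha>"
  shows "\<exists>F. finite F \<and> (\<forall>W\<in>F. minimal_inv g d \<alpha> W) \<and> (\<forall>v\<in>vecs d. v \<noteq> 0 \<longrightarrow> (\<exists>W\<in>F. v \<notin> perp d W))"
proof -
  have "\<exists>F. finite F \<and> (\<forall>W\<in>F. minimal_inv g d \<alpha> W) \<and> (\<forall>v\<in>T. v \<noteq> 0 \<longrightarrow> (\<exists>W\<in>F. v \<notin> perp d W))"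
    if "fv.subspace T" "T \<subseteq> vecs d" for T
    using that
  proof (induction "rk d T" arbitrary: T rule: less_induct)
    case less
    show ?case
    proof (cases "T = {0}")
      case True
      then show ?thesis by (intro exI[of _ "{}"]) auto
    next
      case False
      then obtain v where v: "v \<in> T" "v \<noteq> 0" using fv.subspace_0[OF less(2)] by auto
      from minimal_invariant[OF h _ v(2)] v(1) less(3)
      obtain W where W: "invariant g d \<alpha> W" "v \<notin> perp d W"
        "\<forall>S. invariant g d \<alpha> S \<longrightarrow> S \<subseteq> W \<longrightarrow> S = {0} \<or> S = W" by (meson subsetD)
      have "W \<noteq> {0}" using W(2) v(1) less(3)
        by (auto simp: perp_def cinner_def)
      with W have Wm: "minimal_inv g d \<alpha> W" by (auto simp: minimal_inv_def)
      have sub: "fv.subspace (T \<inter> perp d W)" using less(2) by (simp add: subspace_Int subspace_perp)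
      have "rk d (T \<inter> perp d W) < rk d T"
        using v W(2) by (intro rk_less sub less) auto
      moreover have "T \<inter> perp d W \<subseteq> vecs d" using less(3) by auto
      ultimately obtain F where F: "finite F" "\<forall>W\<in>F. minimal_inv g d \<alpha> W"
        "\<forall>v\<in>T \<inter> perp d W. v \<noteq> 0 \<longrightarrow> (\<exists>W\<in>F. v \<notin> perp d W)"
        using less(1) sub by meson
      then show ?thesis using Wm by (intro exI[of _ "insert W F"]) auto
    qed
  qed
  from this[OF subspace_vecs] show ?thesis by auto
qed

section \<open>Restriction of the coefficients to an invariant subspace\<close>

definition lift :: "(nat \<Rightarrow> complex) list \<Rightarrow> (nat \<Rightarrow> complex) \<Rightarrow> nat \<Rightarrow> complex" where
  "lift us s = (\<Sum>c<length us. scale_fun (s c) (us ! c))"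

text \<open>The matrix of the \<open>j\<close>-th coefficient with respect to an orthonormal list
  \<open>us\<close>, for which \<open>lift us\<close> is the isometry from coordinates into the
  subspace.\<close>

definition compress :: "nat \<Rightarrow> (nat \<Rightarrow> complex) list \<Rightarrow> (nat \<Rightarrow> nat \<Rightarrow> nat \<Rightarrow> complex) \<Rightarrow> nat \<Rightarrow> nat \<Rightarrow> nat \<Rightarrow> complex" where
  "compress d us \<alpha> j c e = cinner d (act d (\<alpha> j) (us ! e)) (us ! c)"

definition onb :: "nat \<Rightarrow> (nat \<Rightarrow> complex) list \<Rightarrow> (nat \<Rightarrow> complex) set \<Rightarrow> bool" where
  "onb d us W \<longleftrightarrow> onf d us \<and> set us \<subseteq> W \<and> (\<forall>v\<in>W. v = proj d us v)"

lemma herm_compress: "herm_coeff g d \<alpha> \<Longrightarrow> herm_coeff g (length us) (compress d us \<alpha>)"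
  unfolding herm_coeff_def[of g "length us"] compress_def
  by (metis cinner_act_herm cinner_commute)

lemma lift_in: "fv.subspace W \<Longrightarrow> set us \<subseteq> W \<Longrightarrow> lift us s \<in> W"
  unfolding lift_def by (intro fv.subspace_sum fv.subspace_scale) auto

lemma lift_add: "lift us (s + t) = lift us s + lift us t"
  by (simp add: lift_def fun_eq_iff sum_fun_apply scale_fun_def algebra_simps sum.distrib)

lemma lift_scale: "lift us (scale_fun c s) = scale_fun c (lift us s)"
  by (simp add: lift_def fun_eq_iff sum_fun_apply scale_fun_def sum_distrib_left mult_ac)

lemma cinner_lift:
  assumes "onf d us" "c < length us"
  shows "cinner d (lift us s) (us ! c) = s c"
proof -
  have "cinner d (lift us s) (us ! c) = (\<Sum>i<length us. if i = c then s c else 0)"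
    unfolding lift_def cinner_sum_left cinner_scale_left
    using assms by (intro sum.cong) (auto simp: onf_def)
  then show ?thesis using assms(2) by simp
qed

lemma act_lift:
  assumes "onb d us W" "invariant g d \<alpha> W" "j < g"
  shows "act d (\<alpha> j) (lift us s) = lift us (act (length us) (compress d us \<alpha> j) s)"
proof -
  have sub: "fv.subspace W" "set us \<subseteq> W" using assms by (auto simp: onb_def invariant_def)
  have "act d (\<alpha> j) (lift us s) \<in> W" using assms lift_in[OF sub] by (auto simp: invariant_def)
  then have "act d (\<alpha> j) (lift us s) = proj d us (act d (\<alpha> j) (lift us s))" using assms by (auto simp: onb_def)
  also have "\<dots> = lift us (act (length us) (compress d us \<alpha> j) s)"
    unfolding proj_def lift_def[of us "act (length us) (compress d us \<alpha> j) s"]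
  proof (rule sum.cong[OF refl])
    fix c assume c: "c \<in> {..<length us}"
    have "cinner d (act d (\<alpha> j) (lift us s)) (us ! c) = (\<Sum>e<length us. compress d us \<alpha> j c e * s e)"
      by (simp add: lift_def act_sum act_scale cinner_sum_left cinner_scale_left compress_def mult.commute)
    then show "scale_fun (cinner d (act d (\<alpha> j) (lift us s)) (us ! c)) (us ! c)
        = scale_fun (act (length us) (compress d us \<alpha> j) s c) (us ! c)" using c by (simp add: act_def)
  qed
  finally show ?thesis .
qed

text \<open>\<open>lift us\<close> intertwines the compressed and the original coefficients and
  therefore carries invariant subspaces to invariant subspaces of \<open>W\<close>; being injective
  with image \<open>W\<close>, it transfers minimality.\<close>

lemma irred_compress:
  assumes W: "minimal_inv g d \<alpha> W" and us: "onb d us W"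
  shows "irred g (length us) (compress d us \<alpha>)"
  unfolding irred_def
proof (intro allI impI)
  let ?k = "length us"
  fix S assume S: "invariant g ?k (compress d us \<alpha>) S"
  have W': "invariant g d \<alpha> W" "fv.subspace W" "W \<subseteq> vecs d" "set us \<subseteq> W"
    using W us by (auto simp: minimal_inv_def invariant_def onb_def)
  have sub: "fv.subspace (lift us ` S)"
    unfolding fv.subspace_def
  proof (intro conjI ballI allI)
    have "lift us 0 = 0" by (simp add: lift_def fun_eq_iff sum_fun_apply scale_fun_def)
    then show "0 \<in> lift us ` S" using S by (metis image_eqI invariant_def fv.subspace_0)
    show "x + y \<in> lift us ` S" if "x \<in> lift us ` S" "y \<in> lift us ` S" for x y
      using that S by (auto simp: invariant_def lift_add[symmetric] intro: fv.subspace_add)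
    show "scale_fun c x \<in> lift us ` S" if "x \<in> lift us ` S" for c x
      using that S by (auto simp: invariant_def lift_scale[symmetric] intro: fv.subspace_scale)
  qed
  have "lift us ` S \<subseteq> W" using lift_in[OF W'(2,4)] by auto
  moreover have "invariant g d \<alpha> (lift us ` S)"
    using sub \<open>lift us ` S \<subseteq> W\<close> W'(3) S by (auto simp: invariant_def act_lift[OF us W'(1)])
  ultimately have cases: "lift us ` S = {0} \<or> lift us ` S = W" using W by (auto simp: minimal_inv_def)
  have onf: "onf d us" using us by (simp add: onb_def)
  have inj: "s = t" if "s \<in> vecs ?k" "t \<in> vecs ?k" "lift us s = lift us t" for s t
  proof
    fix c show "s c = t c"
      using that cinner_lift[OF onf, of c s] cinner_lift[OF onf, of c t]
      by (cases "c < ?k") (auto simp: vecs_def)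
  qed
  have Sv: "S \<subseteq> vecs ?k" "0 \<in> S" using S by (auto simp: invariant_def fv.subspace_0)
  show "S = {0} \<or> S = vecs ?k"
  proof (cases "lift us ` S = {0}")
    case True
    have "lift us 0 = 0" by (simp add: lift_def fun_eq_iff sum_fun_apply scale_fun_def)
    then have "s = 0" if "s \<in> S" for s
      using that True inj[of s 0] Sv by (metis image_eqI singletonD subsetD)
    then show ?thesis using Sv by auto
  next
    case False
    then have eq: "lift us ` S = W" using cases by blast
    have "s \<in> S" if "s \<in> vecs ?k" for s
    proof -
      have "lift us s \<in> lift us ` S" unfolding eq by (rule lift_in[OF W'(2,4)])
      then obtain t where "t \<in> S" "lift us s = lift us t" by auto
      with inj[of s t] that Sv show ?thesis by auto
    qed
    then show ?thesis using Sv by auto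
  qed
qed

section \<open>Tuples with a degenerate eigenvector\<close>

text \<open>A vector of \<open>\<complex>\<^sup>d \<otimes> \<complex>\<^sup>n\<close> is written as the \<open>n \<times> d\<close> matrix \<open>V\<close> of its entries; \<open>pencil_op\<close> is then
  \<open>V \<mapsto> \<Sum>\<^sub>j X\<^sub>j V A\<^sub>j\<^sup>T\<close>.\<close>

definition pencil_op :: "nat \<Rightarrow> nat \<Rightarrow> nat \<Rightarrow> (nat \<Rightarrow> nat \<Rightarrow> nat \<Rightarrow> complex) \<Rightarrow> tuple \<Rightarrow>
    (nat \<times> nat \<Rightarrow> complex) \<Rightarrow> nat \<times> nat \<Rightarrow> complex" where
  "pencil_op g d n \<alpha> x V = (\<lambda>(i, a). \<Sum>j<g. \<Sum>k<n. \<Sum>b<d. x (j, i, k) * \<alpha> j a b * V (k, b))"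

text \<open>The eigenvalue is left free because tuples are perturbed and only afterwards divided by
  it. Entries outside the \<open>n\<close> by \<open>d\<close> range are disregarded.\<close>

definition eigen :: "nat \<Rightarrow> nat \<Rightarrow> nat \<Rightarrow> (nat \<Rightarrow> nat \<Rightarrow> nat \<Rightarrow> complex) \<Rightarrow> tuple \<Rightarrow> complex \<Rightarrow>
    (nat \<times> nat \<Rightarrow> complex) \<Rightarrow> bool" where
  "eigen g d n \<alpha> x \<mu> V \<longleftrightarrow>
     (\<forall>i<n. \<forall>a<d. pencil_op g d n \<alpha> x V (i, a) = \<mu> * V (i, a)) \<and> (\<exists>i<n. \<exists>a<d. V (i, a) \<noteq> 0)"

definition inj_mat :: "nat \<Rightarrow> nat \<Rightarrow> (nat \<times> nat \<Rightarrow> complex) \<Rightarrow> bool" where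
  "inj_mat n d V \<longleftrightarrow> (\<forall>w. (\<forall>i<n. (\<Sum>a<d. V (i, a) * w a) = 0) \<longrightarrow> (\<forall>a<d. w a = 0))"

text \<open>
  Let \<open>v\<^sub>i\<close> be the rows of an eigenvector, choose \<open>J\<close> such that the \<open>v\<^sub>l\<close> with \<open>l \<in> J\<close> are a basis of the row
  space, and \<open>I\<close> such that the \<open>A\<^sub>j v\<^sub>l\<close> with \<open>(j, l) \<in> I\<close> are a basis of its image. With
  \<open>v\<^sub>i = \<Sum>\<^sub>l u\<^sub>i\<^sub>l v\<^sub>l\<close> and \<open>y\<^sub>i\<^sub>j\<^sub>l = \<Sum>\<^sub>k x\<^sub>j\<^sub>i\<^sub>k u\<^sub>k\<^sub>l\<close> the eigenvalue equation reads
  \<open>\<Sum>\<^sub>j\<^sub>,\<^sub>l y\<^sub>i\<^sub>j\<^sub>l A\<^sub>j v\<^sub>l = \<mu> v\<^sub>i\<close>. The free parameters are \<open>u\<close>, the entries \<open>x\<^sub>j\<^sub>i\<^sub>k\<close> with \<open>k \<notin> J\<close>, the \<open>y\<^sub>i\<^sub>j\<^sub>l\<close>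
  with \<open>(j, l) \<notin> I\<close>, the eigenvalue (\<open>PL\<close>), and the coordinates of the \<open>v\<^sub>l\<close> (\<open>PE\<close>) and of the remaining
  \<open>A\<^sub>j v\<^sub>l\<close> (\<open>PC\<close>) in the basis \<open>I\<close>.
\<close>

datatype par = PU nat nat | PX nat nat nat | PY nat nat nat | PL | PE nat nat nat | PC nat nat nat nat

definition params :: "nat \<Rightarrow> nat \<Rightarrow> nat set \<Rightarrow> (nat \<times> nat) set \<Rightarrow> par set" where
  "params g n J I =
     (\<lambda>(i, l). PU i l) ` (({..<n} - J) \<times> J) \<union>
     (\<lambda>(j, i, k). PX j i k) ` ({..<g} \<times> {..<n} \<times> ({..<n} - J)) \<union>
     (\<lambda>(i, j, l). PY i j l) ` ({..<n} \<times> ({..<g} \<times> J - I)) \<union> {PL} \<union>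
     (\<lambda>(l, j, l'). PE l j l') ` (J \<times> I) \<union>
     (\<lambda>((j, l), (j', l')). PC j l j' l') ` (({..<g} \<times> J - I) \<times> I)"

definition par_u :: "nat set \<Rightarrow> (par \<Rightarrow> complex) \<Rightarrow> nat \<Rightarrow> nat \<Rightarrow> complex" where
  "par_u J \<theta> i l = (if i \<in> J then if i = l then 1 else 0 else \<theta> (PU i l))"

text \<open>For (j, l) in \<open>I\<close> the value is forced: it is obtained by comparing the
  coefficients of A_j v_l when the eigenvalue equation is expanded in the basis
  \<open>I\<close>.\<close>

definition par_y :: "nat \<Rightarrow> nat set \<Rightarrow> (nat \<times> nat) set \<Rightarrow> (par \<Rightarrow> complex) \<Rightarrow> nat \<Rightarrow> nat \<Rightarrow> nat \<Rightarrow> complex" where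
  "par_y g J I \<theta> i j l = (if (j, l) \<in> I
     then \<theta> PL * (\<Sum>l'\<in>J. par_u J \<theta> i l' * \<theta> (PE l' j l)) -
       (\<Sum>q\<in>{..<g} \<times> J - I. \<theta> (PY i (fst q) (snd q)) * \<theta> (PC (fst q) (snd q) j l))
     else \<theta> (PY i j l))"

text \<open>For k in \<open>J\<close> the defining equation of y is solved for x_jik, which is
  possible because u is the identity on \<open>J\<close>.\<close>

definition par_x :: "nat \<Rightarrow> nat \<Rightarrow> nat set \<Rightarrow> (nat \<times> nat) set \<Rightarrow> nat \<times> nat \<times> nat \<Rightarrow> (par \<Rightarrow> complex) \<Rightarrow> complex" where
  "par_x g n J I = (\<lambda>(j, i, k) \<theta>. if k \<in> J
     then par_y g J I \<theta> i j k - (\<Sum>k'\<in>{..<n} - J. \<theta> (PX j i k') * par_u J \<theta> k' k)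
     else \<theta> (PX j i k))"

lemma params_mem [simp]:
  "PU i l \<in> params g n J I \<longleftrightarrow> i < n \<and> i \<notin> J \<and> l \<in> J"
  "PX j i k \<in> params g n J I \<longleftrightarrow> j < g \<and> i < n \<and> k < n \<and> k \<notin> J"
  "PY i j l \<in> params g n J I \<longleftrightarrow> i < n \<and> j < g \<and> l \<in> J \<and> (j, l) \<notin> I"
  "PL \<in> params g n J I"
  "PE l j l' \<in> params g n J I \<longleftrightarrow> l \<in> J \<and> (j, l') \<in> I"
  "PC j l j' l' \<in> params g n J I \<longleftrightarrow> j < g \<and> l \<in> J \<and> (j, l) \<notin> I \<and> (j', l') \<in> I"
  unfolding params_def by (auto simp: image_iff Bex_def)

lemma param_poly_par_x:
  assumes "J \<subseteq> {..<n}" "I \<subseteq> {..<g} \<times> J" "t \<in> idx g n"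
  shows "param_poly (params g n J I) (par_x g n J I t)"
proof -
  let ?S = "params g n J I"
  have U: "param_poly ?S (\<lambda>\<theta>. par_u J \<theta> i l)" if "i < n" "l \<in> J" for i l
  proof (cases "i \<in> J")
    case True
    then show ?thesis unfolding par_u_def by (simp add: param_poly.const)
  next
    case False
    then show ?thesis unfolding par_u_def using that by (simp add: param_poly.var)
  qed
  have X: "param_poly ?S (\<lambda>\<theta>. \<theta> (PX j i k))" if "j < g" "i < n" "k < n" "k \<notin> J" for j i k
    by (intro param_poly.var) (use that in simp)
  have Y': "param_poly ?S (\<lambda>\<theta>. \<theta> (PY i j l))" if "i < n" "(j, l) \<in> {..<g} \<times> J - I" for i j l
    by (intro param_poly.var) (use that in simp)
  have E: "param_poly ?S (\<lambda>\<theta>. \<theta> (PE l j l'))" if "l \<in> J" "(j, l') \<in> I" for l j l'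
    by (intro param_poly.var) (use that in simp)
  have C: "param_poly ?S (\<lambda>\<theta>. \<theta> (PC j l j' l'))" if "(j, l) \<in> {..<g} \<times> J - I" "(j', l') \<in> I" for j l j' l'
    by (intro param_poly.var) (use that in simp)
  have L: "param_poly ?S (\<lambda>\<theta>. \<theta> PL)" by (intro param_poly.var) simp
  have Y: "param_poly ?S (\<lambda>\<theta>. par_y g J I \<theta> i j l)" if "i < n" "j < g" "l \<in> J" for i j l
  proof (cases "(j, l) \<in> I")
    case True
    then show ?thesis using that unfolding par_y_def
      by (simp only: if_True, intro param_poly_diff param_poly.mult param_poly_sum L U E C Y') auto
  next
    case False
    then show ?thesis using that Y' unfolding par_y_def by auto
  qed
  obtain j i k where t: "t = (j, i, k)" "j < g" "i < n" "k < n" using assms(3) by auto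
  show ?thesis
  proof (cases "k \<in> J")
    case True
    then show ?thesis using t assms(1) unfolding par_x_def
      by (auto intro!: param_poly_diff param_poly_sum param_poly.mult Y X U)
  next
    case False
    then show ?thesis using t X unfolding par_x_def by auto
  qed
qed

lemma finite_params: "finite J \<Longrightarrow> finite I \<Longrightarrow> finite (params g n J I)"
  by (auto simp: params_def)

text \<open>In the notation of the proof g n^2 = g n r + n (m + s). After cancelling g n r and n s,
  the claim is r k + 1 + k m + s m < n m. Since m \<ge> k + 1, the right side is at least r k + n,
  and n exceeds 1 + k m + s m. Without strict growth of the image the linear gain in n would be
  missing.\<close>

lemma card_params_less:
  assumes J: "J \<subseteq> {..<n}" and I: "I \<subseteq> {..<g} \<times> J" and km: "card J < card I" "card I \<le> d"
    and n: "n > 1 + d\<^sup>2 + g * d\<^sup>2"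
  shows "card (params g n J I) < g * n\<^sup>2"
proof -
  have fin: "finite J" using J by (rule finite_subset) simp
  then have finI: "finite I" using I by (auto intro: finite_subset[OF I])
  define k m r s where "k = card J" and "m = card I" and "r = card ({..<n} - J)"
    and "s = card ({..<g} \<times> J - I)"
  have nk: "n = k + r" using J fin card_mono[OF _ J] by (simp add: k_def r_def card_Diff_subset)
  have ms: "g * k = m + s" using I fin finI card_mono[OF _ I] by (simp add: k_def s_def m_def card_Diff_subset card_cartesian_product)
  have "card (params g n J I) \<le> r * k + g * (n * r) + n * s + 1 + k * m + s * m"
    unfolding params_def
    by (intro order_trans[OF card_Un_le] add_mono order_trans[OF card_image_le])
      (auto simp: fin finI r_def k_def s_def m_def card_cartesian_product)
  also have "\<dots> < g * n\<^sup>2"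
  proof -
    have "k * m \<le> d * d" "s * m \<le> (g * d) * d"
      using km ms unfolding k_def[symmetric] m_def[symmetric]
      by (auto intro!: mult_mono order_trans[OF _ mult_le_mono2[of k d g]])
    then have "r * k + 1 + k * m + s * m < r * k + n" using n by (simp add: power2_eq_square)
    also have "\<dots> \<le> n * (k + 1)" using nk by (simp add: algebra_simps)
    also have "\<dots> \<le> n * m" using km by (intro mult_le_mono2) (simp add: k_def m_def)
    finally have "r * k + g * (n * r) + n * s + 1 + k * m + s * m < n * (m + s) + g * (n * r)"
      by (simp add: algebra_simps)
    also have "\<dots> = g * n * (k + r)" unfolding ms[symmetric] by (simp add: algebra_simps)
    finally show ?thesis unfolding nk[symmetric] by (simp add: power2_eq_square)
  qed
  finally show ?thesis .
qed

text \<open>A basis is recorded by indices, since the parameters are named by indices and the family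
  may repeat vectors.\<close>

lemma indexed_basis:
  fixes f :: "'i \<Rightarrow> 'x \<Rightarrow> complex"
  obtains I where "I \<subseteq> P" "inj_on f I" "fv.independent (f ` I)" "f ` P \<subseteq> fv.span (f ` I)"
proof -
  obtain B where "B \<subseteq> f ` P" "fv.independent B" "f ` P \<subseteq> fv.span B"
    using fv.maximal_independent_subset by blast
  moreover from this(1) obtain I where "I \<subseteq> P" "inj_on f I" "B = f ` I"
    by (auto simp: subset_image_inj)
  ultimately show thesis using that by auto
qed

lemma indexed_coords:
  fixes f :: "'i \<Rightarrow> 'x \<Rightarrow> complex"
  assumes "finite I" "inj_on f I" "v \<in> fv.span (f ` I)"
  shows "\<exists>c. v = (\<Sum>i\<in>I. scale_fun (c i) (f i))"
proof -
  obtain u where "v = (\<Sum>w\<in>f ` I. scale_fun (u w) w)"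
    using assms(3) unfolding fv.span_finite[OF finite_imageI[OF assms(1)]] by auto
  then show ?thesis using assms(2) by (intro exI[of _ "u \<circ> f"]) (simp add: sum.reindex)
qed

lemma indexed_independent:
  fixes f :: "'i \<Rightarrow> 'x \<Rightarrow> complex"
  assumes "finite I" "inj_on f I" "fv.independent (f ` I)"
    and "(\<Sum>i\<in>I. scale_fun (c i) (f i)) = (\<Sum>i\<in>I. scale_fun (c' i) (f i))" "i \<in> I"
  shows "c i = c' i"
proof -
  define u where "u w = c (inv_into I f w) - c' (inv_into I f w)" for w
  have "(\<Sum>w\<in>f ` I. scale_fun (u w) w) = (\<Sum>i\<in>I. scale_fun (c i) (f i) - scale_fun (c' i) (f i))"
    unfolding sum.reindex[OF assms(2)] o_def
    by (rule sum.cong) (auto simp: u_def inv_into_f_f[OF assms(2)] fv.scale_left_diff_distrib)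
  then have "(\<Sum>w\<in>f ` I. scale_fun (u w) w) = 0" using assms(4) by (simp add: sum_subtractf)
  with assms(3) have "u (f i) = 0"
    unfolding fv.dependent_finite[OF finite_imageI[OF assms(1)]] using assms(5) by blast
  then show ?thesis using assms(2,5) by (simp add: u_def)
qed

text \<open>As \<mu> is nonzero, the row space \<open>W\<close> lies in its image under the
  coefficients. If the image were not of larger dimension it would equal \<open>W\<close>, an
  invariant subspace that is nonzero, and proper because \<open>V\<close> is not injective; this
  contradicts irreducibility.\<close>

lemma bad_param:
  assumes irr: "irred g d \<alpha>" and eig: "eigen g d n \<alpha> x \<mu> V" and \<mu>: "\<mu> \<noteq> 0" and ninj: "\<not> inj_mat n d V"
  shows "\<exists>J I \<theta>. J \<subseteq> {..<n} \<and> I \<subseteq> {..<g} \<times> J \<and> card J < card I \<and> card I \<le> d \<and>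
    (\<forall>t\<in>idx g n. x t = par_x g n J I t \<theta>)"
proof -
  define v where "v i = (\<lambda>a. if a < d then V (i, a) else 0)" for i
  define W where "W = fv.span (v ` {..<n})"
  have vd: "v i \<in> vecs d" for i by (simp add: v_def vecs_def)
  have Wd: "W \<subseteq> vecs d" unfolding W_def by (rule fv.span_minimal) (auto simp: vd subspace_vecs)
  have row: "scale_fun \<mu> (v i) = (\<Sum>j<g. \<Sum>k<n. scale_fun (x (j, i, k)) (act d (\<alpha> j) (v k)))" if "i < n" for i
  proof
    fix a
    show "scale_fun \<mu> (v i) a = (\<Sum>j<g. \<Sum>k<n. scale_fun (x (j, i, k)) (act d (\<alpha> j) (v k))) a"
    proof (cases "a < d")
      case True
      then have "\<mu> * V (i, a) = (\<Sum>j<g. \<Sum>k<n. \<Sum>b<d. x (j, i, k) * \<alpha> j a b * V (k, b))"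
        using eig that by (simp add: eigen_def pencil_op_def)
      then show ?thesis using True
        by (simp add: sum_fun_apply scale_fun_def act_def v_def sum_distrib_left mult.assoc)
    qed (simp add: sum_fun_apply scale_fun_def act_def v_def)
  qed
  have W0: "W \<noteq> {0}"
  proof -
    obtain i a where "i < n" "a < d" "V (i, a) \<noteq> 0" using eig by (auto simp: eigen_def)
    then have "v i \<noteq> 0" "v i \<in> W" by (auto simp: v_def fun_eq_iff W_def intro!: fv.span_base)
    then show ?thesis by blast
  qed
  \<comment> \<open>A nonzero \<open>w\<close> killed by \<open>V\<close> pairs to zero with every
    row and hence with all of \<open>W\<close>; the unit vector at a nonzero entry of
    \<open>w\<close> does not.\<close>
  have W1: "W \<noteq> vecs d"
  proof
    assume eq: "W = vecs d"
    obtain w a where w: "\<forall>i<n. (\<Sum>a<d. V (i, a) * w a) = 0" "a < d" "w a \<noteq> 0"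
      using ninj by (auto simp: inj_mat_def)
    have "(\<Sum>a<d. u a * w a) = 0" if "u \<in> W" for u
      using that unfolding W_def
    proof (induction rule: fv.span_induct_alt)
      case (step c x y)
      then obtain i where "i < n" "x = v i" by auto
      then have "(\<Sum>a<d. x a * w a) = 0" using w(1) by (simp add: v_def)
      moreover have "(\<Sum>a<d. (scale_fun c x + y) a * w a) = c * (\<Sum>a<d. x a * w a) + (\<Sum>a<d. y a * w a)"
        by (simp add: scale_fun_def algebra_simps sum.distrib sum_distrib_left)
      ultimately show ?case using step by simp
    qed simp
    from this[of "\<lambda>b. if b = a then 1 else 0"] w(2)
    have "(\<Sum>b<d. (if b = a then 1 else 0) * w b) = 0" by (auto simp: eq vecs_def)
    also have "(\<Sum>b<d. (if b = a then 1 else 0) * w b) = (\<Sum>b<d. if b = a then w a else 0)"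
      by (rule sum.cong) auto
    finally show False using w(2,3) by simp
  qed
  have Winv: "fv.subspace W" by (simp add: W_def)
  obtain J where J: "J \<subseteq> {..<n}" "inj_on v J" "fv.independent (v ` J)" "v ` {..<n} \<subseteq> fv.span (v ` J)"
    using indexed_basis by blast
  have finJ: "finite J" using J(1) by (rule finite_subset) simp
  have WJ: "W = fv.span (v ` J)" unfolding W_def
    using J(1,4) by (intro subset_antisym fv.span_minimal fv.span_mono) auto
  define f where "f = (\<lambda>(j, l). act d (\<alpha> j) (v l))"
  let ?P = "{..<g} \<times> J"
  obtain I where I: "I \<subseteq> ?P" "inj_on f I" "fv.independent (f ` I)" "f ` ?P \<subseteq> fv.span (f ` I)"
    using indexed_basis by blast
  have finI: "finite I" using I(1) finJ by (auto intro: finite_subset)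
  have actW: "act d (\<alpha> j) w \<in> fv.span (f ` I)" if "j < g" "w \<in> W" for j w
  proof -
    have "w \<in> fv.span (v ` J)" using that(2) WJ by simp
    then obtain c where "w = (\<Sum>l\<in>J. scale_fun (c l) (v l))"
      using indexed_coords[OF finJ J(2)] by blast
    then have "act d (\<alpha> j) w = (\<Sum>l\<in>J. scale_fun (c l) (f (j, l)))"
      by (simp add: act_sum act_scale f_def)
    also have "\<dots> \<in> fv.span (f ` I)"
      using I(4) that(1) by (intro fv.span_sum fv.span_scale) auto
    finally show ?thesis .
  qed
  have vW: "v i \<in> W" if "i < n" for i using that unfolding W_def by (auto intro: fv.span_base)
  have vI: "v i \<in> fv.span (f ` I)" if "i < n" for i
  proof -
    have "scale_fun \<mu> (v i) \<in> fv.span (f ` I)"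
      unfolding row[OF that] using actW vW by (intro fv.span_sum fv.span_scale) auto
    from fv.span_scale[OF this, of "1 / \<mu>"] \<mu> show ?thesis by (simp add: scale_fun_def)
  qed
  have "card J < card I"
  proof (rule ccontr)
    assume n: "\<not> ?thesis"
    have cJ: "card (v ` J) = card J" "card (f ` I) = card I" using J(2) I(2) by (auto simp: card_image)
    have sub: "v ` J \<subseteq> fv.span (f ` I)" using vI J(1) by auto
    \<comment> \<open>Exchange argument: a vector of the image basis outside \<open>W\<close> would,
      together with the basis of \<open>W\<close>, give more independent vectors in the image than
      its dimension.\<close>
    have "f ` I \<subseteq> W"
    proof
      fix z assume z: "z \<in> f ` I"
      show "z \<in> W"
      proof (rule ccontr)
        assume nz: "z \<notin> W"
        then have "fv.independent (insert z (v ` J))" "z \<notin> v ` J"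
          using J(3) WJ by (auto simp: fv.independent_insert intro: fv.span_base)
        then have "Suc (card J) \<le> card (f ` I)"
          using fv.independent_span_bound[of "f ` I" "insert z (v ` J)"] sub z finI finJ cJ
          by (auto intro: fv.span_base)
        with n cJ show False by simp
      qed
    qed
    then have "fv.span (f ` I) \<subseteq> W" by (intro fv.span_minimal Winv)
    then have "invariant g d \<alpha> W" using actW Winv Wd by (auto simp: invariant_def)
    with irr W0 W1 show False by (auto simp: irred_def)
  qed
  moreover have "card I \<le> d"
  proof -
    obtain B where B: "finite B" "card B \<le> d" "vecs d \<subseteq> fv.span B" using vecs_span by blast
    have "f ` I \<subseteq> vecs d" by (auto simp: f_def split: prod.splits)
    then have "card (f ` I) \<le> card B" using fv.independent_span_bound[OF B(1) I(3)] B(3) by auto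
    then show ?thesis using B I(2) by (simp add: card_image)
  qed
  moreover have "\<exists>\<theta>. \<forall>t\<in>idx g n. x t = par_x g n J I t \<theta>"
  proof -
    have "\<forall>i. \<exists>c. i < n \<longrightarrow> v i = (\<Sum>l\<in>J. scale_fun (c l) (v l))"
      using indexed_coords[OF finJ J(2)] vW WJ by metis
    then obtain u0 where u0: "\<And>i. i < n \<Longrightarrow> v i = (\<Sum>l\<in>J. scale_fun (u0 i l) (v l))" by metis
    have "\<forall>i. \<exists>c. i < n \<longrightarrow> v i = (\<Sum>p\<in>I. scale_fun (c p) (f p))"
      using indexed_coords[OF finI I(2)] vI by metis
    then obtain e where e: "\<And>i. i < n \<Longrightarrow> v i = (\<Sum>p\<in>I. scale_fun (e i p) (f p))" by metis
    have "\<forall>q. \<exists>c. q \<in> ?P \<longrightarrow> f q = (\<Sum>p\<in>I. scale_fun (c p) (f p))"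
    proof
      fix q
      show "\<exists>c. q \<in> ?P \<longrightarrow> f q = (\<Sum>p\<in>I. scale_fun (c p) (f p))"
      proof (cases "q \<in> ?P")
        case True
        then have "f q \<in> fv.span (f ` I)" using I(4) by blast
        from indexed_coords[OF finI I(2) this] show ?thesis by blast
      qed blast
    qed
    then obtain c where c: "\<And>q. q \<in> ?P \<Longrightarrow> f q = (\<Sum>p\<in>I. scale_fun (c q p) (f p))" by metis
    \<comment> \<open>On \<open>J\<close> the coordinates are those of the identity, the shape
      assumed by \<open>par_u\<close>.\<close>
    define u where "u i l = (if i \<in> J then if i = l then 1 else 0 else u0 i l)" for i l
    define y where "y i q = (\<Sum>k<n. x (fst q, i, k) * u k (snd q))" for i q
    have u: "v i = (\<Sum>l\<in>J. scale_fun (u i l) (v l))" if "i < n" for i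
    proof (cases "i \<in> J")
      case True
      have "(\<Sum>l\<in>J. scale_fun (u i l) (v l)) = (\<Sum>l\<in>J. if l = i then v i else 0)"
        by (rule sum.cong) (auto simp: u_def True scale_fun_def fun_eq_iff)
      then show ?thesis using True finJ by simp
    next
      case False
      have "(\<Sum>l\<in>J. scale_fun (u i l) (v l)) = (\<Sum>l\<in>J. scale_fun (u0 i l) (v l))"
        using False by (simp add: u_def)
      then show ?thesis using u0[OF that] by (rule trans[rotated, OF sym])
    qed
    have yf: "(\<Sum>q\<in>?P. scale_fun (y i q) (f q)) = scale_fun \<mu> (v i)" if "i < n" for i
    proof -
      have "(\<Sum>q\<in>?P. scale_fun (y i q) (f q)) = (\<Sum>j<g. \<Sum>l\<in>J. scale_fun (y i (j, l)) (f (j, l)))"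
        by (simp add: sum.cartesian_product)
      also have "\<dots> = (\<Sum>j<g. \<Sum>k<n. scale_fun (x (j, i, k)) (act d (\<alpha> j) (v k)))"
      proof (rule sum.cong[OF refl])
        fix j
        have "(\<Sum>l\<in>J. scale_fun (y i (j, l)) (f (j, l))) =
            (\<Sum>l\<in>J. \<Sum>k<n. scale_fun (x (j, i, k)) (scale_fun (u k l) (f (j, l))))"
          by (simp add: y_def fv.scale_sum_left)
        also have "\<dots> = (\<Sum>k<n. \<Sum>l\<in>J. scale_fun (x (j, i, k)) (scale_fun (u k l) (f (j, l))))"
          by (rule sum.swap)
        also have "\<dots> = (\<Sum>k<n. scale_fun (x (j, i, k)) (act d (\<alpha> j) (v k)))"
        proof (rule sum.cong[OF refl])
          fix k assume "k \<in> {..<n}"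
          then have "act d (\<alpha> j) (v k) = (\<Sum>l\<in>J. scale_fun (u k l) (f (j, l)))"
            using arg_cong[OF u[of k], of "act d (\<alpha> j)"] by (simp add: act_sum act_scale f_def)
          then show "(\<Sum>l\<in>J. scale_fun (x (j, i, k)) (scale_fun (u k l) (f (j, l)))) =
              scale_fun (x (j, i, k)) (act d (\<alpha> j) (v k))"
            by (simp add: fv.scale_sum_right)
        qed
        finally show "(\<Sum>l\<in>J. scale_fun (y i (j, l)) (f (j, l))) =
            (\<Sum>k<n. scale_fun (x (j, i, k)) (act d (\<alpha> j) (v k)))" .
      qed
      finally show ?thesis using row[OF that] by simp
    qed
    \<comment> \<open>Both sides of the eigenvalue equation are expanded in the basis
      \<open>I\<close>, where coefficients are unique.\<close>
    have yI: "y i p = \<mu> * (\<Sum>l\<in>J. u i l * e l p) - (\<Sum>q\<in>?P - I. y i q * c q p)"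
      if i: "i < n" and p: "p \<in> I" for i p
    proof -
      have "(\<Sum>p\<in>I. scale_fun (y i p + (\<Sum>q\<in>?P - I. y i q * c q p)) (f p))
          = (\<Sum>p\<in>I. scale_fun (y i p) (f p)) + (\<Sum>p\<in>I. \<Sum>q\<in>?P - I. scale_fun (y i q) (scale_fun (c q p) (f p)))"
        by (simp add: fv.scale_left_distrib fv.scale_sum_left sum.distrib)
      also have "(\<Sum>p\<in>I. \<Sum>q\<in>?P - I. scale_fun (y i q) (scale_fun (c q p) (f p)))
          = (\<Sum>q\<in>?P - I. \<Sum>p\<in>I. scale_fun (y i q) (scale_fun (c q p) (f p)))" by (rule sum.swap)
      also have "\<dots> = (\<Sum>q\<in>?P - I. scale_fun (y i q) (f q))"
      proof (rule sum.cong[OF refl])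
        fix q assume "q \<in> ?P - I"
        then have "q \<in> ?P" by blast
        then show "(\<Sum>p\<in>I. scale_fun (y i q) (scale_fun (c q p) (f p))) = scale_fun (y i q) (f q)"
          by (simp only: fv.scale_sum_right[symmetric] c[of q, symmetric])
      qed
      also have "(\<Sum>p\<in>I. scale_fun (y i p) (f p)) + (\<Sum>q\<in>?P - I. scale_fun (y i q) (f q))
          = (\<Sum>q\<in>?P. scale_fun (y i q) (f q))"
        using sum.subset_diff[OF I(1), of "\<lambda>q. scale_fun (y i q) (f q)"] finJ by (simp add: add.commute)
      also have "\<dots> = scale_fun \<mu> (\<Sum>l\<in>J. scale_fun (u i l) (v l))" using yf[OF i] u[OF i] by simp
      also have "\<dots> = (\<Sum>l\<in>J. \<Sum>p\<in>I. scale_fun (\<mu> * (u i l * e l p)) (f p))"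
        unfolding fv.scale_sum_right
      proof (rule sum.cong[OF refl])
        fix l assume "l \<in> J"
        then have "v l = (\<Sum>p\<in>I. scale_fun (e l p) (f p))" using e J(1) by auto
        then show "scale_fun \<mu> (scale_fun (u i l) (v l)) = (\<Sum>p\<in>I. scale_fun (\<mu> * (u i l * e l p)) (f p))"
          by (simp add: fv.scale_sum_right)
      qed
      also have "\<dots> = (\<Sum>p\<in>I. scale_fun (\<mu> * (\<Sum>l\<in>J. u i l * e l p)) (f p))"
        by (subst sum.swap) (simp only: sum_distrib_left fv.scale_sum_left)
      finally have "y i p + (\<Sum>q\<in>?P - I. y i q * c q p) = \<mu> * (\<Sum>l\<in>J. u i l * e l p)"
        by (rule indexed_independent[where c = "\<lambda>p. y i p + (\<Sum>q\<in>?P - I. y i q * c q p)"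
            and c' = "\<lambda>p. \<mu> * (\<Sum>l\<in>J. u i l * e l p)", OF finI I(2,3) _ p])
      then show ?thesis by (simp add: algebra_simps)
    qed
    have yx: "y i (j, l) = x (j, i, l) + (\<Sum>k\<in>{..<n} - J. x (j, i, k) * u k l)" if "l \<in> J" for i j l
    proof -
      have "y i (j, l) = (\<Sum>k\<in>J. x (j, i, k) * u k l) + (\<Sum>k\<in>{..<n} - J. x (j, i, k) * u k l)"
        using sum.subset_diff[OF J(1), of "\<lambda>k. x (j, i, k) * u k l"] by (simp add: y_def add.commute)
      also have "(\<Sum>k\<in>J. x (j, i, k) * u k l) = (\<Sum>k\<in>J. if k = l then x (j, i, l) else 0)"
        by (rule sum.cong) (auto simp: u_def)
      finally show ?thesis using that finJ by simp
    qed
    define \<theta> where "\<theta> s = (case s of PU i l \<Rightarrow> u i l | PX j i k \<Rightarrow> x (j, i, k) | PY i j l \<Rightarrow> y i (j, l)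
      | PL \<Rightarrow> \<mu> | PE l j l' \<Rightarrow> e l (j, l') | PC j l j' l' \<Rightarrow> c (j, l) (j', l'))" for s
    have pu: "par_u J \<theta> i l = u i l" for i l by (simp add: par_u_def \<theta>_def u_def)
    have py: "par_y g J I \<theta> i j l = y i (j, l)" if "i < n" for i j l
      using yI[OF that, of "(j, l)"] by (simp add: par_y_def pu) (simp add: \<theta>_def)
    have "x (j, i, k) = par_x g n J I (j, i, k) \<theta>" if "i < n" for j i k
      using yx[of k i j] by (simp add: par_x_def py[OF that] pu) (simp add: \<theta>_def)
    then show ?thesis by auto
  qed
  ultimately show ?thesis using J(1) I(1) by blast
qed

text \<open>Only finitely many pairs (J, I) occur, so the product of their equations works. Since
  \<mu> is one of the parameters, the hypersurface contains all nonzero multiples of the degenerate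
  tuples on the locus.\<close>

lemma bad_hypersurface:
  assumes irr: "irred g d \<alpha>" and n: "n > 1 + d\<^sup>2 + g * d\<^sup>2"
  shows "\<exists>q. entry_polynomial g n q \<and> (\<exists>x. q (tup g n x) \<noteq> 0) \<and>
    (\<forall>x \<mu> V. eigen g d n \<alpha> x \<mu> V \<longrightarrow> \<mu> \<noteq> 0 \<longrightarrow> \<not> inj_mat n d V \<longrightarrow> q (tup g n x) = 0)"
proof -
  define K where "K = {(J, I). J \<subseteq> {..<n} \<and> I \<subseteq> {..<g} \<times> J \<and> card J < card I \<and> card I \<le> d}"
  have "K \<subseteq> Pow {..<n} \<times> Pow ({..<g} \<times> {..<n})" by (auto simp: K_def)
  then have finK: "finite K" by (rule finite_subset) simp
  have "\<exists>q. entry_polynomial g n q \<and> (\<exists>x. q (tup g n x) \<noteq> 0) \<and>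
    (\<forall>\<theta>. q (tup g n (\<lambda>t. par_x g n (fst z) (snd z) t \<theta>)) = 0)" if "z \<in> K" for z
  proof -
    obtain J I where z: "z = (J, I)" "J \<subseteq> {..<n}" "I \<subseteq> {..<g} \<times> J" "card J < card I" "card I \<le> d"
      using \<open>z \<in> K\<close> by (auto simp: K_def)
    have "finite J" using z(2) by (rule finite_subset) simp
    moreover from this have "finite I" by (intro finite_subset[OF z(3)]) simp
    ultimately have "finite (params g n J I)" by (rule finite_params)
    from image_in_hypersurface[OF this card_params_less[OF z(2-5) n] param_poly_par_x[OF z(2,3)]] z(1)
    show ?thesis by simp
  qed
  then obtain Q where Q: "\<And>z. z \<in> K \<Longrightarrow> entry_polynomial g n (Q z)"
    "\<And>z. z \<in> K \<Longrightarrow> \<exists>x. Q z (tup g n x) \<noteq> 0"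
    "\<And>z \<theta>. z \<in> K \<Longrightarrow> Q z (tup g n (\<lambda>t. par_x g n (fst z) (snd z) t \<theta>)) = 0" by metis
  have "(\<Prod>z\<in>K. Q z (tup g n x)) = 0"
    if "eigen g d n \<alpha> x \<mu> V" "\<mu> \<noteq> 0" "\<not> inj_mat n d V" for x \<mu> V
  proof -
    from bad_param[OF irr that] obtain J I \<theta> where J: "(J, I) \<in> K" "\<forall>t\<in>idx g n. x t = par_x g n J I t \<theta>"
      unfolding K_def by blast
    then have "tup g n x = tup g n (\<lambda>t. par_x g n J I t \<theta>)" by (intro tup_cong) auto
    then have "Q (J, I) (tup g n x) = 0" using Q(3)[OF J(1)] by simp
    then show ?thesis using J(1) finK by (simp add: prod_zero_iff) blast
  qed
  moreover have "\<exists>x. (\<Prod>z\<in>K. Q z (tup g n x)) \<noteq> 0"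
    by (rule entry_polynomial_prod_nonzero[OF finK Q(1,2)])
  ultimately show ?thesis
    by (intro exI[of _ "\<lambda>X. \<Prod>z\<in>K. Q z X"]) (auto intro: entry_polynomial_prod Q)
qed

section \<open>The characteristic polynomial of a pencil\<close>

lemma sum_div_mod:
  fixes f :: "nat \<Rightarrow> nat \<Rightarrow> 'b::comm_monoid_add"
  shows "(\<Sum>r<d * n. f (r div n) (r mod n)) = (\<Sum>a<d. \<Sum>i<n. f a i)"
proof -
  have "(\<Sum>r<d * n. f (r div n) (r mod n)) = (\<Sum>a<d. \<Sum>r\<in>{a * n..<a * n + n}. f (r div n) (r mod n))"
    by (rule sum.nat_group[symmetric])
  also have "\<dots> = (\<Sum>a<d. \<Sum>i<n. f a i)"
  proof (rule sum.cong[OF refl])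
    fix a
    have "(\<Sum>r\<in>{0 + a * n..<n + a * n}. f (r div n) (r mod n)) = (\<Sum>i\<in>{0..<n}. f ((i + a * n) div n) ((i + a * n) mod n))"
      by (rule sum.shift_bounds_nat_ivl)
    also have "\<dots> = (\<Sum>i<n. f a i)"
      by (rule sum.cong) auto
    finally show "(\<Sum>r\<in>{a * n..<a * n + n}. f (r div n) (r mod n)) = (\<Sum>i<n. f a i)"
      by (simp add: add.commute)
  qed
  finally show ?thesis .
qed

text \<open>The matrix of the sum of A_j \<otimes> X_j. A row index encodes the pair (a, i) as a n +
  i, and \<open>flat\<close> lists the entries V (i, a) in the same order.\<close>

definition pmat :: "nat \<Rightarrow> nat \<Rightarrow> nat \<Rightarrow> (nat \<Rightarrow> nat \<Rightarrow> nat \<Rightarrow> complex) \<Rightarrow> tuple \<Rightarrow> complex mat" where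
  "pmat g d n \<alpha> x = mat (d * n) (d * n)
     (\<lambda>(r, c). \<Sum>j<g. \<alpha> j (r div n) (c div n) * x (j, r mod n, c mod n))"

definition flat :: "nat \<Rightarrow> nat \<Rightarrow> (nat \<times> nat \<Rightarrow> complex) \<Rightarrow> complex Matrix.vec" where
  "flat d n V = Matrix.vec (d * n) (\<lambda>r. V (r mod n, r div n))"

definition unflat :: "nat \<Rightarrow> complex Matrix.vec \<Rightarrow> nat \<times> nat \<Rightarrow> complex" where
  "unflat n v = (\<lambda>(i, a). vec_index v (a * n + i))"

lemma pmat_carrier [simp]: "pmat g d n \<alpha> x \<in> carrier_mat (d * n) (d * n)"
  by (simp add: pmat_def)

lemma flat_carrier [simp]: "flat d n V \<in> carrier_vec (d * n)"
  by (simp add: flat_def)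

lemma div_mod_bounds: "r < d * n \<Longrightarrow> r div n < d \<and> r mod n < n" for r :: nat
  by (metis less_mult_imp_div_less mod_less_divisor mult_0_right not_gr_zero not_less_zero)

lemma flat_unflat: "v \<in> carrier_vec (d * n) \<Longrightarrow> flat d n (unflat n v) = v"
  by (auto simp: flat_def unflat_def)

lemma flat_cong: "(\<And>i a. i < n \<Longrightarrow> a < d \<Longrightarrow> V (i, a) = W (i, a)) \<Longrightarrow> flat d n V = flat d n W"
  unfolding flat_def using div_mod_bounds[of _ d n] by (auto intro!: eq_vecI)

lemma mult_add_less: "a < d \<Longrightarrow> i < n \<Longrightarrow> a * n + i < d * n" for a d i n :: nat
proof -
  assume "a < d" "i < n"
  then have "a * n + i < Suc a * n" by simp
  also have "\<dots> \<le> d * n" using \<open>a < d\<close> by (intro mult_le_mono1) simp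
  finally show ?thesis .
qed

lemma flat_eq_iff: "flat d n V = flat d n W \<longleftrightarrow> (\<forall>i<n. \<forall>a<d. V (i, a) = W (i, a))"
proof
  assume eq: "flat d n V = flat d n W"
  show "\<forall>i<n. \<forall>a<d. V (i, a) = W (i, a)"
  proof (intro allI impI)
    fix i a assume "i < n" "a < d"
    then have "a * n + i < d * n" by (intro mult_add_less)
    with arg_cong[OF eq, of "\<lambda>v. vec_index v (a * n + i)"] \<open>i < n\<close>
    show "V (i, a) = W (i, a)" by (simp add: flat_def)
  qed
qed (auto intro: flat_cong)

lemma flat_zero_iff: "flat d n V = 0\<^sub>v (d * n) \<longleftrightarrow> (\<forall>i<n. \<forall>a<d. V (i, a) = 0)"
proof -
  have "0\<^sub>v (d * n) = flat d n (\<lambda>_. 0)" by (auto simp: flat_def)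
  then show ?thesis by (simp add: flat_eq_iff)
qed

lemma pmat_mult_flat: "pmat g d n \<alpha> x *\<^sub>v flat d n V = flat d n (pencil_op g d n \<alpha> x V)"
proof (rule eq_vecI)
  show "dim_vec (pmat g d n \<alpha> x *\<^sub>v flat d n V) = dim_vec (flat d n (pencil_op g d n \<alpha> x V))"
    by (simp add: pmat_def flat_def)
  fix r assume "r < dim_vec (flat d n (pencil_op g d n \<alpha> x V))"
  then have r: "r < d * n" by (simp add: flat_def)
  have "vec_index (pmat g d n \<alpha> x *\<^sub>v flat d n V) r
      = (\<Sum>c<d * n. (\<Sum>j<g. \<alpha> j (r div n) (c div n) * x (j, r mod n, c mod n)) * V (c mod n, c div n))"
    using r by (simp add: pmat_def flat_def scalar_prod_def atLeast0LessThan)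
  also have "\<dots> = (\<Sum>b<d. \<Sum>k<n. (\<Sum>j<g. \<alpha> j (r div n) b * x (j, r mod n, k)) * V (k, b))"
    using sum_div_mod[of "\<lambda>b k. (\<Sum>j<g. \<alpha> j (r div n) b * x (j, r mod n, k)) * V (k, b)"] .
  also have "\<dots> = (\<Sum>b<d. \<Sum>k<n. \<Sum>j<g. x (j, r mod n, k) * \<alpha> j (r div n) b * V (k, b))"
    by (simp only: sum_distrib_right mult.commute[of "\<alpha> _ _ _"])
  also have "\<dots> = (\<Sum>b<d. \<Sum>j<g. \<Sum>k<n. x (j, r mod n, k) * \<alpha> j (r div n) b * V (k, b))"
    by (intro sum.cong refl sum.swap)
  also have "\<dots> = (\<Sum>j<g. \<Sum>b<d. \<Sum>k<n. x (j, r mod n, k) * \<alpha> j (r div n) b * V (k, b))"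
    by (rule sum.swap)
  also have "\<dots> = (\<Sum>j<g. \<Sum>k<n. \<Sum>b<d. x (j, r mod n, k) * \<alpha> j (r div n) b * V (k, b))"
    by (intro sum.cong refl sum.swap)
  finally show "vec_index (pmat g d n \<alpha> x *\<^sub>v flat d n V) r = vec_index (flat d n (pencil_op g d n \<alpha> x V)) r"
    using r by (simp add: flat_def pencil_op_def)
qed

lemma smult_flat: "c \<cdot>\<^sub>v flat d n V = flat d n (\<lambda>t. c * V t)"
  by (auto simp: flat_def)

lemma eigen_iff_eigenvector:
  "eigen g d n \<alpha> x \<mu> V \<longleftrightarrow> eigenvector (pmat g d n \<alpha> x) (flat d n V) \<mu>"
proof -
  have "dim_row (pmat g d n \<alpha> x) = d * n" by (simp add: pmat_def)
  then show ?thesis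
    by (auto simp: eigen_def eigenvector_def flat_zero_iff pmat_mult_flat smult_flat flat_eq_iff)
qed

definition chp :: "nat \<Rightarrow> nat \<Rightarrow> nat \<Rightarrow> (nat \<Rightarrow> nat \<Rightarrow> nat \<Rightarrow> complex) \<Rightarrow> tuple \<Rightarrow> complex poly" where
  "chp g d n \<alpha> x = char_poly (pmat g d n \<alpha> x)"

lemma chp_root_iff: "poly (chp g d n \<alpha> x) \<mu> = 0 \<longleftrightarrow> (\<exists>V. eigen g d n \<alpha> x \<mu> V)"
proof -
  have "poly (chp g d n \<alpha> x) \<mu> = 0 \<longleftrightarrow> eigenvalue (pmat g d n \<alpha> x) \<mu>"
    unfolding chp_def using eigenvalue_root_char_poly[OF pmat_carrier] by simp
  also have "\<dots> \<longleftrightarrow> (\<exists>V. eigen g d n \<alpha> x \<mu> V)"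
  proof
    assume "eigenvalue (pmat g d n \<alpha> x) \<mu>"
    then obtain v where v: "eigenvector (pmat g d n \<alpha> x) v \<mu>" by (auto simp: eigenvalue_def)
    then have "v \<in> carrier_vec (d * n)" by (auto simp: eigenvector_def pmat_def)
    then have "eigen g d n \<alpha> x \<mu> (unflat n v)"
      using v by (simp add: eigen_iff_eigenvector flat_unflat)
    then show "\<exists>V. eigen g d n \<alpha> x \<mu> V" by blast
  qed (auto simp: eigen_iff_eigenvector eigenvalue_def)
  finally show ?thesis .
qed

lemma chp_degree: "degree (chp g d n \<alpha> x) = d * n" "coeff (chp g d n \<alpha> x) (d * n) = 1"
  using degree_monic_char_poly[OF pmat_carrier] by (auto simp: chp_def)

lemma chp_poly: "poly (chp g d n \<alpha> x) \<mu> = (\<Sum>k\<le>d * n. coeff (chp g d n \<alpha> x) k * \<mu> ^ k)"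
  by (simp add: poly_altdef chp_degree)

lemma pmat_cong: "(\<And>t. t \<in> idx g n \<Longrightarrow> x t = y t) \<Longrightarrow> pmat g d n \<alpha> x = pmat g d n \<alpha> y"
  unfolding pmat_def using div_mod_bounds[of _ d n]
  by (auto intro!: eq_matI sum.cong)

text \<open>The Leibniz formula builds the characteristic polynomial from the entries of the pencil
  by sums and products, and both preserve the property \<open>ep\<close> of having polynomial
  coefficients.\<close>

lemma chp_coeff_polynomial:
  obtains c where "\<And>k. entry_polynomial g n (c k)"
    "\<And>k x. c k (tup g n x) = coeff (chp g d n \<alpha> x) k"
proof -
  define ep where "ep P \<longleftrightarrow> (\<forall>k. entry_polynomial g n (\<lambda>X. coeff (P X) k))" for P :: "complex mat list \<Rightarrow> complex poly"
  have const: "ep (\<lambda>_. a)" for a by (auto simp: ep_def intro: entry_polynomial.const)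
  have add: "ep (\<lambda>X. P X + Q X)" if "ep P" "ep Q" for P Q
    using that by (auto simp: ep_def intro: entry_polynomial.add)
  have mult: "ep (\<lambda>X. P X * Q X)" if "ep P" "ep Q" for P Q
    using that by (auto simp: ep_def coeff_mult intro!: entry_polynomial_sum entry_polynomial.mult)
  have sum: "ep (\<lambda>X. \<Sum>i\<in>I. P i X)" if "\<And>i. i \<in> I \<Longrightarrow> ep (P i)" for P and I :: "'i set"
    using that by (induction I rule: infinite_finite_induct) (auto intro: const add)
  have prod: "ep (\<lambda>X. \<Prod>i\<in>I. P i X)" if "\<And>i. i \<in> I \<Longrightarrow> ep (P i)" for P and I :: "'i set"
    using that by (induction I rule: infinite_finite_induct) (auto intro: const mult)
  have mono: "ep (\<lambda>X. [:p X:])" if "entry_polynomial g n p" for p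
    unfolding ep_def
  proof
    fix k show "entry_polynomial g n (\<lambda>X. coeff [:p X:] k)"
      using that by (cases k) (auto intro: entry_polynomial.const)
  qed
  define C where "C X = char_poly_matrix (pmat g d n \<alpha> (untup X))" for X
  have C: "C X \<in> carrier_mat (d * n) (d * n)" for X by (simp add: C_def)
  have entry: "ep (\<lambda>X. C X $$ (r, c))" if "r < d * n" "c < d * n" for r c
  proof -
    have "(\<lambda>X. C X $$ (r, c)) = (\<lambda>X. (if r = c then [:0, 1:] else 0) +
        [:\<Sum>j<g. (- \<alpha> j (r div n) (c div n)) * untup X (j, r mod n, c mod n):])"
      using that by (auto simp: C_def char_poly_matrix_def pmat_def fun_eq_iff sum_negf)
    moreover have "ep \<dots>"
      using div_mod_bounds[OF that(1)] div_mod_bounds[OF that(2)]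
      by (intro add const mono entry_polynomial_sum entry_polynomial.mult entry_polynomial.const
          entry_polynomial_entry_tup) auto
    ultimately show ?thesis by simp
  qed
  have "ep (\<lambda>X. det (C X))"
    unfolding det_def'[OF C]
    by (intro sum mult const prod entry) (auto simp: permutes_in_image)
  then have ep: "ep (\<lambda>X. chp g d n \<alpha> (untup X))" by (simp add: chp_def char_poly_def C_def)
  have "chp g d n \<alpha> (untup (tup g n x)) = chp g d n \<alpha> x" for x
    unfolding chp_def by (rule arg_cong[where f = char_poly], rule pmat_cong) (simp add: untup_tup)
  with ep show thesis
    by (intro that[of "\<lambda>k X. coeff (chp g d n \<alpha> (untup X)) k"]) (auto simp: ep_def)
qed

lemma prod_list_ge_power:
  fixes m :: real
  assumes "0 \<le> m" "\<And>e. e \<in> set es \<Longrightarrow> m \<le> f e"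
  shows "m ^ length es \<le> (\<Prod>e\<leftarrow>es. f e)"
  using assms(2)
proof (induction es)
  case (Cons e es)
  then have "m ^ length es \<le> (\<Prod>e\<leftarrow>es. f e)" "m \<le> f e" by auto
  then have "m * m ^ length es \<le> f e * (\<Prod>e\<leftarrow>es. f e)"
    using assms(1) by (intro mult_mono) (auto intro: order_trans[OF assms(1)])
  then show ?case by simp
qed simp

text \<open>The modulus of the value at \<open>w\<close> is the product of the distances to all
  \<open>d * n\<close> roots, so a small value forces a root nearby. This gives continuity of roots
  without following a branch.\<close>

lemma chp_root_near:
  assumes "0 < d * n"
  shows "\<exists>\<mu>. poly (chp g d n \<alpha> x) \<mu> = 0 \<and> cmod (w - \<mu>) ^ (d * n) \<le> cmod (poly (chp g d n \<alpha> x) w)"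
proof -
  obtain es where es: "chp g d n \<alpha> x = (\<Prod>a\<leftarrow>es. [:- a, 1:])" "length es = d * n"
    using char_poly_factorized[OF pmat_carrier] unfolding chp_def by blast
  have P: "poly (chp g d n \<alpha> x) z = (\<Prod>a\<leftarrow>es. z - a)" for z
    unfolding es(1) by (simp add: poly_prod_list o_def)
  define m where "m = Min ((\<lambda>e. cmod (w - e)) ` set es)"
  have ne: "set es \<noteq> {}" using es(2) assms by auto
  then have "m \<in> (\<lambda>e. cmod (w - e)) ` set es" unfolding m_def by (intro Min_in) auto
  then obtain \<mu> where \<mu>: "\<mu> \<in> set es" "m = cmod (w - \<mu>)" by auto
  have "m ^ length es \<le> (\<Prod>e\<leftarrow>es. cmod (w - e))"
  proof (rule prod_list_ge_power)
    show "0 \<le> m" using \<mu>(2) by simp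
    show "m \<le> cmod (w - e)" if "e \<in> set es" for e
      unfolding m_def using that by (intro Min_le) auto
  qed
  also have "\<dots> = cmod (\<Prod>e\<leftarrow>es. w - e)" by (induction es) (auto simp: norm_mult)
  finally have "cmod (w - \<mu>) ^ (d * n) \<le> cmod (poly (chp g d n \<alpha> x) w)" using \<mu> es(2) P by simp
  moreover have "poly (chp g d n \<alpha> x) \<mu> = 0" using \<mu>(1) by (auto simp: P prod_list_zero_iff)
  ultimately show ?thesis by blast
qed

section \<open>The inner product of kernel matrices and simple eigenvalues\<close>

definition ip :: "nat \<Rightarrow> nat \<Rightarrow> (nat \<times> nat \<Rightarrow> complex) \<Rightarrow> (nat \<times> nat \<Rightarrow> complex) \<Rightarrow> complex" where
  "ip n d V W = (\<Sum>i<n. \<Sum>a<d. V (i, a) * cnj (W (i, a)))"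

lemma ip_commute: "ip n d W V = cnj (ip n d V W)"
  by (simp add: ip_def mult.commute)

lemma ip_self: "ip n d V V = of_real (\<Sum>i<n. \<Sum>a<d. (cmod (V (i, a)))\<^sup>2)"
  by (simp add: ip_def complex_norm_square[symmetric])

lemma ip_pencil_herm:
  assumes "herm_coeff g d \<alpha>" "herm g n x"
  shows "ip n d (pencil_op g d n \<alpha> x V) W = ip n d V (pencil_op g d n \<alpha> x W)"
proof -
  define f where "f i a j k b = x (j, i, k) * \<alpha> j a b * V (k, b) * cnj (W (i, a))" for i a j k b
  have "ip n d (pencil_op g d n \<alpha> x V) W = (\<Sum>i<n. \<Sum>a<d. \<Sum>j<g. \<Sum>k<n. \<Sum>b<d. f i a j k b)"
    by (simp add: ip_def pencil_op_def sum_distrib_right f_def)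
  also have "\<dots> = (\<Sum>t\<in>{..<n} \<times> {..<d} \<times> {..<g} \<times> {..<n} \<times> {..<d}. case t of (i, a, j, k, b) \<Rightarrow> f i a j k b)"
    by (simp add: sum.cartesian_product)
  also have "\<dots> = (\<Sum>t\<in>{..<n} \<times> {..<d} \<times> {..<g} \<times> {..<n} \<times> {..<d}. case t of (k, b, j, i, a) \<Rightarrow> f i a j k b)"
    by (rule sum.reindex_bij_witness[of _ "\<lambda>(i, a, j, k, b). (k, b, j, i, a)" "\<lambda>(i, a, j, k, b). (k, b, j, i, a)"]) auto
  also have "\<dots> = (\<Sum>k<n. \<Sum>b<d. \<Sum>j<g. \<Sum>i<n. \<Sum>a<d. f i a j k b)"
    by (simp add: sum.cartesian_product)
  also have "\<dots> = ip n d V (pencil_op g d n \<alpha> x W)"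
    unfolding ip_def pencil_op_def f_def using assms
    by (auto simp: herm_coeff_def herm_def sum_distrib_left mult_ac intro!: sum.cong)
  finally show ?thesis .
qed

definition simple_kernel :: "nat \<Rightarrow> nat \<Rightarrow> nat \<Rightarrow> (nat \<Rightarrow> nat \<Rightarrow> nat \<Rightarrow> complex) \<Rightarrow> tuple \<Rightarrow> complex \<Rightarrow> bool" where
  "simple_kernel g d n \<alpha> x \<mu> \<longleftrightarrow> (\<exists>V. eigen g d n \<alpha> x \<mu> V \<and>
     (\<forall>W. eigen g d n \<alpha> x \<mu> W \<longrightarrow> (\<exists>c. \<forall>i<n. \<forall>a<d. W (i, a) = c * V (i, a))))"

lemma ip_flat:
  "ip n d V W = flat d n V \<bullet>c flat d n W"
proof -
  have "flat d n V \<bullet>c flat d n W = (\<Sum>r<d * n. V (r mod n, r div n) * cnj (W (r mod n, r div n)))"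
    by (simp add: flat_def scalar_prod_def atLeast0LessThan)
  also have "\<dots> = (\<Sum>a<d. \<Sum>i<n. V (i, a) * cnj (W (i, a)))"
    by (rule sum_div_mod[of "\<lambda>a i. V (i, a) * cnj (W (i, a))"])
  also have "\<dots> = ip n d V W" unfolding ip_def by (rule sum.swap)
  finally show ?thesis ..
qed

text \<open>A double root yields, by a Schur decomposition starting with it, two independent vectors \<open>p\<close>, \<open>q\<close>
  with \<open>M p = \<mu> p\<close> and \<open>M q = \<mu> q + b p\<close>; for hermitian \<open>M\<close> this forces \<open>b = 0\<close>.\<close>

lemma chp_simple_root:
  assumes h: "herm_coeff g d \<alpha>" "herm g n x" and s: "simple_kernel g d n \<alpha> x \<mu>" and \<mu>: "cnj \<mu> = \<mu>"
  shows "poly (pderiv (chp g d n \<alpha> x)) \<mu> \<noteq> 0"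
proof
  let ?M = "pmat g d n \<alpha> x" and ?N = "d * n"
  assume deriv: "poly (pderiv (chp g d n \<alpha> x)) \<mu> = 0"
  obtain V where V: "eigen g d n \<alpha> x \<mu> V"
    "\<And>W. eigen g d n \<alpha> x \<mu> W \<Longrightarrow> (\<exists>c. \<forall>i<n. \<forall>a<d. W (i, a) = c * V (i, a))"
    using s by (auto simp: simple_kernel_def)
  then have root: "poly (chp g d n \<alpha> x) \<mu> = 0" by (auto simp: chp_root_iff)
  obtain es where es: "chp g d n \<alpha> x = (\<Prod>a\<leftarrow>es. [:- a, 1:])" "length es = ?N"
    using char_poly_factorized[OF pmat_carrier] unfolding chp_def by blast
  have "\<mu> \<in> set es" using root by (auto simp: es(1) poly_prod_list prod_list_zero_iff)
  then have e1: "chp g d n \<alpha> x = [:- \<mu>, 1:] * (\<Prod>a\<leftarrow>remove1 \<mu> es. [:- a, 1:])"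
    unfolding es(1) by (rule prod_list_map_remove1)
  \<comment> \<open>At \<mu> only the term that differentiates the split-off factor survives, so a
    vanishing derivative makes \<mu> a root of the remaining product.\<close>
  have "poly (pderiv (chp g d n \<alpha> x)) \<mu> = poly (\<Prod>a\<leftarrow>remove1 \<mu> es. [:- a, 1:]) \<mu>"
    unfolding e1 pderiv_mult by (simp add: pderiv_pCons)
  then have "\<mu> \<in> set (remove1 \<mu> es)" using deriv by (auto simp: poly_prod_list prod_list_zero_iff)
  then have e2: "chp g d n \<alpha> x = (\<Prod>a\<leftarrow>\<mu> # \<mu> # remove1 \<mu> (remove1 \<mu> es). [:- a, 1:])"
    unfolding e1 by (simp add: prod_list_map_remove1)
  obtain B P Q where schur: "schur_decomposition ?M (\<mu> # \<mu> # remove1 \<mu> (remove1 \<mu> es)) = (B, P, Q)"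
    by (metis prod_cases3)
  from schur_decomposition[OF pmat_carrier e2[unfolded chp_def] this]
  have sim: "similar_mat_wit ?M B P Q" and ut: "upper_triangular B"
    and diag: "diag_mat B = \<mu> # \<mu> # remove1 \<mu> (remove1 \<mu> es)" by auto
  note w = similar_mat_witD2[OF pmat_carrier sim]
  have "length (diag_mat B) = ?N" using w(5) by (simp add: diag_mat_def)
  then have N: "1 < ?N" using diag by simp
  have B00: "B $$ (0, 0) = \<mu>" and B11: "B $$ (1, 1) = \<mu>"
  proof -
    have "diag_mat B ! k = B $$ (k, k)" if "k < ?N" for k
      using that w(5) by (simp add: diag_mat_def)
    from this[of 0] this[of 1] have "diag_mat B ! 0 = B $$ (0, 0)" "diag_mat B ! 1 = B $$ (1, 1)"
      using N by linarith+
    then show "B $$ (0, 0) = \<mu>" "B $$ (1, 1) = \<mu>" unfolding diag by simp_all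
  qed
  have below: "B $$ (r, c) = 0" if "c < r" "r < ?N" for r c
    using ut that w(5) by (auto simp: upper_triangular_def)
  define p q where "p = col P 0" and "q = col P 1"
  have pq: "p \<in> carrier_vec ?N" "q \<in> carrier_vec ?N" unfolding p_def q_def using w(6) by (auto intro!: carrier_vecI)
  have MP: "?M * P = P * B"
  proof -
    have "?M * P = P * B * (Q * P)" using w by (simp add: assoc_mult_mat[of _ ?N ?N _ ?N _ ?N])
    then show ?thesis using w by simp
  qed
  have Mcol: "?M *\<^sub>v col P c = P *\<^sub>v col B c" if "c < ?N" for c
  proof -
    have "?M *\<^sub>v col P c = col (?M * P) c" by (rule col_mult2[OF w(4,6) that, symmetric])
    also have "\<dots> = P *\<^sub>v col B c" unfolding MP by (rule col_mult2[OF w(6,5) that])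
    finally show ?thesis .
  qed
  have colB: "vec_index (col B c) r = B $$ (r, c)" if "c < ?N" "r < ?N" for c r
    using that carrier_matD[OF w(5)] by (intro index_col) simp_all
  have N0: "0 < ?N" using N by linarith
  have c0: "col B 0 = \<mu> \<cdot>\<^sub>v unit_vec ?N 0"
  proof (rule eq_vecI)
    fix r assume "r < dim_vec (\<mu> \<cdot>\<^sub>v unit_vec ?N 0)"
    then have r: "r < ?N" by simp
    then show "vec_index (col B 0) r = vec_index (\<mu> \<cdot>\<^sub>v unit_vec ?N 0) r"
      using B00 below[of 0 r] colB[OF N0 r] by (cases "r = 0") (auto simp: unit_vec_def)
  qed (use carrier_matD[OF w(5)] in simp)
  have c1: "col B 1 = B $$ (0, 1) \<cdot>\<^sub>v unit_vec ?N 0 + \<mu> \<cdot>\<^sub>v unit_vec ?N 1"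
  proof (rule eq_vecI)
    fix r assume "r < dim_vec (B $$ (0, 1) \<cdot>\<^sub>v unit_vec ?N 0 + \<mu> \<cdot>\<^sub>v unit_vec ?N 1)"
    then have r: "r < ?N" by simp
    consider "r = 0" | "r = 1" | "1 < r" by linarith
    then show "vec_index (col B 1) r = vec_index (B $$ (0, 1) \<cdot>\<^sub>v unit_vec ?N 0 + \<mu> \<cdot>\<^sub>v unit_vec ?N 1) r"
      using B11 below[of 1 r] r colB[OF N r] by cases (auto simp: unit_vec_def)
  qed (use carrier_matD[OF w(5)] in simp)
  have Pu: "P *\<^sub>v unit_vec ?N c = col P c" if "c < ?N" for c
    using that w(6) by (intro eq_vecI) auto
  have Mp: "?M *\<^sub>v p = \<mu> \<cdot>\<^sub>v p"
  proof -
    have "?M *\<^sub>v p = P *\<^sub>v (\<mu> \<cdot>\<^sub>v unit_vec ?N 0)" unfolding p_def c0[symmetric] by (rule Mcol[OF N0])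
    also have "\<dots> = \<mu> \<cdot>\<^sub>v (P *\<^sub>v unit_vec ?N 0)" by (rule mult_mat_vec[OF w(6)]) simp
    finally show ?thesis using Pu[OF N0] N by (simp add: p_def)
  qed
  have Mq: "?M *\<^sub>v q = B $$ (0, 1) \<cdot>\<^sub>v p + \<mu> \<cdot>\<^sub>v q"
  proof -
    have "?M *\<^sub>v q = P *\<^sub>v (B $$ (0, 1) \<cdot>\<^sub>v unit_vec ?N 0 + \<mu> \<cdot>\<^sub>v unit_vec ?N 1)"
      unfolding q_def c1[symmetric] by (rule Mcol[OF N])
    also have "\<dots> = P *\<^sub>v (B $$ (0, 1) \<cdot>\<^sub>v unit_vec ?N 0) + P *\<^sub>v (\<mu> \<cdot>\<^sub>v unit_vec ?N 1)"
      by (rule mult_add_distrib_mat_vec[OF w(6)]) simp_all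
    also have "\<dots> = B $$ (0, 1) \<cdot>\<^sub>v (P *\<^sub>v unit_vec ?N 0) + \<mu> \<cdot>\<^sub>v (P *\<^sub>v unit_vec ?N 1)"
      by (simp only: mult_mat_vec[OF w(6) unit_vec_carrier])
    finally show ?thesis using Pu[OF N0] Pu[OF N] N by (simp add: p_def q_def)
  qed
  define p' q' where "p' = unflat n p" and "q' = unflat n q"
  have f: "flat d n p' = p" "flat d n q' = q" using pq by (auto simp: p'_def q'_def flat_unflat)
  have Qp: "Q *\<^sub>v col P c = unit_vec ?N c" if "c < ?N" for c
  proof -
    have "Q *\<^sub>v col P c = col (Q * P) c" by (rule col_mult2[OF w(7,6) that, symmetric])
    then show ?thesis unfolding w(2) using that by simp
  qed
  have rowQ: "row Q i \<in> carrier_vec ?N" for i using w(7) by (auto intro!: carrier_vecI)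
  have Q0: "Q *\<^sub>v 0\<^sub>v ?N = 0\<^sub>v ?N"
    using w(7) rowQ by (intro eq_vecI) auto
  have p0: "p \<noteq> 0\<^sub>v ?N"
  proof
    assume "p = 0\<^sub>v ?N"
    then have eq: "unit_vec ?N 0 = Q *\<^sub>v (0\<^sub>v ?N :: complex Matrix.vec)" using Qp[OF N0] N by (simp add: p_def)
    show False using arg_cong[OF eq, of "\<lambda>v. vec_index v 0"] Q0 N N0 by simp
  qed
  have opp: "pencil_op g d n \<alpha> x p' (i, a) = \<mu> * p' (i, a)" if "i < n" "a < d" for i a
  proof -
    have "flat d n (pencil_op g d n \<alpha> x p') = flat d n (\<lambda>t. \<mu> * p' t)"
      unfolding pmat_mult_flat[symmetric] smult_flat[symmetric] f by (rule Mp)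
    then show ?thesis using that by (simp add: flat_eq_iff)
  qed
  have eigp: "eigen g d n \<alpha> x \<mu> p'"
    using opp p0 flat_zero_iff[of d n p'] by (auto simp: eigen_def f)
  have opq: "pencil_op g d n \<alpha> x q' (i, a) = B $$ (0, 1) * p' (i, a) + \<mu> * q' (i, a)" if "i < n" "a < d" for i a
  proof -
    have "flat d n (pencil_op g d n \<alpha> x q') = flat d n (\<lambda>t. B $$ (0, 1) * p' t + \<mu> * q' t)"
    proof -
      have "flat d n (\<lambda>t. B $$ (0, 1) * p' t + \<mu> * q' t) = B $$ (0, 1) \<cdot>\<^sub>v flat d n p' + \<mu> \<cdot>\<^sub>v flat d n q'"
        by (auto simp: flat_def)
      then show ?thesis unfolding pmat_mult_flat[symmetric] f by (simp only: Mq)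
    qed
    then show ?thesis using that by (simp add: flat_eq_iff)
  qed
  \<comment> \<open>Self-adjointness is tested on q' and p'. As \<mu> is real, the terms with \<mu>
    cancel and the off-diagonal entry times the squared norm of p' is left.\<close>
  have "ip n d (pencil_op g d n \<alpha> x q') p' = B $$ (0, 1) * ip n d p' p' + \<mu> * ip n d q' p'"
    by (simp add: ip_def opq algebra_simps sum.distrib sum_distrib_left)
  moreover have "ip n d q' (pencil_op g d n \<alpha> x p') = \<mu> * ip n d q' p'"
    using \<mu> by (simp add: ip_def opp sum_distrib_left mult_ac)
  ultimately have "B $$ (0, 1) * ip n d p' p' = 0" using ip_pencil_herm[OF h, of q' p'] by simp
  moreover have "ip n d p' p' \<noteq> 0"
    using p0 pq by (simp add: ip_flat f conjugate_square_eq_0_vec)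
  ultimately have "B $$ (0, 1) = 0" by simp
  then have opq': "pencil_op g d n \<alpha> x q' (i, a) = \<mu> * q' (i, a)" if "i < n" "a < d" for i a
    using opq that by simp
  have q0: "q \<noteq> 0\<^sub>v ?N"
  proof
    assume "q = 0\<^sub>v ?N"
    then have eq: "unit_vec ?N 1 = Q *\<^sub>v (0\<^sub>v ?N :: complex Matrix.vec)" using Qp[OF N] N by (simp add: q_def)
    show False using arg_cong[OF eq, of "\<lambda>v. vec_index v 1"] Q0 N N0 by simp
  qed
  have eigq: "eigen g d n \<alpha> x \<mu> q'"
    using opq' q0 flat_zero_iff[of d n q'] by (auto simp: eigen_def f)
  obtain c1 c2 where "\<forall>i<n. \<forall>a<d. p' (i, a) = c1 * V (i, a)" "\<forall>i<n. \<forall>a<d. q' (i, a) = c2 * V (i, a)"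
    using V(2)[OF eigp] V(2)[OF eigq] by blast
  then have "p = c1 \<cdot>\<^sub>v flat d n V" "q = c2 \<cdot>\<^sub>v flat d n V"
    unfolding f[symmetric] smult_flat by (auto intro: flat_cong)
  \<comment> \<open>\<open>p\<close> and \<open>q\<close> are multiples of one kernel vector; the
    inverse \<open>Q\<close> of \<open>P\<close> turns this into a relation between two distinct
    unit vectors.\<close>
  then have "c2 \<cdot>\<^sub>v p = c1 \<cdot>\<^sub>v q" by (auto simp: smult_smult_assoc mult.commute)
  then have "Q *\<^sub>v (c2 \<cdot>\<^sub>v p) = Q *\<^sub>v (c1 \<cdot>\<^sub>v q)" by simp
  then have eq: "c2 \<cdot>\<^sub>v unit_vec ?N 0 = c1 \<cdot>\<^sub>v (unit_vec ?N 1 :: complex Matrix.vec)"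
    unfolding mult_mat_vec[OF w(7) pq(1)] mult_mat_vec[OF w(7) pq(2)]
    using Qp[OF N0] Qp[OF N] N by (simp add: p_def q_def)
  have "c1 = 0" using arg_cong[OF eq, of "\<lambda>v. vec_index v 1"] N by (simp add: unit_vec_def)
  then have "p = 0\<^sub>v ?N" using \<open>p = c1 \<cdot>\<^sub>v flat d n V\<close> by (auto simp: flat_def)
  with p0 show False by blast
qed

section \<open>Analytic continuation from hermitian tuples\<close>

definition tdist :: "nat \<Rightarrow> nat \<Rightarrow> tuple \<Rightarrow> tuple \<Rightarrow> real" where
  "tdist g n x y = (\<Sum>t\<in>idx g n. cmod (x t - y t))"

text \<open>Neighbourhoods of \<open>x0\<close> with respect to the entries in
  \<open>idx g n\<close> alone; coordinates outside this range are unconstrained.\<close>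

definition near :: "nat \<Rightarrow> nat \<Rightarrow> tuple \<Rightarrow> tuple filter" where
  "near g n x0 = filtercomap (\<lambda>x. tdist g n x x0) (nhds 0)"

lemma tdist_nonneg [simp]: "0 \<le> tdist g n x y"
  by (simp add: tdist_def sum_nonneg)

lemma eventually_near: "eventually P (near g n x0) \<longleftrightarrow> (\<exists>e>0. \<forall>x. tdist g n x x0 < e \<longrightarrow> P x)"
  unfolding near_def eventually_filtercomap eventually_nhds_metric
proof safe
  fix Q and e :: real
  assume "\<forall>x. Q (tdist g n x x0) \<longrightarrow> P x" "0 < e" "\<forall>x. dist x 0 < e \<longrightarrow> Q x"
  then show "\<exists>e>0. \<forall>x. tdist g n x x0 < e \<longrightarrow> P x" by (intro exI[of _ e]) auto
next
  fix e :: real assume "0 < e" "\<forall>x. tdist g n x x0 < e \<longrightarrow> P x"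
  then show "\<exists>Q. (\<exists>d>0. \<forall>x. dist x 0 < d \<longrightarrow> Q x) \<and> (\<forall>x. Q (tdist g n x x0) \<longrightarrow> P x)"
    by (intro exI[of _ "\<lambda>r. r < e"]) auto
qed

lemma tdist_coord: "t \<in> idx g n \<Longrightarrow> cmod (x t - y t) \<le> tdist g n x y"
  unfolding tdist_def by (rule member_le_sum) auto

lemma tendsto_near_coord: "t \<in> idx g n \<Longrightarrow> ((\<lambda>x. x t) \<longlongrightarrow> x0 t) (near g n x0)"
  unfolding tendsto_iff eventually_near dist_norm using tdist_coord by (meson order_le_less_trans)

lemma tendsto_near:
  assumes "entry_polynomial g n p"
  shows "((\<lambda>x. p (tup g n x)) \<longlongrightarrow> p (tup g n x0)) (near g n x0)"
  by (rule entry_polynomial_tendsto[OF assms tendsto_near_coord])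

lemma filterlim_near:
  assumes "\<And>t. t \<in> idx g n \<Longrightarrow> ((\<lambda>s. f s t) \<longlongrightarrow> x0 t) F"
  shows "filterlim f (near g n x0) F"
proof -
  have "((\<lambda>s. tdist g n (f s) x0) \<longlongrightarrow> (\<Sum>t\<in>idx g n. cmod (x0 t - x0 t))) F"
    unfolding tdist_def by (intro tendsto_sum tendsto_norm tendsto_diff assms tendsto_const)
  then show ?thesis unfolding near_def by (simp add: filterlim_filtercomap_iff o_def)
qed

text \<open>The quotient (P(a) - P(b)) / (a - b) written as a polynomial, so that it extends
  continuously to a = b, where it is the derivative. The fixed bound \<open>N\<close> on the degree
  makes the summation range independent of \<open>P\<close>.\<close>

definition divdiff :: "nat \<Rightarrow> complex poly \<Rightarrow> complex \<Rightarrow> complex \<Rightarrow> complex" where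
  "divdiff N P a b = (\<Sum>k\<le>N. coeff P k * (\<Sum>i<k. b ^ (k - Suc i) * a ^ i))"

lemma divdiff:
  assumes "degree P \<le> N"
  shows "poly P a - poly P b = (a - b) * divdiff N P a b"
proof -
  have *: "poly P z = (\<Sum>k\<le>N. coeff P k * z ^ k)" for z
  proof -
    have "(\<Sum>k\<le>N. coeff P k * z ^ k) = (\<Sum>k\<le>degree P. coeff P k * z ^ k)"
      using assms by (intro sum.mono_neutral_right) (auto simp: coeff_eq_0)
    then show ?thesis by (simp add: poly_altdef)
  qed
  have "poly P a - poly P b = (\<Sum>k\<le>N. coeff P k * (a ^ k - b ^ k))"
    unfolding * by (simp add: sum_subtractf right_diff_distrib)
  also have "\<dots> = (\<Sum>k\<le>N. (a - b) * (coeff P k * (\<Sum>i<k. b ^ (k - Suc i) * a ^ i)))"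
    by (intro sum.cong refl) (simp add: power_diff_sumr2 mult_ac)
  finally show ?thesis by (simp add: divdiff_def sum_distrib_left)
qed

lemma divdiff_diag:
  assumes "degree P \<le> N"
  shows "divdiff N P a a = poly (pderiv P) a"
proof -
  have "((\<lambda>h. divdiff N P (a + h) a) \<longlongrightarrow> divdiff N P (a + 0) a) (at 0)"
    unfolding divdiff_def by (intro tendsto_intros)
  then have "((\<lambda>h. divdiff N P (a + h) a) \<longlongrightarrow> divdiff N P a a) (at 0)" by simp
  then have "((\<lambda>h. (poly P (a + h) - poly P a) / h) \<longlongrightarrow> divdiff N P a a) (at 0)"
    by (rule Lim_transform_eventually) (auto simp: divdiff[OF assms] eventually_at_filter)
  moreover have "((\<lambda>h. (poly P (a + h) - poly P a) / h) \<longlongrightarrow> poly (pderiv P) a) (at 0)"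
    using poly_DERIV[of P a] unfolding DERIV_def .
  ultimately show ?thesis by (rule tendsto_unique[rotated]) simp
qed

lemma chp_coeff_tendsto:
  assumes "\<And>t. t \<in> idx g n \<Longrightarrow> ((\<lambda>s. f s t) \<longlongrightarrow> x0 t) F"
  shows "((\<lambda>s. coeff (chp g d n \<alpha> (f s)) k) \<longlongrightarrow> coeff (chp g d n \<alpha> x0) k) F"
proof -
  obtain c where c: "\<And>k. entry_polynomial g n (c k)"
    "\<And>k x. c k (tup g n x) = coeff (chp g d n \<alpha> x) k" using chp_coeff_polynomial by blast
  from entry_polynomial_tendsto[OF c(1) assms] show ?thesis by (simp add: c(2))
qed

lemma chp_coeff_holomorphic:
  assumes "\<And>t. t \<in> idx g n \<Longrightarrow> (\<lambda>s. f s t) holomorphic_on S"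
  shows "(\<lambda>s. coeff (chp g d n \<alpha> (f s)) k) holomorphic_on S"
proof -
  obtain c where c: "\<And>k. entry_polynomial g n (c k)"
    "\<And>k x. c k (tup g n x) = coeff (chp g d n \<alpha> x) k" using chp_coeff_polynomial by blast
  from entry_polynomial_holomorphic[OF c(1) assms] show ?thesis by (simp add: c(2))
qed

lemma chp_root_near_eventually:
  assumes N: "0 < d * n" and root: "poly (chp g d n \<alpha> x0) w = 0" and r: "0 < r"
  shows "\<forall>\<^sub>F x in near g n x0. \<exists>\<mu>. cmod (w - \<mu>) < r \<and> poly (chp g d n \<alpha> x) \<mu> = 0"
proof -
  have "((\<lambda>x. poly (chp g d n \<alpha> x) w) \<longlongrightarrow> poly (chp g d n \<alpha> x0) w) (near g n x0)"
    unfolding chp_poly by (intro tendsto_intros chp_coeff_tendsto tendsto_near_coord)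
  then have "((\<lambda>x. cmod (poly (chp g d n \<alpha> x) w)) \<longlongrightarrow> 0) (near g n x0)"
    using root by (simp add: tendsto_norm_zero)
  then have "\<forall>\<^sub>F x in near g n x0. cmod (poly (chp g d n \<alpha> x) w) < r ^ (d * n)"
    using r by (intro order_tendstoD) auto
  then show ?thesis
  proof (rule eventually_mono)
    fix x assume x: "cmod (poly (chp g d n \<alpha> x) w) < r ^ (d * n)"
    obtain \<mu> where \<mu>: "poly (chp g d n \<alpha> x) \<mu> = 0" "cmod (w - \<mu>) ^ (d * n) \<le> cmod (poly (chp g d n \<alpha> x) w)"
      using chp_root_near[OF N] by blast
    have "cmod (w - \<mu>) < r"
    proof (rule ccontr)
      assume "\<not> ?thesis"
      then have "r ^ (d * n) \<le> cmod (w - \<mu>) ^ (d * n)" using r by (intro power_mono) auto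
      with \<mu>(2) x show False by simp
    qed
    with \<mu>(1) show "\<exists>\<mu>. cmod (w - \<mu>) < r \<and> poly (chp g d n \<alpha> x) \<mu> = 0" by blast
  qed
qed

text \<open>An implicit function theorem for a simple root. Near (x0, 1, 1) the divided difference
  stays away from 0, so two roots in the ball coincide; that there is one follows from continuity of
  roots.\<close>

lemma chp_branch:
  assumes N: "0 < d * n" and root: "poly (chp g d n \<alpha> x0) 1 = 0"
    and simple: "poly (pderiv (chp g d n \<alpha> x0)) 1 \<noteq> 0"
  shows "\<exists>r>0. r < 1 \<and> (\<exists>e>0. \<exists>\<kappa>>0. \<forall>x. tdist g n x x0 < e \<longrightarrow>
     (\<exists>\<mu>\<in>ball 1 r. poly (chp g d n \<alpha> x) \<mu> = 0) \<and>
     (\<forall>a\<in>ball 1 r. \<forall>b\<in>ball 1 r. \<kappa> < cmod (divdiff (d * n) (chp g d n \<alpha> x) a b)))"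
proof -
  let ?D = "\<lambda>x a b. divdiff (d * n) (chp g d n \<alpha> x) a b"
  define \<kappa> where "\<kappa> = cmod (?D x0 1 1) / 2"
  have \<kappa>: "0 < \<kappa>" "\<kappa> < cmod (?D x0 1 1)" using simple by (auto simp: divdiff_diag chp_degree \<kappa>_def)
  have "((\<lambda>z. ?D (fst z) (fst (snd z)) (snd (snd z))) \<longlongrightarrow> ?D x0 1 1) (near g n x0 \<times>\<^sub>F (nhds 1 \<times>\<^sub>F nhds 1))"
    unfolding divdiff_def
    by (intro tendsto_intros chp_coeff_tendsto filterlim_compose[OF tendsto_near_coord filterlim_fst]
        filterlim_compose[OF filterlim_fst filterlim_snd] filterlim_compose[OF filterlim_snd filterlim_snd])
  from order_tendstoD(1)[OF tendsto_norm[OF this] \<kappa>(2), THEN eventually_prod_filter[THEN iffD1]]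
  obtain P Q where P: "eventually P (near g n x0)" and Q: "eventually Q (nhds (1::complex) \<times>\<^sub>F nhds (1::complex))"
    and PQ: "\<And>x z. P x \<Longrightarrow> Q z \<Longrightarrow> \<kappa> < cmod (?D x (fst z) (snd z))" by auto
  from Q[THEN eventually_prod_filter[THEN iffD1]]
  obtain Q1 Q2 where Q12: "eventually Q1 (nhds (1::complex))" "eventually Q2 (nhds (1::complex))"
    "\<And>a b. Q1 a \<Longrightarrow> Q2 b \<Longrightarrow> Q (a, b)" by auto
  from eventually_conj[OF Q12(1,2)] obtain r where r: "0 < r" "\<And>a. dist a 1 < r \<Longrightarrow> Q1 a \<and> Q2 a"
    unfolding eventually_nhds_metric by blast
  \<comment> \<open>A radius below 1 keeps 0 out of the ball, so that tuples can be divided by the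
    root.\<close>
  define r' where "r' = min r (1/2)"
  have r': "0 < r'" "r' < 1" "r' \<le> r" using r by (auto simp: r'_def)
  from eventually_conj[OF P chp_root_near_eventually[OF N root r'(1)]]
  obtain e where e: "0 < e" "\<And>x. tdist g n x x0 < e \<Longrightarrow> P x \<and> (\<exists>\<mu>. cmod (1 - \<mu>) < r' \<and> poly (chp g d n \<alpha> x) \<mu> = 0)"
    unfolding eventually_near by blast
  show ?thesis
  proof (rule exI[of _ r'], intro conjI r'(1,2), rule exI[of _ e], intro conjI e(1), rule exI[of _ \<kappa>],
      intro conjI \<kappa>(1) allI impI ballI)
    fix x assume x: "tdist g n x x0 < e"
    then show "\<exists>\<mu>\<in>ball 1 r'. poly (chp g d n \<alpha> x) \<mu> = 0" using e(2) by (force simp: dist_norm)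
    fix a b :: complex assume "a \<in> ball 1 r'" "b \<in> ball 1 r'"
    then have "Q (a, b)" using r(2)[of a] r(2)[of b] r'(3) Q12(3) by (auto simp: dist_commute)
    then show "\<kappa> < cmod (?D x a b)" using PQ[of x "(a, b)"] e(2)[OF x] by simp
  qed
qed

text \<open>Comparing the polynomials at \<open>z\<close> and \<open>w\<close> in the point \<mu> w
  expresses \<mu> w - \<mu> z by the differences of the coefficients over a divided difference
  bounded below. This yields continuity of the branch, and with it the limit of the difference
  quotient.\<close>

lemma chp_branch_holomorphic:
  assumes S: "open S" and f: "\<And>t. t \<in> idx g n \<Longrightarrow> (\<lambda>s. f s t) holomorphic_on S"
    and \<mu>: "\<And>z. z \<in> S \<Longrightarrow> \<mu> z \<in> ball 1 r" "\<And>z. z \<in> S \<Longrightarrow> poly (chp g d n \<alpha> (f z)) (\<mu> z) = 0"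
    and D: "\<And>z a b. z \<in> S \<Longrightarrow> a \<in> ball 1 r \<Longrightarrow> b \<in> ball 1 r \<Longrightarrow>
      \<kappa> < cmod (divdiff (d * n) (chp g d n \<alpha> (f z)) a b)"
    and \<kappa>: "0 < \<kappa>"
  shows "\<mu> holomorphic_on S"
proof -
  let ?N = "d * n"
  define c where "c z k = coeff (chp g d n \<alpha> (f z)) k" for z k
  have c: "(\<lambda>z. c z k) holomorphic_on S" for k
    unfolding c_def by (rule chp_coeff_holomorphic[OF f])
  have step: "\<mu> w - \<mu> z = - (\<Sum>k\<le>?N. (c w k - c z k) * \<mu> w ^ k) / divdiff ?N (chp g d n \<alpha> (f z)) (\<mu> w) (\<mu> z)"
    if "z \<in> S" "w \<in> S" for z w
  proof -
    have "poly (chp g d n \<alpha> (f z)) (\<mu> w) - poly (chp g d n \<alpha> (f w)) (\<mu> w) = - (\<Sum>k\<le>?N. (c w k - c z k) * \<mu> w ^ k)"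
      by (simp add: chp_poly c_def sum_negf[symmetric] sum_subtractf[symmetric] algebra_simps)
    then have "(\<mu> w - \<mu> z) * divdiff ?N (chp g d n \<alpha> (f z)) (\<mu> w) (\<mu> z) = - (\<Sum>k\<le>?N. (c w k - c z k) * \<mu> w ^ k)"
      using divdiff[of "chp g d n \<alpha> (f z)" ?N "\<mu> w" "\<mu> z"] \<mu>(2)[OF that(1)] \<mu>(2)[OF that(2)]
      by (simp add: chp_degree)
    moreover have "divdiff ?N (chp g d n \<alpha> (f z)) (\<mu> w) (\<mu> z) \<noteq> 0"
      using D[OF that(1) \<mu>(1)[OF that(2)] \<mu>(1)[OF that(1)]] \<kappa> by auto
    ultimately show ?thesis by (simp add: field_simps)
  qed
  show ?thesis
    unfolding holomorphic_on_open[OF S]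
  proof
    fix z assume z: "z \<in> S"
    let ?P = "chp g d n \<alpha> (f z)"
    have ev: "\<forall>\<^sub>F w in at z. w \<in> S" using S z by (rule eventually_at_in_open')
    have ck: "((\<lambda>w. c w k) \<longlongrightarrow> c z k) (at z)" for k
      using holomorphic_on_imp_continuous_on[OF c] S z by (metis continuous_on_eq_continuous_at isCont_def)
    let ?D = "\<lambda>w. divdiff ?N ?P (\<mu> w) (\<mu> z)"
    have "((\<lambda>w. \<mu> w - \<mu> z) \<longlongrightarrow> 0) (at z)"
    proof (rule Lim_null_comparison)
      show "\<forall>\<^sub>F w in at z. norm (\<mu> w - \<mu> z) \<le> (\<Sum>k\<le>?N. cmod (c w k - c z k) * (1 + r) ^ k) / \<kappa>"
        using ev
      proof (rule eventually_mono)
        fix w assume w: "w \<in> S"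
        have "dist 1 (\<mu> w) < r" using \<mu>(1)[OF w] by simp
        then have b: "cmod (\<mu> w) \<le> 1 + r"
          using norm_triangle_ineq2[of "\<mu> w" 1] by (simp add: dist_norm norm_minus_commute)
        then have r: "0 \<le> 1 + r" using norm_ge_zero order_trans by blast
        have "cmod (\<Sum>k\<le>?N. (c w k - c z k) * \<mu> w ^ k) \<le> (\<Sum>k\<le>?N. cmod (c w k - c z k) * (1 + r) ^ k)"
          using b by (auto simp: norm_mult norm_power intro!: sum_norm_le mult_left_mono power_mono)
        moreover have "\<kappa> \<le> cmod (?D w)" using D[OF z \<mu>(1)[OF w] \<mu>(1)[OF z]] by simp
        ultimately show "norm (\<mu> w - \<mu> z) \<le> (\<Sum>k\<le>?N. cmod (c w k - c z k) * (1 + r) ^ k) / \<kappa>"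
          unfolding step[OF z w] norm_divide norm_minus_cancel using \<kappa> r
          by (intro frac_le) (auto intro!: sum_nonneg mult_nonneg_nonneg zero_le_power)
      qed
      have "((\<lambda>w. (\<Sum>k\<le>?N. cmod (c w k - c z k) * (1 + r) ^ k) / \<kappa>) \<longlongrightarrow>
          (\<Sum>k\<le>?N. cmod (c z k - c z k) * (1 + r) ^ k) / \<kappa>) (at z)"
        using \<kappa> by (intro tendsto_intros ck) auto
      then show "((\<lambda>w. (\<Sum>k\<le>?N. cmod (c w k - c z k) * (1 + r) ^ k) / \<kappa>) \<longlongrightarrow> 0) (at z)" by simp
    qed
    then have \<mu>z: "(\<mu> \<longlongrightarrow> \<mu> z) (at z)" by (simp add: LIM_zero_iff)
    have "(\<lambda>w. c w k) field_differentiable (at z)" for k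
      using c S z by (rule holomorphic_on_imp_differentiable_at)
    then have "((\<lambda>w. c w k) has_field_derivative deriv (\<lambda>w. c w k) z) (at z)" for k
      by (simp add: DERIV_deriv_iff_field_differentiable)
    then have ck': "((\<lambda>w. (c w k - c z k) / (w - z)) \<longlongrightarrow> deriv (\<lambda>w. c w k) z) (at z)" for k
      by (simp add: has_field_derivative_iff)
    have "?D z \<noteq> 0" using D[OF z \<mu>(1)[OF z] \<mu>(1)[OF z]] \<kappa> by auto
    moreover have "(?D \<longlongrightarrow> ?D z) (at z)"
      unfolding divdiff_def by (intro tendsto_intros \<mu>z)
    ultimately have "((\<lambda>w. - (\<Sum>k\<le>?N. ((c w k - c z k) / (w - z)) * \<mu> w ^ k) / ?D w) \<longlongrightarrow>
        - (\<Sum>k\<le>?N. deriv (\<lambda>w. c w k) z * \<mu> z ^ k) / ?D z) (at z)"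
      by (intro tendsto_intros ck' \<mu>z)
    then have "((\<lambda>w. (\<mu> w - \<mu> z) / (w - z)) \<longlongrightarrow> - (\<Sum>k\<le>?N. deriv (\<lambda>w. c w k) z * \<mu> z ^ k) / ?D z) (at z)"
    proof (rule Lim_transform_eventually)
      show "\<forall>\<^sub>F w in at z. - (\<Sum>k\<le>?N. ((c w k - c z k) / (w - z)) * \<mu> w ^ k) / ?D w = (\<mu> w - \<mu> z) / (w - z)"
        using ev by (rule eventually_mono) (simp add: step[OF z] sum_divide_distrib[symmetric] divide_simps mult.commute)
    qed
    then show "\<exists>f'. (\<mu> has_field_derivative f') (at z)"
      unfolding has_field_derivative_iff by blast
  qed
qed

text \<open>Hermitian tuples are a uniqueness set: along the line \<open>H + z K\<close> through the hermitian parts of a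
  complex tuple the simple eigenvalue near 1 is holomorphic, and the tuples with real \<open>z\<close> are hermitian.\<close>

lemma vanish_near_hermitian:
  assumes N: "0 < d * n" and x0: "herm g n x0"
    and root: "poly (chp g d n \<alpha> x0) 1 = 0"
    and simple: "poly (pderiv (chp g d n \<alpha> x0)) 1 \<noteq> 0"
    and p: "entry_polynomial g n p"
    and van: "\<And>r. 0 < r \<Longrightarrow> \<exists>e>0. \<forall>x. herm g n x \<longrightarrow> tdist g n x x0 < e \<longrightarrow>
       (\<exists>\<mu>\<in>ball 1 r. poly (chp g d n \<alpha> x) \<mu> = 0 \<and> p (tup g n (\<lambda>t. x t / \<mu>)) = 0)"
  shows "\<exists>e>0. \<forall>x. tdist g n x x0 < e \<longrightarrow> poly (chp g d n \<alpha> x) 1 = 0 \<longrightarrow> p (tup g n x) = 0"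
proof -
  obtain r e1 \<kappa> where r: "0 < r" "r < 1" and e1: "0 < e1" and \<kappa>: "0 < \<kappa>"
    and ex: "\<And>x. tdist g n x x0 < e1 \<Longrightarrow> \<exists>\<mu>\<in>ball 1 r. poly (chp g d n \<alpha> x) \<mu> = 0"
    and D: "\<And>x a b. tdist g n x x0 < e1 \<Longrightarrow> a \<in> ball 1 r \<Longrightarrow> b \<in> ball 1 r \<Longrightarrow>
      \<kappa> < cmod (divdiff (d * n) (chp g d n \<alpha> x) a b)"
    using chp_branch[OF N root simple] by blast
  have uniq: "a = b" if "tdist g n x x0 < e1" "a \<in> ball 1 r" "b \<in> ball 1 r"
    "poly (chp g d n \<alpha> x) a = 0" "poly (chp g d n \<alpha> x) b = 0" for x a b
    using divdiff[of "chp g d n \<alpha> x" "d * n" a b] D[OF that(1-3)] that(4,5) \<kappa> by (auto simp: chp_degree)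
  obtain e2 where e2: "0 < e2" "\<And>x. herm g n x \<Longrightarrow> tdist g n x x0 < e2 \<Longrightarrow>
       (\<exists>\<mu>\<in>ball 1 r. poly (chp g d n \<alpha> x) \<mu> = 0 \<and> p (tup g n (\<lambda>t. x t / \<mu>)) = 0)"
    using van[OF r(1)] by blast
  \<comment> \<open>\<open>H\<close> is within e of \<open>x0\<close> and the entries of
    \<open>K\<close> add up to at most e, so H + z K stays within 3 e of \<open>x0\<close> for z of
    modulus below 2. That disc contains both \<i> and a real interval.\<close>
  define e where "e = min e1 e2 / 4"
  have e: "0 < e" "4 * e \<le> e1" "4 * e \<le> e2" using e1 e2(1) by (auto simp: e_def)
  show ?thesis
  proof (intro exI[of _ e] conjI e(1) allI impI)
    fix x assume x: "tdist g n x x0 < e" and one: "poly (chp g d n \<alpha> x) 1 = 0"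
    define H K where "H = re_part x" and "K = im_part x"
    let ?y = "\<lambda>t. x t - x0 t"
    have swap: "(\<Sum>t\<in>idx g n. cmod (cnj (f (fst t, snd (snd t), fst (snd t))))) = (\<Sum>t\<in>idx g n. cmod (f t))" for f :: tuple
      by (rule sum.reindex_bij_witness[of _ "\<lambda>(j, i, k). (j, k, i)" "\<lambda>(j, i, k). (j, k, i)"]) auto
    have herm0: "x0 (j, i, k) = cnj (x0 (j, k, i))" if "j < g" "i < n" "k < n" for j i k
      using x0 that by (simp add: herm_def)
    have Hd: "tdist g n H x0 \<le> e"
    proof -
      have "tdist g n H x0 \<le> (\<Sum>t\<in>idx g n. (cmod (?y t) + cmod (cnj (?y (fst t, snd (snd t), fst (snd t))))) / 2)"
        unfolding tdist_def
      proof (rule sum_mono)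
        fix t assume "t \<in> idx g n"
        then obtain j i k where t: "t = (j, i, k)" "j < g" "i < n" "k < n" by auto
        have eq: "H t - x0 t = (?y t + cnj (?y (j, k, i))) / 2"
          using herm0[OF t(2-4)] by (simp add: H_def re_part_def t(1) field_simps)
        show "cmod (H t - x0 t) \<le> (cmod (?y t) + cmod (cnj (?y (fst t, snd (snd t), fst (snd t))))) / 2"
          using norm_triangle_ineq[of "?y t" "cnj (?y (j, k, i))"] unfolding eq norm_divide by (simp add: t(1))
      qed
      also have "\<dots> = tdist g n x x0"
        unfolding sum_divide_distrib[symmetric] sum.distrib swap[of ?y] tdist_def by simp
      finally show ?thesis using x by simp
    qed
    have Kd: "(\<Sum>t\<in>idx g n. cmod (K t)) \<le> e"
    proof -
      have "(\<Sum>t\<in>idx g n. cmod (K t)) \<le> (\<Sum>t\<in>idx g n. (cmod (?y t) + cmod (cnj (?y (fst t, snd (snd t), fst (snd t))))) / 2)"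
      proof (rule sum_mono)
        fix t assume "t \<in> idx g n"
        then obtain j i k where t: "t = (j, i, k)" "j < g" "i < n" "k < n" by auto
        have eq: "K t = (?y t - cnj (?y (j, k, i))) / (2 * \<i>)"
          using herm0[OF t(2-4)] by (simp add: K_def im_part_def t(1))
        show "cmod (K t) \<le> (cmod (?y t) + cmod (cnj (?y (fst t, snd (snd t), fst (snd t))))) / 2"
          using norm_triangle_ineq4[of "?y t" "cnj (?y (j, k, i))"]
          unfolding eq norm_divide norm_mult by (simp add: t(1))
      qed
      also have "\<dots> = tdist g n x x0"
        unfolding sum_divide_distrib[symmetric] sum.distrib swap[of ?y] tdist_def by simp
      finally show ?thesis using x by simp
    qed
    define f where "f z = line H K z" for z
    have fd: "tdist g n (f z) x0 < 4 * e" if "cmod z < 2" for z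
    proof -
      have "tdist g n (f z) x0 \<le> (\<Sum>t\<in>idx g n. cmod (H t - x0 t) + cmod z * cmod (K t))"
        unfolding tdist_def
      proof (rule sum_mono)
        fix t
        have eq: "f z t - x0 t = (H t - x0 t) + z * K t" by (simp add: f_def line_def)
        show "cmod (f z t - x0 t) \<le> cmod (H t - x0 t) + cmod z * cmod (K t)"
          unfolding eq norm_mult[symmetric] by (rule norm_triangle_ineq)
      qed
      also have "\<dots> = tdist g n H x0 + cmod z * (\<Sum>t\<in>idx g n. cmod (K t))"
        by (simp add: sum.distrib sum_distrib_left tdist_def)
      also have "\<dots> \<le> e + 2 * e"
        using that Hd Kd e(1) by (intro add_mono mult_mono) (auto intro: sum_nonneg)
      finally show ?thesis using e(1) by simp
    qed
    let ?S = "ball (0::complex) 2"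
    have "\<forall>z. \<exists>\<mu>. z \<in> ?S \<longrightarrow> \<mu> \<in> ball 1 r \<and> poly (chp g d n \<alpha> (f z)) \<mu> = 0"
      using ex fd e(2) by (metis (no_types, lifting) dist_0_norm mem_ball order_less_le_trans)
    then obtain \<mu> where \<mu>: "\<And>z. z \<in> ?S \<Longrightarrow> \<mu> z \<in> ball 1 r"
      "\<And>z. z \<in> ?S \<Longrightarrow> poly (chp g d n \<alpha> (f z)) (\<mu> z) = 0" by metis
    have fS: "tdist g n (f z) x0 < e1" "tdist g n (f z) x0 < e2" if "z \<in> ?S" for z
      using fd[of z] that e by auto
    have fhol: "(\<lambda>z. f z t) holomorphic_on ?S" for t
      unfolding f_def line_def by (intro holomorphic_intros)
    have \<mu>hol: "\<mu> holomorphic_on ?S"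
      by (rule chp_branch_holomorphic[OF _ fhol \<mu> D[OF fS(1)] \<kappa>]) auto
    have \<mu>0: "\<mu> z \<noteq> 0" if "z \<in> ?S" for z
    proof
      assume "\<mu> z = 0"
      then have "dist (1::complex) 0 < r" using \<mu>(1)[OF that] by simp
      with r(2) show False by simp
    qed
    \<comment> \<open>\<open>G\<close> evaluates \<open>p\<close> at the tuple divided by its
      eigenvalue, which lies on the locus. It vanishes at real z by hypothesis, and at \<i> the
      eigenvalue is 1 and the tuple is \<open>x\<close>.\<close>
    define G where "G z = p (tup g n (\<lambda>t. f z t / \<mu> z))" for z
    have Ghol: "G holomorphic_on ?S"
      unfolding G_def by (rule entry_polynomial_holomorphic[OF p]) (intro holomorphic_intros fhol \<mu>hol \<mu>0)
    have Greal: "G (of_real s) = 0" if "\<bar>s\<bar> < 2" for s :: real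
    proof -
      have s: "complex_of_real s \<in> ?S" using that by simp
      have "herm g n (f (of_real s))"
        unfolding f_def H_def K_def by (intro herm_line herm_re_part herm_im_part)
      from e2(2)[OF this fS(2)[OF s]] obtain b where b: "b \<in> ball 1 r"
        "poly (chp g d n \<alpha> (f (of_real s))) b = 0" "p (tup g n (\<lambda>t. f (of_real s) t / b)) = 0" by blast
      have "b = \<mu> (of_real s)" by (rule uniq[OF fS(1)[OF s] b(1) \<mu>(1)[OF s] b(2) \<mu>(2)[OF s]])
      with b(3) show ?thesis by (simp add: G_def)
    qed
    have limpt: "0 islimpt complex_of_real ` {-1<..<1}"
      unfolding islimpt_approachable
    proof (intro allI impI)
      fix \<epsilon> :: real assume "0 < \<epsilon>"
      then show "\<exists>x'\<in>complex_of_real ` {-1<..<1}. x' \<noteq> 0 \<and> dist x' 0 < \<epsilon>"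
        by (intro bexI[of _ "of_real (min (1/2) (\<epsilon>/2))"] imageI) auto
    qed
    have "G \<i> = 0"
      by (rule analytic_continuation[OF Ghol _ _ _ _ limpt]) (use Greal in auto)
    moreover have "f \<i> = x" by (simp add: f_def H_def K_def line_re_im)
    moreover have "\<mu> \<i> = 1"
    proof -
      have "\<i> \<in> ?S" by simp
      from uniq[OF fS(1)[OF this] \<mu>(1)[OF this] _ \<mu>(2)[OF this]] r one \<open>f \<i> = x\<close> show ?thesis by simp
    qed
    ultimately show "p (tup g n x) = 0" by (simp add: G_def)
  qed
qed

section \<open>Differentiability points of the top eigenvalue\<close>

definition nrm :: "nat \<Rightarrow> nat \<Rightarrow> (nat \<times> nat \<Rightarrow> complex) \<Rightarrow> real" where
  "nrm n d V = (\<Sum>i<n. \<Sum>a<d. (cmod (V (i, a)))\<^sup>2)"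

definition frm :: "nat \<Rightarrow> nat \<Rightarrow> nat \<Rightarrow> (nat \<Rightarrow> nat \<Rightarrow> nat \<Rightarrow> complex) \<Rightarrow> tuple \<Rightarrow>
    (nat \<times> nat \<Rightarrow> complex) \<Rightarrow> (nat \<times> nat \<Rightarrow> complex) \<Rightarrow> complex" where
  "frm g d n \<alpha> x V W = ip n d (pencil_op g d n \<alpha> x V) W"

abbreviation rfrm :: "nat \<Rightarrow> nat \<Rightarrow> nat \<Rightarrow> (nat \<Rightarrow> nat \<Rightarrow> nat \<Rightarrow> complex) \<Rightarrow> tuple \<Rightarrow>
    (nat \<times> nat \<Rightarrow> complex) \<Rightarrow> real" where
  "rfrm g d n \<alpha> x V \<equiv> Re (frm g d n \<alpha> x V V)"

lemma ip_nrm: "ip n d V V = of_real (nrm n d V)"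
  by (simp add: ip_self nrm_def)

lemma nrm_nonneg [simp]: "0 \<le> nrm n d V"
  by (simp add: nrm_def sum_nonneg)

lemma nrm_zero_iff: "nrm n d V = 0 \<longleftrightarrow> (\<forall>i<n. \<forall>a<d. V (i, a) = 0)"
  unfolding nrm_def by (simp add: sum_nonneg_eq_0_iff sum_nonneg) auto

lemma nrm_pos_iff: "0 < nrm n d V \<longleftrightarrow> (\<exists>i<n. \<exists>a<d. V (i, a) \<noteq> 0)"
  using nrm_nonneg[of n d V] nrm_zero_iff[of n d V] by (metis less_eq_real_def less_irrefl)

lemma ip_lin_left: "ip n d (\<lambda>t. V t + c * W t) U = ip n d V U + c * ip n d W U"
  by (simp add: ip_def algebra_simps sum.distrib sum_distrib_left)

lemma ip_lin_right: "ip n d U (\<lambda>t. V t + c * W t) = ip n d U V + cnj c * ip n d U W"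
  by (simp add: ip_def algebra_simps sum.distrib sum_distrib_left)

lemma ip_scale_left: "ip n d (\<lambda>t. c * W t) U = c * ip n d W U"
  by (simp add: ip_def sum_distrib_left mult.assoc)

lemma ip_scale_right: "ip n d U (\<lambda>t. c * W t) = cnj c * ip n d U W"
  by (simp add: ip_def sum_distrib_left mult_ac)

lemma nrm_scale: "nrm n d (\<lambda>t. c * W t) = (cmod c)\<^sup>2 * nrm n d W"
  by (simp add: nrm_def norm_mult power_mult_distrib sum_distrib_left)

lemma ip_cong: "(\<And>i a. i < n \<Longrightarrow> a < d \<Longrightarrow> V (i, a) = V' (i, a)) \<Longrightarrow>
    (\<And>i a. i < n \<Longrightarrow> a < d \<Longrightarrow> W (i, a) = W' (i, a)) \<Longrightarrow> ip n d V W = ip n d V' W'"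
  unfolding ip_def by (intro sum.cong) auto

lemma nrm_cong: "(\<And>i a. i < n \<Longrightarrow> a < d \<Longrightarrow> V (i, a) = V' (i, a)) \<Longrightarrow> nrm n d V = nrm n d V'"
  unfolding nrm_def by (intro sum.cong) auto

lemma pencil_op_cong: "(\<And>i a. i < n \<Longrightarrow> a < d \<Longrightarrow> V (i, a) = V' (i, a)) \<Longrightarrow>
    pencil_op g d n \<alpha> x V = pencil_op g d n \<alpha> x V'"
  unfolding pencil_op_def by (auto intro!: sum.cong)

lemma frm_cong: "(\<And>i a. i < n \<Longrightarrow> a < d \<Longrightarrow> V (i, a) = V' (i, a)) \<Longrightarrow>
    frm g d n \<alpha> x V V = frm g d n \<alpha> x V' V'"
  unfolding frm_def using pencil_op_cong[of n d V V'] by (intro ip_cong) auto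

lemma pencil_op_lin: "pencil_op g d n \<alpha> x (\<lambda>t. V t + c * W t) =
    (\<lambda>t. pencil_op g d n \<alpha> x V t + c * pencil_op g d n \<alpha> x W t)"
  by (simp add: pencil_op_def fun_eq_iff algebra_simps sum.distrib sum_distrib_left)

lemma pencil_op_scale: "pencil_op g d n \<alpha> x (\<lambda>t. c * W t) = (\<lambda>t. c * pencil_op g d n \<alpha> x W t)"
  by (simp add: pencil_op_def fun_eq_iff mult_ac sum_distrib_left)

lemma pencil_op_line: "pencil_op g d n \<alpha> (line x y s) V =
    (\<lambda>t. pencil_op g d n \<alpha> x V t + s * pencil_op g d n \<alpha> y V t)"
  by (simp add: pencil_op_def line_def fun_eq_iff algebra_simps sum.distrib sum_distrib_left)

lemma pencil_op_tuple_scale: "pencil_op g d n \<alpha> (\<lambda>t. c * x t) V = (\<lambda>t. c * pencil_op g d n \<alpha> x V t)"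
  by (simp add: pencil_op_def fun_eq_iff mult_ac sum_distrib_left)

lemma frm_line: "frm g d n \<alpha> (line x y s) V W = frm g d n \<alpha> x V W + s * frm g d n \<alpha> y V W"
  by (simp add: frm_def pencil_op_line ip_lin_left)

lemma frm_lin_left: "frm g d n \<alpha> x (\<lambda>t. V t + c * W t) U = frm g d n \<alpha> x V U + c * frm g d n \<alpha> x W U"
  by (simp add: frm_def pencil_op_lin ip_lin_left)

lemma frm_lin_right: "frm g d n \<alpha> x U (\<lambda>t. V t + c * W t) = frm g d n \<alpha> x U V + cnj c * frm g d n \<alpha> x U W"
  by (simp add: frm_def ip_lin_right)

lemma frm_scale: "frm g d n \<alpha> x (\<lambda>t. c * V t) (\<lambda>t. c * V t) = of_real ((cmod c)\<^sup>2) * frm g d n \<alpha> x V V"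
  unfolding complex_norm_square frm_def pencil_op_scale ip_scale_left ip_scale_right by (simp add: mult_ac)

lemma frm_tuple_scale: "frm g d n \<alpha> (\<lambda>t. c * x t) V W = c * frm g d n \<alpha> x V W"
  by (simp add: frm_def pencil_op_tuple_scale ip_scale_left)

lemma frm_herm:
  assumes "herm_coeff g d \<alpha>" "herm g n x"
  shows "frm g d n \<alpha> x W V = cnj (frm g d n \<alpha> x V W)"
  unfolding frm_def by (subst ip_pencil_herm[OF assms], rule ip_commute)

lemma eigen_frm:
  assumes "eigen g d n \<alpha> x \<mu> V"
  shows "frm g d n \<alpha> x V W = \<mu> * ip n d V W"
proof -
  have "frm g d n \<alpha> x V W = ip n d (\<lambda>t. \<mu> * V t) W"
    unfolding frm_def using assms by (intro ip_cong) (auto simp: eigen_def)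
  then show ?thesis by (simp add: ip_scale_left)
qed

text \<open>A crude Lipschitz constant of the form as a function of the tuple, relative to
  \<open>nrm\<close>; it suffices to bound the product of any two entries of \<open>V\<close> by
  \<open>nrm n d V\<close>.\<close>

definition coeff_bound :: "nat \<Rightarrow> nat \<Rightarrow> (nat \<Rightarrow> nat \<Rightarrow> nat \<Rightarrow> complex) \<Rightarrow> real" where
  "coeff_bound g d \<alpha> = (\<Sum>j<g. \<Sum>a<d. \<Sum>b<d. cmod (\<alpha> j a b))"

lemma coeff_bound_nonneg [simp]: "0 \<le> coeff_bound g d \<alpha>"
  by (simp add: coeff_bound_def sum_nonneg)

lemma entry_le_nrm:
  assumes "i < n" "a < d"
  shows "(cmod (V (i, a)))\<^sup>2 \<le> nrm n d V"
proof -
  have "(cmod (V (i, a)))\<^sup>2 \<le> (\<Sum>a<d. (cmod (V (i, a)))\<^sup>2)"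
    using assms by (intro member_le_sum) auto
  also have "\<dots> \<le> nrm n d V"
    unfolding nrm_def using assms by (intro member_le_sum[of i]) (auto intro: sum_nonneg)
  finally show ?thesis .
qed

lemma frm_bound: "cmod (frm g d n \<alpha> x V V) \<le> coeff_bound g d \<alpha> * tdist g n x (\<lambda>_. 0) * nrm n d V"
proof -
  have V: "cmod (V (k, b)) * cmod (V (i, a)) \<le> nrm n d V" if "i < n" "a < d" "k < n" "b < d" for i a k b
  proof -
    have "2 * (cmod (V (k, b)) * cmod (V (i, a))) \<le> (cmod (V (k, b)))\<^sup>2 + (cmod (V (i, a)))\<^sup>2"
      using sum_squares_bound[of "cmod (V (k, b))" "cmod (V (i, a))"] by simp
    also have "\<dots> \<le> 2 * nrm n d V" using entry_le_nrm[of k n b d V] entry_le_nrm[of i n a d V] that by simp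
    finally show ?thesis by simp
  qed
  have "cmod (frm g d n \<alpha> x V V) \<le> (\<Sum>i<n. \<Sum>a<d. \<Sum>j<g. \<Sum>k<n. \<Sum>b<d. cmod (x (j, i, k)) * cmod (\<alpha> j a b) * nrm n d V)"
    unfolding frm_def ip_def pencil_op_def prod.case sum_distrib_right
  proof (intro sum_norm_le)
    fix i a j k b assume "i \<in> {..<n}" "a \<in> {..<d}" "j \<in> {..<g}" "k \<in> {..<n}" "b \<in> {..<d}"
    then have "cmod (x (j, i, k)) * cmod (\<alpha> j a b) * (cmod (V (k, b)) * cmod (V (i, a)))
      \<le> cmod (x (j, i, k)) * cmod (\<alpha> j a b) * nrm n d V" by (intro mult_left_mono V) auto
    then show "cmod (x (j, i, k) * \<alpha> j a b * V (k, b) * cnj (V (i, a))) \<le> cmod (x (j, i, k)) * cmod (\<alpha> j a b) * nrm n d V"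
      by (simp add: norm_mult mult.assoc)
  qed
  also have "\<dots> = (\<Sum>i<n. \<Sum>j<g. \<Sum>a<d. \<Sum>k<n. \<Sum>b<d. cmod (x (j, i, k)) * cmod (\<alpha> j a b) * nrm n d V)"
    by (intro sum.cong refl sum.swap)
  also have "\<dots> = (\<Sum>j<g. \<Sum>i<n. \<Sum>a<d. \<Sum>k<n. \<Sum>b<d. cmod (x (j, i, k)) * cmod (\<alpha> j a b) * nrm n d V)"
    by (rule sum.swap)
  also have "\<dots> = (\<Sum>j<g. \<Sum>i<n. \<Sum>k<n. \<Sum>a<d. \<Sum>b<d. cmod (x (j, i, k)) * cmod (\<alpha> j a b) * nrm n d V)"
    by (intro sum.cong refl sum.swap)
  also have "\<dots> = (\<Sum>j<g. \<Sum>i<n. \<Sum>k<n. cmod (x (j, i, k)) * ((\<Sum>a<d. \<Sum>b<d. cmod (\<alpha> j a b)) * nrm n d V))"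
    by (simp add: sum_distrib_left sum_distrib_right mult.assoc)
  also have "\<dots> \<le> (\<Sum>j<g. \<Sum>i<n. \<Sum>k<n. cmod (x (j, i, k)) * (coeff_bound g d \<alpha> * nrm n d V))"
  proof (intro sum_mono mult_left_mono mult_right_mono nrm_nonneg norm_ge_zero)
    fix j assume "j \<in> {..<g}"
    then show "(\<Sum>a<d. \<Sum>b<d. cmod (\<alpha> j a b)) \<le> coeff_bound g d \<alpha>"
      unfolding coeff_bound_def by (intro member_le_sum) (auto intro!: sum_nonneg)
  qed
  also have "\<dots> = (\<Sum>j<g. \<Sum>i<n. \<Sum>k<n. cmod (x (j, i, k))) * (coeff_bound g d \<alpha> * nrm n d V)"
    by (simp add: sum_distrib_right)
  also have "(\<Sum>j<g. \<Sum>i<n. \<Sum>k<n. cmod (x (j, i, k))) = tdist g n x (\<lambda>_. 0)"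
    by (simp add: tdist_def sum.cartesian_product)
  finally show ?thesis by (simp add: mult_ac)
qed

lemma tdist_commute: "tdist g n x y = tdist g n y x"
  by (simp add: tdist_def norm_minus_commute)

lemma rfrm_perturb: "rfrm g d n \<alpha> x V \<le> rfrm g d n \<alpha> y V + coeff_bound g d \<alpha> * tdist g n x y * nrm n d V"
proof -
  have "x = line y (\<lambda>t. x t - y t) 1" by (simp add: line_def)
  then have "frm g d n \<alpha> x V V = frm g d n \<alpha> y V V + frm g d n \<alpha> (\<lambda>t. x t - y t) V V"
    by (metis frm_line mult_1)
  moreover have "tdist g n (\<lambda>t. x t - y t) (\<lambda>_. 0) = tdist g n x y" by (simp add: tdist_def)
  ultimately show ?thesis
    using frm_bound[of g d n \<alpha> "\<lambda>t. x t - y t" V] complex_Re_le_cmod[of "frm g d n \<alpha> (\<lambda>t. x t - y t) V V"]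
    by simp
qed

text \<open>The first-order condition at a maximum in elementary form: for small \<open>s\<close> of
  the sign of \<open>u\<close> the linear term would beat the quadratic one.\<close>

lemma zero_slope:
  fixes u K s0 :: real
  assumes "0 < s0" "\<And>s. \<bar>s\<bar> < s0 \<Longrightarrow> s * u \<le> K * s\<^sup>2"
  shows "u = 0"
proof (rule ccontr)
  assume u: "u \<noteq> 0"
  define t where "t = min (s0 / 2) (\<bar>u\<bar> / (2 * (\<bar>K\<bar> + 1)))"
  have t: "0 < t" "t < s0" "t \<le> \<bar>u\<bar> / (2 * (\<bar>K\<bar> + 1))" using assms(1) u by (auto simp: t_def)
  define s where "s = sgn u * t"
  have "\<bar>s\<bar> = t" using u t(1) by (simp add: s_def abs_mult sgn_if)
  then have "s * u \<le> K * s\<^sup>2" using assms(2) t(2) by simp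
  moreover have "s * u = t * \<bar>u\<bar>" by (simp add: s_def sgn_if)
  moreover have "s\<^sup>2 = t\<^sup>2" using \<open>\<bar>s\<bar> = t\<close> by (metis power2_abs)
  ultimately have "t * \<bar>u\<bar> \<le> K * t * t" by (simp add: power2_eq_square)
  then have "\<bar>u\<bar> \<le> K * t" using t(1) by (simp add: mult.commute)
  also have "\<dots> \<le> (\<bar>K\<bar> + 1) * (\<bar>u\<bar> / (2 * (\<bar>K\<bar> + 1)))" using t by (intro mult_mono) auto
  also have "\<dots> = \<bar>u\<bar> / 2" by (simp add: field_simps)
  finally show False using u by simp
qed

text \<open>Moving \<open>V\<close> by s R along the residual R = M V - \<mu> V changes the form
  minus \<mu> times the squared norm by 2 s times the squared norm of R, up to order s^2. Maximality
  forces R = 0.\<close>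

lemma top_is_eigen:
  assumes h: "herm_coeff g d \<alpha>" "herm g n x"
    and le: "\<And>W. rfrm g d n \<alpha> x W \<le> \<mu> * nrm n d W"
    and eq: "rfrm g d n \<alpha> x V = \<mu> * nrm n d V" and V: "0 < nrm n d V"
  shows "eigen g d n \<alpha> x (of_real \<mu>) V"
proof -
  define R where "R t = pencil_op g d n \<alpha> x V t + (- of_real \<mu>) * V t" for t
  have R: "ip n d R R = frm g d n \<alpha> x V R - of_real \<mu> * ip n d V R"
    unfolding frm_def by (subst (1) R_def[abs_def]) (simp only: ip_lin_left, simp)
  have "2 * nrm n d R = 0"
  proof (rule zero_slope[of 1 _ "\<mu> * nrm n d R - rfrm g d n \<alpha> x R"])
    fix s :: real
    let ?U = "\<lambda>t. V t + of_real s * R t"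
    have f: "rfrm g d n \<alpha> x ?U = rfrm g d n \<alpha> x V + 2 * s * Re (frm g d n \<alpha> x V R) + s\<^sup>2 * rfrm g d n \<alpha> x R"
      unfolding frm_lin_left frm_lin_right using frm_herm[OF h, of R V]
      by (simp add: algebra_simps power2_eq_square)
    have "complex_of_real (nrm n d ?U) = of_real (nrm n d V) + of_real s * ip n d V R + of_real s * cnj (ip n d V R) + of_real (s\<^sup>2 * nrm n d R)"
      unfolding ip_nrm[symmetric] ip_lin_left ip_lin_right ip_commute[of n d R V]
      by (simp add: ip_nrm algebra_simps power2_eq_square)
    from arg_cong[OF this, of Re]
    have nU: "nrm n d ?U = nrm n d V + 2 * s * Re (ip n d V R) + s\<^sup>2 * nrm n d R" by simp
    have "Re (frm g d n \<alpha> x V R) = nrm n d R + \<mu> * Re (ip n d V R)"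
      using arg_cong[OF R, of Re] by (simp add: ip_nrm)
    with le[of ?U] f nU eq
    have "s * (2 * nrm n d R) \<le> s\<^sup>2 * (\<mu> * nrm n d R - rfrm g d n \<alpha> x R)"
      by (simp add: algebra_simps)
    then show "s * (2 * nrm n d R) \<le> (\<mu> * nrm n d R - rfrm g d n \<alpha> x R) * s\<^sup>2"
      by (simp add: mult.commute)
  qed simp
  then have "nrm n d R = 0" by simp
  then have "\<forall>i<n. \<forall>a<d. pencil_op g d n \<alpha> x V (i, a) = of_real \<mu> * V (i, a)"
    by (simp add: nrm_zero_iff R_def)
  then show ?thesis using V by (simp add: eigen_def nrm_pos_iff)
qed

text \<open>Compactness comes from Tychonoff's theorem for a possibly infinite index type. The bound
  therefore concerns all coordinates, which is why matrices are set to zero outside their range by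
  \<open>cut\<close>.\<close>

lemma attains_max_on:
  fixes S :: "('i \<Rightarrow> complex) set" and \<phi> :: "('i \<Rightarrow> complex) \<Rightarrow> real"
  assumes "closed S" "S \<noteq> {}" "\<And>z i. z \<in> S \<Longrightarrow> cmod (z i) \<le> R" "continuous_on UNIV \<phi>"
  shows "\<exists>z\<in>S. \<forall>y\<in>S. \<phi> y \<le> \<phi> z"
proof -
  have "compactin (product_topology (\<lambda>i::'i. euclidean :: complex topology) UNIV) (PiE UNIV (\<lambda>_. cball 0 R))"
    unfolding compactin_PiE by simp
  then have "compact (PiE UNIV (\<lambda>_. cball 0 R) :: ('i \<Rightarrow> complex) set)"
    by (simp add: euclidean_product_topology)
  then have "compact (PiE UNIV (\<lambda>_. cball 0 R) \<inter> S)" using assms(1) by (rule compact_Int_closed)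
  moreover have "PiE UNIV (\<lambda>_. cball 0 R) \<inter> S = S" using assms(3) by auto
  ultimately have "compact S" by simp
  from continuous_attains_sup[OF this assms(2)] continuous_on_subset[OF assms(4)] show ?thesis by auto
qed

lemma continuous_coord [continuous_intros]: "continuous_on S (\<lambda>z :: 'i \<Rightarrow> complex. z i)"
  by (rule continuous_on_subset[OF continuous_on_product_coordinates]) simp

lemma continuous_frm:
  fixes x :: "('i \<Rightarrow> complex) \<Rightarrow> tuple" and V :: "('i \<Rightarrow> complex) \<Rightarrow> nat \<times> nat \<Rightarrow> complex"
  assumes "\<And>t. continuous_on UNIV (\<lambda>z. x z t)" "\<And>t. continuous_on UNIV (\<lambda>z. V z t)"
  shows "continuous_on UNIV (\<lambda>z :: 'i \<Rightarrow> complex. frm g d n \<alpha> (x z) (V z) (V z))"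
  unfolding frm_def ip_def pencil_op_def prod.case
  by (intro continuous_intros assms)

lemma continuous_nrm:
  fixes V :: "('i \<Rightarrow> complex) \<Rightarrow> nat \<times> nat \<Rightarrow> complex"
  assumes "\<And>t. continuous_on UNIV (\<lambda>z. V z t)"
  shows "continuous_on UNIV (\<lambda>z :: 'i \<Rightarrow> complex. nrm n d (V z))"
  unfolding nrm_def by (intro continuous_intros assms)

definition cut :: "nat \<Rightarrow> nat \<Rightarrow> (nat \<times> nat \<Rightarrow> complex) \<Rightarrow> nat \<times> nat \<Rightarrow> complex" where
  "cut n d V = (\<lambda>(i, a). if i < n \<and> a < d then V (i, a) else 0)"

lemma cut_props: "nrm n d (cut n d V) = nrm n d V" "frm g d n \<alpha> x (cut n d V) (cut n d V) = frm g d n \<alpha> x V V"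
  "ip n d (cut n d V) U = ip n d V U"
  by (auto simp: cut_def intro!: nrm_cong frm_cong ip_cong)

definition supp_set :: "nat \<Rightarrow> nat \<Rightarrow> (nat \<times> nat \<Rightarrow> complex) set" where
  "supp_set n d = {V. \<forall>t. t \<notin> {..<n} \<times> {..<d} \<longrightarrow> V t = 0}"

lemma cut_supp: "cut n d V \<in> supp_set n d"
  by (auto simp: cut_def supp_set_def)

lemma unit_entry_le: "V \<in> supp_set n d \<Longrightarrow> nrm n d V = 1 \<Longrightarrow> cmod (V t) \<le> 1"
proof (cases t)
  fix i a assume V: "V \<in> supp_set n d" "nrm n d V = 1" and t: "t = (i, a)"
  show "cmod (V t) \<le> 1"
  proof (cases "i < n \<and> a < d")
    case True
    then have "(cmod (V t))\<^sup>2 \<le> 1\<^sup>2" using entry_le_nrm[of i n a d V] V t by simp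
    then show ?thesis by (rule power2_le_imp_le) simp
  next
    case False
    then show ?thesis using V t by (auto simp: supp_set_def)
  qed
qed

lemma closed_coord_eq: "closed {z :: 'i \<Rightarrow> complex. \<forall>t. P t \<longrightarrow> z t = c t}"
proof -
  have "{z :: 'i \<Rightarrow> complex. \<forall>t. P t \<longrightarrow> z t = c t} = (\<Inter>t\<in>{t. P t}. {z. z t = c t})" by auto
  moreover have "closed \<dots>"
    by (intro closed_INT ballI closed_Collect_eq continuous_intros)
  ultimately show ?thesis by simp
qed

lemma normalise:
  assumes "0 < nrm n d W"
  obtains W' c where "W' = (\<lambda>t. c * W t)" "nrm n d W' = 1" "(cmod c)\<^sup>2 * nrm n d W = 1" "c \<noteq> 0"
proof -
  define c where "c = complex_of_real (1 / sqrt (nrm n d W))"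
  have "(cmod c)\<^sup>2 * nrm n d W = 1" using assms by (simp add: c_def norm_divide power_divide)
  moreover have "c \<noteq> 0" using assms by (simp add: c_def)
  ultimately show thesis using that nrm_scale[of n d c W] by metis
qed

text \<open>The form attains its maximum on the unit sphere of the orthogonal complement of
  \<open>U\<close>, and homogeneity extends the bound. A zero \<open>U\<close> gives the full
  sphere; a top eigenvector as \<open>U\<close> leads to the spectral gap.\<close>

lemma top_exists:
  assumes W0: "0 < nrm n d W0" "ip n d W0 U = 0"
  shows "\<exists>V. nrm n d V = 1 \<and> ip n d V U = 0 \<and>
    (\<forall>W. ip n d W U = 0 \<longrightarrow> rfrm g d n \<alpha> x W \<le> rfrm g d n \<alpha> x V * nrm n d W)"
proof -
  define S where "S = supp_set n d \<inter> {V. nrm n d V = 1} \<inter> {V. ip n d V U = 0}"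
  have "closed S" unfolding S_def supp_set_def
    by (intro closed_Int closed_coord_eq closed_Collect_eq continuous_nrm continuous_intros)
      (auto simp: ip_def intro!: continuous_intros)
  moreover obtain W' c where W': "W' = (\<lambda>t. c * W0 t)" "nrm n d W' = 1" "(cmod c)\<^sup>2 * nrm n d W0 = 1"
    using normalise[OF W0(1)] by metis
  have "cut n d W' \<in> S" using W'(1,2) W0(2) by (simp add: S_def cut_supp cut_props ip_scale_left)
  then have "S \<noteq> {}" by blast
  moreover have "cmod (V t) \<le> 1" if "V \<in> S" for V t
    by (rule unit_entry_le) (use that in \<open>auto simp: S_def\<close>)
  moreover have "continuous_on UNIV (\<lambda>V. rfrm g d n \<alpha> x V)"
    by (intro continuous_on_Re continuous_frm continuous_intros)
  ultimately obtain V where V: "V \<in> S" "\<forall>W\<in>S. rfrm g d n \<alpha> x W \<le> rfrm g d n \<alpha> x V"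
    using attains_max_on[of S 1 "\<lambda>V. rfrm g d n \<alpha> x V"] by blast
  have "rfrm g d n \<alpha> x W \<le> rfrm g d n \<alpha> x V * nrm n d W" if W: "ip n d W U = 0" for W
  proof (cases "nrm n d W = 0")
    case True
    then have "frm g d n \<alpha> x W W = frm g d n \<alpha> x (\<lambda>_. 0) (\<lambda>_. 0)" by (intro frm_cong) (simp add: nrm_zero_iff)
    then show ?thesis using True by (simp add: frm_def ip_def)
  next
    case False
    then have pos: "0 < nrm n d W" using nrm_nonneg[of n d W] by linarith
    obtain W' c where W': "W' = (\<lambda>t. c * W t)" "nrm n d W' = 1" "(cmod c)\<^sup>2 * nrm n d W = 1"
      using normalise[OF pos] by metis
    have "cut n d W' \<in> S" using W'(1,2) W by (simp add: S_def cut_supp cut_props ip_scale_left)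
    then have "rfrm g d n \<alpha> x W' \<le> rfrm g d n \<alpha> x V" using V(2) cut_props(2)[of g d n \<alpha> x W'] by metis
    moreover have "rfrm g d n \<alpha> x W' = (cmod c)\<^sup>2 * rfrm g d n \<alpha> x W"
      unfolding W'(1) frm_scale by (simp add: Re_complex_of_real)
    ultimately have "(cmod c)\<^sup>2 * rfrm g d n \<alpha> x W * nrm n d W \<le> rfrm g d n \<alpha> x V * nrm n d W"
      using pos by (intro mult_right_mono) auto
    moreover have "(cmod c)\<^sup>2 * rfrm g d n \<alpha> x W * nrm n d W = rfrm g d n \<alpha> x W * ((cmod c)\<^sup>2 * nrm n d W)"
      by (simp add: mult_ac)
    ultimately show ?thesis using W'(3) by simp
  qed
  then show ?thesis using V(1) by (intro exI[of _ V]) (auto simp: S_def)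
qed

definition sqdist :: "nat \<Rightarrow> nat \<Rightarrow> tuple \<Rightarrow> tuple \<Rightarrow> real" where
  "sqdist g n x y = (\<Sum>t\<in>idx g n. (cmod (x t - y t))\<^sup>2)"

text \<open>Maximising the top eigenvalue minus a paraboloid gives a point where the top eigenvalue, a convex
  function of the tuple, is touched from above by a smooth function and hence differentiable; all its
  subgradients \<open>E \<mapsto> \<langle>M(E) V, V\<rangle>\<close> coincide there.\<close>

lemma smooth_top_point:
  assumes hc: "herm g n c" and r: "0 < r" and N: "0 < d * n"
  shows "\<exists>x V l. herm g n x \<and> (\<forall>t\<in>idx g n. cmod (x t - c t) < r) \<and> nrm n d V = 1 \<and>
    (\<forall>W. rfrm g d n \<alpha> x W \<le> rfrm g d n \<alpha> x V * nrm n d W) \<and>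
    (\<forall>W E. nrm n d W = 1 \<longrightarrow> rfrm g d n \<alpha> x W = rfrm g d n \<alpha> x V \<longrightarrow> herm g n E \<longrightarrow> rfrm g d n \<alpha> E W = l E)"
proof -
  define A where "A = coeff_bound g d \<alpha>"
  define M where "M = card (idx g n)"
  \<comment> \<open>The paraboloid is steep enough to beat the Lipschitz growth of the form at the
    boundary of the box of radius \<open>r\<close>, which keeps the maximum inside.\<close>
  define C where "C = A * real M / r + 1"
  have A: "0 \<le> A" by (simp add: A_def)
  then have C: "0 < C" using r by (auto simp: C_def intro: add_nonneg_pos)
  \<comment> \<open>Tuple and unit vector are maximised jointly, packed into one function on a sum
    type.\<close>
  define X where "X z = (\<lambda>t. z (Inl t))" for z :: "(nat \<times> nat \<times> nat) + (nat \<times> nat) \<Rightarrow> complex"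
  define Y where "Y z = (\<lambda>t. z (Inr t))" for z :: "(nat \<times> nat \<times> nat) + (nat \<times> nat) \<Rightarrow> complex"
  define P where "P s = (case s of Inl t \<Rightarrow> t \<notin> idx g n | Inr t \<Rightarrow> t \<notin> {..<n} \<times> {..<d})" for s
  define S where "S = {z. \<forall>s. P s \<longrightarrow> z s = 0} \<inter> {z. nrm n d (Y z) = 1} \<inter>
    (\<Inter>t\<in>idx g n. {z. cmod (z (Inl t) - c t) \<le> r}) \<inter>
    (\<Inter>(j, i, k)\<in>idx g n. {z. cnj (z (Inl (j, i, k))) = z (Inl (j, k, i))})"
  define \<phi> where "\<phi> z = rfrm g d n \<alpha> (X z) (Y z) - C * sqdist g n (X z) c" for z
  have "closed S" unfolding S_def
    by (intro closed_Int closed_coord_eq closed_INT ballI)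
      (auto simp: Y_def intro!: closed_Collect_eq closed_Collect_le continuous_nrm continuous_intros)
  have SD: "herm g n (X z)" "nrm n d (Y z) = 1" "Y z \<in> supp_set n d" "\<And>t. t \<in> idx g n \<Longrightarrow> cmod (X z t - c t) \<le> r"
    "\<And>t. t \<notin> idx g n \<Longrightarrow> X z t = 0" if "z \<in> S" for z
    using that by (auto simp: S_def X_def Y_def P_def herm_def supp_set_def split: sum.splits)
  have SI: "case_sum (\<lambda>t. if t \<in> idx g n then x t else 0) (cut n d V) \<in> S"
    if "herm g n x" "nrm n d V = 1" "\<And>t. t \<in> idx g n \<Longrightarrow> cmod (x t - c t) \<le> r" for x V
  proof -
    have "nrm n d (Y (case_sum (\<lambda>t. if t \<in> idx g n then x t else 0) (cut n d V))) = 1"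
      using that(2) by (simp add: Y_def cut_props)
    then show ?thesis
      using that by (auto simp: S_def P_def herm_def cut_def split: sum.splits)
  qed
  have \<phi>I: "\<phi> (case_sum (\<lambda>t. if t \<in> idx g n then x t else 0) (cut n d V)) = rfrm g d n \<alpha> x V - C * sqdist g n x c" for x V
  proof -
    have "frm g d n \<alpha> (\<lambda>t. if t \<in> idx g n then x t else 0) V V = frm g d n \<alpha> x V V"
      unfolding frm_def ip_def pencil_op_def by (auto intro!: sum.cong)
    moreover have "sqdist g n (\<lambda>t. if t \<in> idx g n then x t else 0) c = sqdist g n x c"
      unfolding sqdist_def by (auto intro!: sum.cong)
    ultimately show ?thesis by (simp add: \<phi>_def X_def Y_def cut_props)
  qed
  have "0 < d" "0 < n" using N by auto
  then have "0 < nrm n d (\<lambda>_. 1)" by (auto simp: nrm_pos_iff)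
  then obtain V1 where V1: "nrm n d V1 = 1" using normalise by metis
  have "S \<noteq> {}" using SI[OF hc V1] r by auto
  moreover have "cmod (z s) \<le> max 1 (r + (\<Sum>t\<in>idx g n. cmod (c t)))" if z: "z \<in> S" for z s
  proof (cases s)
    case (Inl t)
    have nn: "0 \<le> (\<Sum>t\<in>idx g n. cmod (c t))" by (intro sum_nonneg) simp
    show ?thesis
    proof (cases "t \<in> idx g n")
      case True
      have "cmod (z s) \<le> cmod (X z t - c t) + cmod (c t)"
        using norm_triangle_ineq[of "X z t - c t" "c t"] Inl by (simp add: X_def)
      also have "\<dots> \<le> r + (\<Sum>t\<in>idx g n. cmod (c t))"
        using SD(4)[OF z True] True by (intro add_mono member_le_sum) auto
      finally show ?thesis by simp
    next
      case False
      then have "z s = 0" using SD(5)[OF z False] Inl by (simp add: X_def)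
      then show ?thesis by simp
    qed
  next
    case (Inr t)
    then show ?thesis using unit_entry_le[OF SD(3,2)[OF z], of t] by (simp add: Y_def)
  qed
  moreover have "continuous_on UNIV \<phi>"
    unfolding \<phi>_def X_def Y_def sqdist_def
    by (intro continuous_intros continuous_on_Re continuous_frm)
  ultimately obtain z where z: "z \<in> S" "\<And>y. y \<in> S \<Longrightarrow> \<phi> y \<le> \<phi> z"
    using attains_max_on[OF \<open>closed S\<close>] by metis
  define x V where "x = X z" and "V = Y z"
  note xV = SD[OF z(1), folded x_def V_def]
  have \<phi>z: "\<phi> z = rfrm g d n \<alpha> x V - C * sqdist g n x c" by (simp add: \<phi>_def x_def V_def)
  have max: "rfrm g d n \<alpha> y W - C * sqdist g n y c \<le> rfrm g d n \<alpha> x V - C * sqdist g n x c"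
    if "herm g n y" "nrm n d W = 1" "\<And>t. t \<in> idx g n \<Longrightarrow> cmod (y t - c t) \<le> r" for y W
    using z(2)[OF SI[OF that]] unfolding \<phi>I \<phi>z .
  \<comment> \<open>Comparison with the centre \<open>c\<close> for the same vector
    \<open>V\<close>: the penalty is at most the variation of the form.\<close>
  have int: "cmod (x t - c t) < r" if t: "t \<in> idx g n" for t
  proof -
    have "tdist g n x c \<le> real M * r"
      unfolding tdist_def M_def using sum_bounded_above[of "idx g n" "\<lambda>t. cmod (x t - c t)" r] xV(4) by simp
    then have "A * tdist g n x c \<le> A * (real M * r)" using A by (rule mult_left_mono)
    moreover have "C * sqdist g n x c \<le> A * tdist g n x c"
      using max[OF hc xV(2)] r rfrm_perturb[of g d n \<alpha> x V c] xV(2) by (simp add: sqdist_def A_def)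
    moreover have "(cmod (x t - c t))\<^sup>2 \<le> sqdist g n x c" unfolding sqdist_def using t by (intro member_le_sum) auto
    then have "C * (cmod (x t - c t))\<^sup>2 \<le> C * sqdist g n x c" using C by simp
    ultimately have "C * (cmod (x t - c t))\<^sup>2 \<le> A * (real M * r)" by linarith
    also have "\<dots> < C * r\<^sup>2" using r by (simp add: C_def power2_eq_square field_simps)
    finally have "(cmod (x t - c t))\<^sup>2 < r\<^sup>2" using C by simp
    then show ?thesis by (rule power2_less_imp_less) (use r in simp)
  qed
  have top: "rfrm g d n \<alpha> x W \<le> rfrm g d n \<alpha> x V * nrm n d W" for W
  proof -
    obtain V' where V': "nrm n d V' = 1" "\<And>W. rfrm g d n \<alpha> x W \<le> rfrm g d n \<alpha> x V' * nrm n d W"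
      using top_exists[of n d V1 "\<lambda>_. 0" g \<alpha> x] V1 by (auto simp: ip_def)
    have "rfrm g d n \<alpha> x V' \<le> rfrm g d n \<alpha> x V" using max[OF xV(1) V'(1) xV(4)] by simp
    then have "rfrm g d n \<alpha> x V' * nrm n d W \<le> rfrm g d n \<alpha> x V * nrm n d W" by (intro mult_right_mono) auto
    with V'(2)[of W] show ?thesis by simp
  qed
  \<comment> \<open>The derivative of the paraboloid at \<open>x\<close> in direction E; every top
    eigenvector has to reproduce it.\<close>
  define l where "l E = 2 * C * (\<Sum>t\<in>idx g n. Re ((x t - c t) * cnj (E t)))" for E
  have "rfrm g d n \<alpha> E W = l E" if W: "nrm n d W = 1" "rfrm g d n \<alpha> x W = rfrm g d n \<alpha> x V" and E: "herm g n E" for W E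
  proof -
    define e where "e = (\<Sum>t\<in>idx g n. (cmod (E t))\<^sup>2)"
    have "\<forall>\<^sub>F s in at (0::real). \<forall>t\<in>idx g n. cmod (x t + of_real s * E t - c t) < r"
    proof (rule eventually_ball_finite, simp, rule ballI)
      fix t assume "t \<in> idx g n"
      have "((\<lambda>s. cmod (x t + of_real s * E t - c t)) \<longlongrightarrow> cmod (x t + of_real 0 * E t - c t)) (at (0::real))"
        by (intro tendsto_intros)
      then show "\<forall>\<^sub>F s in at (0::real). cmod (x t + of_real s * E t - c t) < r"
        using int[OF \<open>t \<in> idx g n\<close>] by (intro order_tendstoD) auto
    qed
    then obtain s0 where s0: "0 < s0" "\<And>s t. s \<noteq> 0 \<Longrightarrow> \<bar>s\<bar> < s0 \<Longrightarrow> t \<in> idx g n \<Longrightarrow> cmod (x t + of_real s * E t - c t) < r"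
      unfolding eventually_at by (auto simp: dist_real_def)
    have "rfrm g d n \<alpha> E W - l E = 0"
    proof (rule zero_slope[OF s0(1)])
      fix s :: real assume s: "\<bar>s\<bar> < s0"
      let ?y = "line x E (of_real s)"
      have box: "cmod (?y t - c t) \<le> r" if "t \<in> idx g n" for t
        using s0(2)[OF _ s that] int[OF that] by (cases "s = 0") (auto simp: line_def intro: less_imp_le)
      have sq: "sqdist g n ?y c = sqdist g n x c + s * (2 * (\<Sum>t\<in>idx g n. Re ((x t - c t) * cnj (E t)))) + e * s\<^sup>2"
      proof -
        have "(cmod (?y t - c t))\<^sup>2 = (cmod (x t - c t))\<^sup>2 + s * (2 * Re ((x t - c t) * cnj (E t))) + (cmod (E t))\<^sup>2 * s\<^sup>2" for t
          unfolding line_def cmod_power2 by (simp add: power2_eq_square algebra_simps)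
        then show ?thesis
          unfolding sqdist_def e_def sum_distrib_left sum_distrib_right
          by (simp only: sum.distrib[symmetric])
      qed
      have "rfrm g d n \<alpha> ?y W = rfrm g d n \<alpha> x V + s * rfrm g d n \<alpha> E W" using W(2) by (simp add: frm_line)
      with max[OF herm_line[OF xV(1) E] W(1) box] sq
      show "s * (rfrm g d n \<alpha> E W - l E) \<le> (C * e) * s\<^sup>2"
        by (simp add: l_def algebra_simps)
    qed
    then show ?thesis by simp
  qed
  with xV(1) int xV(2) top show ?thesis by blast
qed

text \<open>If \<open>V\<close> and \<open>U\<close> are orthogonal top eigenvectors, equality of the subgradients on their span forces
  \<open>\<langle>M(E) U, V\<rangle> = 0\<close> for all \<open>E\<close>, that is \<open>U A\<^sub>j\<^sup>T V\<^sup>* = 0\<close>, which is impossible for injective \<open>V\<close>.\<close>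

lemma simple_top_point:
  assumes h: "herm_coeff g d \<alpha>" "herm g n x" and V: "nrm n d V = 1"
    and top: "\<And>W. rfrm g d n \<alpha> x W \<le> rfrm g d n \<alpha> x V * nrm n d W"
    and l: "\<And>W E. nrm n d W = 1 \<Longrightarrow> rfrm g d n \<alpha> x W = rfrm g d n \<alpha> x V \<Longrightarrow> herm g n E \<Longrightarrow> rfrm g d n \<alpha> E W = l E"
    and \<mu>: "\<mu> = rfrm g d n \<alpha> x V" "\<mu> \<noteq> 0"
    and inj: "\<And>W. eigen g d n \<alpha> x (of_real \<mu>) W \<Longrightarrow> inj_mat n d W"
  shows "eigen g d n \<alpha> x (of_real \<mu>) V"
    and "eigen g d n \<alpha> x (of_real \<mu>) W \<Longrightarrow> \<exists>c. \<forall>i<n. \<forall>a<d. W (i, a) = c * V (i, a)"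
proof -
  show eV: "eigen g d n \<alpha> x (of_real \<mu>) V"
    by (rule top_is_eigen[OF h]) (use top V \<mu> in auto)
  assume eW: "eigen g d n \<alpha> x (of_real \<mu>) W"
  define c where "c = ip n d W V"
  define U where "U t = W t + (- c) * V t" for t
  have opU: "pencil_op g d n \<alpha> x U (i, a) = of_real \<mu> * U (i, a)" if "i < n" "a < d" for i a
    using eV eW that unfolding U_def[abs_def] pencil_op_lin by (simp add: eigen_def algebra_simps)
  have UV: "ip n d U V = 0"
    unfolding U_def[abs_def] ip_lin_left by (simp add: ip_nrm V c_def)
  have "nrm n d U = 0"
  proof (rule ccontr)
    assume "nrm n d U \<noteq> 0"
    then have pos: "0 < nrm n d U" using nrm_nonneg[of n d U] by linarith
    obtain U' b where U': "U' = (\<lambda>t. b * U t)" "nrm n d U' = 1" "b \<noteq> 0" using normalise[OF pos] by metis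
    have opU': "pencil_op g d n \<alpha> x U' (i, a) = of_real \<mu> * U' (i, a)" if "i < n" "a < d" for i a
      using opU[OF that] unfolding U'(1) pencil_op_scale by (simp add: mult_ac)
    have eU': "eigen g d n \<alpha> x (of_real \<mu>) U'"
      using opU' U'(2) nrm_pos_iff[of n d U'] by (simp add: eigen_def)
    have U'V: "ip n d U' V = 0" "ip n d V U' = 0"
      using UV ip_commute[of n d V U'] by (auto simp: U'(1) ip_scale_left)
    have cross: "frm g d n \<alpha> E U' V = 0" if E: "herm g n E" for E
    proof -
      \<comment> \<open>The normalised sum of \<open>V\<close> and \<theta> U' is again a top
        eigenvector, so its subgradient is also \<open>l\<close>, and the cross terms must have real
        part zero. The cases \<theta> = 1 and \<theta> = \<i> suffice.\<close>
      have ph: "Re (\<theta> * frm g d n \<alpha> E U' V) = 0" if \<theta>: "cmod \<theta> = 1" for \<theta>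
      proof -
        define T where "T t = V t + \<theta> * U' t" for t
        have \<theta>': "\<theta> * cnj \<theta> = 1" using \<theta> complex_norm_square[of \<theta>] by simp
        have "complex_of_real (nrm n d T) = 2"
          unfolding ip_nrm[symmetric] T_def[abs_def] ip_lin_left ip_lin_right U'V
          using \<theta>' by (simp add: ip_nrm V U'(2))
        then have nT: "nrm n d T = 2" by (metis of_real_eq_iff of_real_numeral)
        then have "0 < nrm n d T" by simp
        then obtain T' b where T': "T' = (\<lambda>t. b * T t)" "nrm n d T' = 1" "(cmod b)\<^sup>2 * nrm n d T = 1"
          using normalise by metis
        have b: "(cmod b)\<^sup>2 = 1 / 2" using T'(3) nT by simp
        have "pencil_op g d n \<alpha> x T' (i, a) = of_real \<mu> * T' (i, a)" if "i < n" "a < d" for i a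
          using opU'[OF that] eV that unfolding T'(1) pencil_op_scale T_def[abs_def] pencil_op_lin
          by (simp add: eigen_def algebra_simps)
        then have "eigen g d n \<alpha> x (of_real \<mu>) T'"
          using T'(2) nrm_pos_iff[of n d T'] by (simp add: eigen_def)
        from eigen_frm[OF this, of T'] have "rfrm g d n \<alpha> x T' = rfrm g d n \<alpha> x V"
          using T'(2) \<mu>(1) by (simp add: ip_nrm)
        from l[OF T'(2) this E] have "l E = (1 / 2) * rfrm g d n \<alpha> E T"
          unfolding T'(1) frm_scale b by (simp add: Re_divide_numeral)
        moreover have "frm g d n \<alpha> E T T = frm g d n \<alpha> E V V + frm g d n \<alpha> E U' U' + \<theta> * frm g d n \<alpha> E U' V
            + cnj (\<theta> * frm g d n \<alpha> E U' V)"
          unfolding T_def[abs_def] frm_lin_left frm_lin_right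
          using \<theta>' frm_herm[OF h(1) E, of V U'] by (simp add: algebra_simps)
        moreover have "rfrm g d n \<alpha> E V = l E" by (rule l[OF V refl E])
        moreover have "rfrm g d n \<alpha> x U' = rfrm g d n \<alpha> x V"
          using eigen_frm[OF eU', of U'] U'(2) \<mu>(1) by (simp add: ip_nrm)
        then have "rfrm g d n \<alpha> E U' = l E" by (rule l[OF U'(2) _ E])
        ultimately show ?thesis by simp
      qed
      from ph[of 1] ph[of "\<i>"] show ?thesis by (simp add: complex_eq_iff)
    qed
    \<comment> \<open>The form is complex linear in the tuple, so vanishing on hermitian tuples
      extends to all tuples.\<close>
    have cross': "frm g d n \<alpha> E U' V = 0" for E
      using cross[OF herm_re_part] cross[OF herm_im_part]
      by (subst line_re_im[symmetric]) (simp add: frm_line)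
    have injV: "inj_mat n d V" by (rule inj[OF eV])
    \<comment> \<open>The matrix unit at (j, i, k) shows that A_j applied to row k of U' is
      orthogonal to row i of \<open>V\<close>. The rows of an injective \<open>V\<close> span, so it
      vanishes; hence the pencil operator kills U', against \<mu> \<noteq> 0.\<close>
    have z: "(\<Sum>b<d. \<alpha> j a b * U' (k, b)) = 0" if j: "j < g" and k: "k < n" and a: "a < d" for j k a
    proof -
      define w where "w a = cnj (\<Sum>b<d. \<alpha> j a b * U' (k, b))" for a
      have "(\<Sum>a<d. V (i, a) * w a) = 0" if i: "i < n" for i
      proof -
        define E :: tuple where "E t = (if t = (j, i, k) then 1 else 0)" for t
        have op: "pencil_op g d n \<alpha> E U' (i', a) = (if i' = i then \<Sum>b<d. \<alpha> j a b * U' (k, b) else 0)" if "i' < n" for i' a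
        proof -
          have "pencil_op g d n \<alpha> E U' (i', a) = (\<Sum>j'<g. \<Sum>k'<n. if j' = j then if k' = k then if i' = i
              then \<Sum>b<d. \<alpha> j a b * U' (k, b) else 0 else 0 else 0)"
            unfolding pencil_op_def by (auto simp: E_def intro!: sum.cong)
          also have "\<dots> = (if i' = i then \<Sum>b<d. \<alpha> j a b * U' (k, b) else 0)"
            using j k by (subst sum.swap) simp
          finally show ?thesis .
        qed
        have "0 = (\<Sum>i'<n. \<Sum>a<d. (if i' = i then \<Sum>b<d. \<alpha> j a b * U' (k, b) else 0) * cnj (V (i', a)))"
          using cross'[of E] by (simp add: frm_def ip_def op)
        also have "\<dots> = (\<Sum>i'<n. if i' = i then \<Sum>a<d. (\<Sum>b<d. \<alpha> j a b * U' (k, b)) * cnj (V (i, a)) else 0)"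
          by (rule sum.cong) auto
        also have "\<dots> = (\<Sum>a<d. (\<Sum>b<d. \<alpha> j a b * U' (k, b)) * cnj (V (i, a)))" using i by simp
        finally have "cnj (\<Sum>a<d. (\<Sum>b<d. \<alpha> j a b * U' (k, b)) * cnj (V (i, a))) = 0" by simp
        then show ?thesis by (simp add: w_def mult.commute)
      qed
      then have "w a = 0" using injV a unfolding inj_mat_def by blast
      then show ?thesis unfolding w_def complex_cnj_zero_iff .
    qed
    have "pencil_op g d n \<alpha> x U' (i, a) = 0" if "i < n" "a < d" for i a
    proof -
      have "pencil_op g d n \<alpha> x U' (i, a) = (\<Sum>j<g. \<Sum>k<n. x (j, i, k) * (\<Sum>b<d. \<alpha> j a b * U' (k, b)))"
        by (simp add: pencil_op_def sum_distrib_left mult.assoc)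
      then show ?thesis using z that by simp
    qed
    then have "nrm n d U' = 0" using opU' \<mu>(2) by (simp add: nrm_zero_iff)
    with U'(2) show False by simp
  qed
  then show "\<exists>c. \<forall>i<n. \<forall>a<d. W (i, a) = c * V (i, a)"
    by (intro exI[of _ c]) (simp add: nrm_zero_iff U_def)
qed

section \<open>Rational curves in the free locus\<close>

text \<open>The columns of all coefficients span an invariant subspace, nonzero because of the
  nonzero eigenvalue, hence everything. So the block row (A_1 ... A_g) has a right inverse
  \<beta>.\<close>

lemma irred_range:
  assumes irr: "irred g d \<alpha>" and eig: "eigen g d n \<alpha> x \<mu> V" and \<mu>: "\<mu> \<noteq> 0"
  obtains \<beta> where "\<And>a c. a < d \<Longrightarrow> c < d \<Longrightarrow> (\<Sum>j<g. \<Sum>b<d. \<alpha> j a b * \<beta> j b c) = (if a = c then 1 else 0)"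
proof -
  define f where "f = (\<lambda>(j, b) a. if a < d then \<alpha> j a b else 0 :: complex)"
  let ?I = "{..<g} \<times> {..<d}"
  define S where "S = fv.span (f ` ?I)"
  have f: "f (j, b) \<in> vecs d" for j b by (simp add: f_def vecs_def)
  have actS: "act d (\<alpha> j) v \<in> S" if "j < g" for j v
  proof -
    have "act d (\<alpha> j) v = (\<Sum>b<d. scale_fun (v b) (f (j, b)))"
      by (auto simp: act_def f_def scale_fun_def fun_eq_iff sum_fun_apply mult.commute)
    also have "\<dots> \<in> S" unfolding S_def
      using that by (intro fv.span_sum fv.span_scale fv.span_base) auto
    finally show ?thesis .
  qed
  have Sd: "S \<subseteq> vecs d" unfolding S_def by (rule fv.span_minimal) (use f subspace_vecs in auto)
  then have inv: "invariant g d \<alpha> S" using actS by (auto simp: invariant_def S_def)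
  have "S \<noteq> {0}"
  proof
    assume S0: "S = {0}"
    have z: "\<alpha> j a b = 0" if "j < g" "a < d" "b < d" for j a b
    proof -
      have "f (j, b) \<in> S" unfolding S_def using that by (intro fv.span_base) auto
      then have "f (j, b) = 0" using S0 by simp
      from fun_cong[OF this, of a] that show ?thesis by (simp add: f_def)
    qed
    obtain i a where ia: "i < n" "a < d" "V (i, a) \<noteq> 0" using eig by (auto simp: eigen_def)
    have "\<mu> * V (i, a) = pencil_op g d n \<alpha> x V (i, a)" using eig ia by (simp add: eigen_def)
    also have "\<dots> = 0" using z ia by (simp add: pencil_op_def)
    finally show False using ia \<mu> by simp
  qed
  with irr inv have S: "S = vecs d" by (auto simp: irred_def)
  have "\<forall>c. \<exists>u. c < d \<longrightarrow> (\<lambda>a. if a = c then 1 else 0 :: complex) = (\<Sum>p\<in>?I. scale_fun (u p) (f p))"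
  proof
    fix c
    show "\<exists>u. c < d \<longrightarrow> (\<lambda>a. if a = c then 1 else 0 :: complex) = (\<Sum>p\<in>?I. scale_fun (u p) (f p))"
    proof (cases "c < d")
      case True
      then have "(\<lambda>a. if a = c then 1 else 0 :: complex) \<in> fv.span (f ` ?I)"
        using S by (auto simp: S_def vecs_def)
      moreover obtain I where I: "I \<subseteq> ?I" "inj_on f I" "fv.independent (f ` I)" "f ` ?I \<subseteq> fv.span (f ` I)"
        by (rule indexed_basis)
      then have "fv.span (f ` ?I) \<subseteq> fv.span (f ` I)" by (simp add: fv.span_minimal)
      ultimately have m: "(\<lambda>a. if a = c then 1 else 0 :: complex) \<in> fv.span (f ` I)" by blast
      have "finite I" using I(1) by (rule finite_subset) simp
      from indexed_coords[OF this I(2) m] obtain u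
        where u: "(\<lambda>a. if a = c then 1 else 0 :: complex) = (\<Sum>p\<in>I. scale_fun (u p) (f p))" by blast
      also have "\<dots> = (\<Sum>p\<in>?I. scale_fun (if p \<in> I then u p else 0) (f p))"
        using I(1) by (intro sum.mono_neutral_cong_left) (auto simp: scale_fun_def fun_eq_iff)
      finally show ?thesis by (intro exI[of _ "\<lambda>p. if p \<in> I then u p else 0"]) simp
    qed simp
  qed
  then obtain u where u: "\<And>c. c < d \<Longrightarrow>
    (\<lambda>a. if a = c then 1 else 0 :: complex) = (\<Sum>p\<in>?I. scale_fun (u c p) (f p))" by metis
  have "(\<Sum>j<g. \<Sum>b<d. \<alpha> j a b * u c (j, b)) = (if a = c then 1 else 0)" if "a < d" "c < d" for a c
  proof -
    have "(if a = c then 1 else 0) = (\<Sum>p\<in>?I. scale_fun (u c p) (f p)) a"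
      using fun_cong[OF u[OF that(2)], of a] .
    also have "\<dots> = (\<Sum>p\<in>?I. u c p * f p a)" by (simp add: sum_fun_apply scale_fun_def)
    also have "\<dots> = (\<Sum>j<g. \<Sum>b<d. u c (j, b) * f (j, b) a)" by (simp add: sum.cartesian_product)
    also have "\<dots> = (\<Sum>j<g. \<Sum>b<d. \<alpha> j a b * u c (j, b))" using that by (simp add: f_def mult.commute)
    finally show ?thesis ..
  qed
  then show thesis by (rule that)
qed

text \<open>With C = adj(Q P) Q and D = det(Q P) one has C P = D I, a left inverse of
  \<open>P\<close> with one denominator. \<open>Q\<close> stands in for the adjoint of
  \<open>P\<close>, whose entries would not be polynomial.\<close>

lemma poly_left_inverse:
  fixes P :: "nat \<times> nat \<Rightarrow> complex poly" and Q :: "nat \<times> nat \<Rightarrow> complex poly"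
  shows "\<exists>C D. (\<forall>a<d. \<forall>b<d. (\<Sum>i<n. C (a, i) * P (i, b)) = (if a = b then D else 0)) \<and>
    (\<forall>s. (\<forall>w. (\<forall>a<d. (\<Sum>b<d. \<Sum>i<n. poly (Q (a, i)) s * poly (P (i, b)) s * w b) = 0) \<longrightarrow>
       (\<forall>b<d. w b = 0)) \<longrightarrow> poly D s \<noteq> 0)"
proof -
  define G where "G = mat d d (\<lambda>(a, b). \<Sum>i<n. Q (a, i) * P (i, b))"
  have G: "G \<in> carrier_mat d d" by (simp add: G_def)
  define C where "C = (\<lambda>(a, i). \<Sum>e<d. adj_mat G $$ (a, e) * Q (e, i))"
  note adj = adj_mat[OF G]
  show ?thesis
  proof (intro exI[of _ C] exI[of _ "det G"] conjI allI impI)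
    fix a b assume ab: "a < d" "b < d"
    have "(\<Sum>i<n. C (a, i) * P (i, b)) = (\<Sum>i<n. \<Sum>e<d. adj_mat G $$ (a, e) * (Q (e, i) * P (i, b)))"
      by (simp add: C_def sum_distrib_right mult.assoc)
    also have "\<dots> = (\<Sum>e<d. \<Sum>i<n. adj_mat G $$ (a, e) * (Q (e, i) * P (i, b)))" by (rule sum.swap)
    also have "\<dots> = (\<Sum>e<d. adj_mat G $$ (a, e) * G $$ (e, b))"
      using ab by (simp add: G_def sum_distrib_left)
    also have "\<dots> = (adj_mat G * G) $$ (a, b)"
      using ab adj(1) G by (simp add: times_mat_def scalar_prod_def atLeast0LessThan)
    also have "\<dots> = (if a = b then det G else 0)" unfolding adj(3) using ab by simp
    finally show "(\<Sum>i<n. C (a, i) * P (i, b)) = (if a = b then det G else 0)" .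
  next
    fix s
    assume inj: "\<forall>w. (\<forall>a<d. (\<Sum>b<d. \<Sum>i<n. poly (Q (a, i)) s * poly (P (i, b)) s * w b) = 0) \<longrightarrow> (\<forall>b<d. w b = 0)"
    define H where "H = map_mat (\<lambda>p. poly p s) G"
    have H: "H \<in> carrier_mat d d" using G by (simp add: H_def)
    show "poly (det G) s \<noteq> 0"
    proof
      assume "poly (det G) s = 0"
      moreover have "poly (det G) s = det H"
        by (rule poly_det_cong[OF H G]) (use G in \<open>simp add: H_def\<close>)
      ultimately have "det H = 0" by simp
      then obtain v where v: "v \<in> carrier_vec d" "v \<noteq> 0\<^sub>v d" "H *\<^sub>v v = 0\<^sub>v d"
        using det_0_iff_vec_prod_zero[OF H] by blast
      have "(\<Sum>b<d. \<Sum>i<n. poly (Q (a, i)) s * poly (P (i, b)) s * vec_index v b) = 0" if "a < d" for a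
      proof -
        have "0 = vec_index (H *\<^sub>v v) a" using v(3) that by simp
        also have "\<dots> = (\<Sum>b<d. H $$ (a, b) * vec_index v b)"
          using v(1) H that by (simp add: scalar_prod_def atLeast0LessThan)
        also have "\<dots> = (\<Sum>b<d. (\<Sum>i<n. poly (Q (a, i)) s * poly (P (i, b)) s) * vec_index v b)"
          using that by (simp add: H_def G_def poly_sum)
        finally show ?thesis by (simp add: sum_distrib_right)
      qed
      then have "\<forall>b<d. vec_index v b = 0" using inj by blast
      then have "v = 0\<^sub>v d" using v(1) by auto
      with v(2) show False by simp
    qed
  qed
qed

text \<open>The tuples with a given injective kernel vector form an affine space, and injective matrices can be
  joined by a line; solving the affine equations along this line gives a rational curve in the free locus.\<close>

lemma free_locus_curve:
  assumes irr: "irred g d \<alpha>"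
    and x: "eigen g d n \<alpha> x 1 V" "inj_mat n d V" and y: "eigen g d n \<alpha> y 1 W" "inj_mat n d W"
    and p: "entry_polynomial g n p"
    and van: "0 < e" "\<And>z U. tdist g n z x < e \<Longrightarrow> eigen g d n \<alpha> z 1 U \<Longrightarrow> p (tup g n z) = 0"
  shows "p (tup g n y) = 0"
proof -
  obtain \<beta> where \<beta>: "\<And>a c. a < d \<Longrightarrow> c < d \<Longrightarrow> (\<Sum>j<g. \<Sum>b<d. \<alpha> j a b * \<beta> j b c) = (if a = c then 1 else 0)"
    using irred_range[OF irr x(1)] by auto
  define P where "P t = [:V t, W t - V t:]" for t
  \<comment> \<open>The adjoints of the two endpoints are joined by a line of their own. At s = 0
    and s = 1 the product Q P is the Gram matrix of an injective matrix, so \<open>D\<close> is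
    nonzero there.\<close>
  define Q where "Q = (\<lambda>(a, i). [:cnj (V (i, a)), cnj (W (i, a)) - cnj (V (i, a)):])"
  from poly_left_inverse[where d = d and n = n and P = P and Q = Q] obtain C D
    where CD: "\<forall>a<d. \<forall>b<d. (\<Sum>i<n. C (a, i) * P (i, b)) = (if a = b then D else 0)"
      "\<forall>s. (\<forall>w. (\<forall>a<d. (\<Sum>b<d. \<Sum>i<n. poly (Q (a, i)) s * poly (P (i, b)) s * w b) = 0) \<longrightarrow>
       (\<forall>b<d. w b = 0)) \<longrightarrow> poly D s \<noteq> 0" by (elim exE conjE)
  have gram: "\<forall>b<d. w b = 0" if U: "inj_mat n d U"
    and z: "\<forall>a<d. (\<Sum>b<d. \<Sum>i<n. cnj (U (i, a)) * U (i, b) * w b) = 0" for U and w :: "nat \<Rightarrow> complex"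
  proof -
    define r where "r i = (\<Sum>b<d. U (i, b) * w b)" for i
    have "(\<Sum>i<n. cnj (U (i, a)) * r i) = 0" if "a < d" for a
      using z that by (subst (asm) sum.swap) (simp add: r_def sum_distrib_left mult.assoc)
    then have "(\<Sum>a<d. cnj (w a) * (\<Sum>i<n. cnj (U (i, a)) * r i)) = 0" by simp
    moreover have "(\<Sum>a<d. cnj (w a) * (\<Sum>i<n. cnj (U (i, a)) * r i)) = (\<Sum>i<n. \<Sum>a<d. cnj (U (i, a) * w a) * r i)"
      by (subst sum.swap) (simp add: sum_distrib_left mult_ac)
    moreover have "\<dots> = (\<Sum>i<n. cnj (r i) * r i)"
      by (simp add: r_def sum_distrib_right)
    moreover have "\<dots> = complex_of_real (\<Sum>i<n. (cmod (r i))\<^sup>2)"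
      unfolding of_real_sum complex_norm_square by (simp add: mult.commute)
    ultimately have "(\<Sum>i<n. (cmod (r i))\<^sup>2) = 0" by (metis of_real_eq_0_iff)
    then have "\<forall>i<n. r i = 0" by (subst (asm) sum_nonneg_eq_0_iff) auto
    then show ?thesis using U unfolding inj_mat_def r_def by blast
  qed
  have PQ: "poly (P t) 0 = V t" "poly (Q (a, i)) 0 = cnj (V (i, a))"
    "poly (P t) 1 = W t" "poly (Q (a, i)) 1 = cnj (W (i, a))" for t a i
    by (auto simp: P_def Q_def)
  have D0: "poly D 0 \<noteq> 0" using CD(2)[rule_format, of 0, unfolded PQ] gram[OF x(2)] by blast
  have D1: "poly D 1 \<noteq> 0" using CD(2)[rule_format, of 1, unfolded PQ] gram[OF y(2)] by blast
  define z where "z s = line x (\<lambda>t. y t - x t) s" for s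
  define U where "U s = (\<lambda>t. poly (P t) s)" for s
  \<comment> \<open>\<open>T\<close> is the defect of the interpolated tuple for the vector
    \<open>U s\<close>, and \<open>E\<close> corrects it by means of the right inverse \<beta> and
    the left inverse C / D. The defect vanishes at both ends, so the curve \<open>X\<close> joins
    \<open>x\<close> to \<open>y\<close> on \<open>idx g n\<close>.\<close>
  define T where "T s t = U s t - pencil_op g d n \<alpha> (z s) (U s) t" for s t
  define E where "E s = (\<lambda>(j, i, k). \<Sum>c<d. \<Sum>b<d. T s (i, c) * \<beta> j b c * poly (C (b, k)) s / poly D s)" for s
  define X where "X s t = z s t + E s t" for s t
  have U01: "U 0 = V" "U 1 = W" "z 0 = x" "z 1 = y" by (auto simp: U_def P_def z_def line_def)
  have CU: "(\<Sum>k<n. poly (C (b, k)) s * U s (k, b')) = (if b = b' then poly D s else 0)" if "b < d" "b' < d" for b b' s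
    using arg_cong[OF CD(1)[rule_format, OF that], of "\<lambda>q. poly q s"] by (simp add: poly_sum U_def split: if_splits)
  have opE: "pencil_op g d n \<alpha> (E s) (U s) (i, a) = T s (i, a)" if s: "poly D s \<noteq> 0" and ia: "i < n" "a < d" for s i a
  proof -
    have "pencil_op g d n \<alpha> (E s) (U s) (i, a) =
        (\<Sum>j<g. \<Sum>k<n. \<Sum>b'<d. \<Sum>c<d. \<Sum>b<d. T s (i, c) * \<beta> j b c * \<alpha> j a b' / poly D s * (poly (C (b, k)) s * U s (k, b')))"
      unfolding pencil_op_def E_def prod.case sum_distrib_right
      by (intro sum.cong refl) (simp add: mult_ac)
    also have "\<dots> = (\<Sum>j<g. \<Sum>b'<d. \<Sum>k<n. \<Sum>c<d. \<Sum>b<d. T s (i, c) * \<beta> j b c * \<alpha> j a b' / poly D s * (poly (C (b, k)) s * U s (k, b')))"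
      by (intro sum.cong refl sum.swap)
    also have "\<dots> = (\<Sum>j<g. \<Sum>b'<d. \<Sum>c<d. \<Sum>k<n. \<Sum>b<d. T s (i, c) * \<beta> j b c * \<alpha> j a b' / poly D s * (poly (C (b, k)) s * U s (k, b')))"
      by (intro sum.cong refl sum.swap)
    also have "\<dots> = (\<Sum>j<g. \<Sum>b'<d. \<Sum>c<d. \<Sum>b<d. \<Sum>k<n. T s (i, c) * \<beta> j b c * \<alpha> j a b' / poly D s * (poly (C (b, k)) s * U s (k, b')))"
      by (intro sum.cong refl sum.swap)
    also have "\<dots> = (\<Sum>j<g. \<Sum>b'<d. \<Sum>c<d. \<Sum>b<d. T s (i, c) * \<beta> j b c * \<alpha> j a b' / poly D s * (if b = b' then poly D s else 0))"
      by (intro sum.cong refl) (simp only: sum_distrib_left[symmetric] CU lessThan_iff)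
    also have "\<dots> = (\<Sum>j<g. \<Sum>b'<d. \<Sum>c<d. \<Sum>b<d. if b = b' then T s (i, c) * \<beta> j b' c * \<alpha> j a b' else 0)"
      using s by (intro sum.cong refl) auto
    also have "\<dots> = (\<Sum>j<g. \<Sum>b'<d. \<Sum>c<d. T s (i, c) * (\<alpha> j a b' * \<beta> j b' c))"
      by (intro sum.cong refl) (simp add: mult_ac)
    also have "\<dots> = (\<Sum>j<g. \<Sum>c<d. \<Sum>b'<d. T s (i, c) * (\<alpha> j a b' * \<beta> j b' c))"
      by (intro sum.cong refl sum.swap)
    also have "\<dots> = (\<Sum>c<d. \<Sum>j<g. \<Sum>b'<d. T s (i, c) * (\<alpha> j a b' * \<beta> j b' c))" by (rule sum.swap)
    also have "\<dots> = (\<Sum>c<d. T s (i, c) * (if a = c then 1 else 0))"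
      by (intro sum.cong refl) (simp only: sum_distrib_left[symmetric] \<beta> ia lessThan_iff)
    also have "\<dots> = (\<Sum>c<d. if c = a then T s (i, a) else 0)"
      by (intro sum.cong refl) auto
    also have "\<dots> = T s (i, a)" using ia by simp
    finally show ?thesis .
  qed
  have Xeig: "eigen g d n \<alpha> (X s) 1 (U s)" if s: "poly D s \<noteq> 0" for s
  proof -
    have "X s = line (z s) (E s) 1" by (simp add: X_def line_def fun_eq_iff)
    then have "pencil_op g d n \<alpha> (X s) (U s) (i, a) = U s (i, a)" if "i < n" "a < d" for i a
      using opE[OF s that] by (simp add: pencil_op_line T_def)
    moreover have "\<exists>i<n. \<exists>a<d. U s (i, a) \<noteq> 0"
    proof (rule ccontr)
      assume "\<not> ?thesis"
      then have 0: "U s (i, a) = 0" if "i < n" "a < d" for i a using that by auto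
      obtain a where "a < d" using x(1) by (auto simp: eigen_def)
      from CU[OF this this, of s] 0 this s show False by simp
    qed
    ultimately show ?thesis by (simp add: eigen_def)
  qed
  have T0: "T s (i, a) = 0" if "s = 0 \<or> s = 1" "i < n" "a < d" for s i a
    using that x(1) y(1) by (auto simp: T_def U01 eigen_def)
  have X0: "X s t = z s t" if "s = 0 \<or> s = 1" "t \<in> idx g n" for s t
    using that T0 by (auto simp: X_def E_def)
  have zpoly: "\<exists>R. \<forall>s. z s t = poly R s" for t
    by (rule exI[of _ "[:x t, y t - x t:]"]) (simp add: z_def line_def algebra_simps)
  have Tpoly: "\<exists>R. \<forall>s. T s t = poly R s" for t
  proof -
    obtain R where R: "\<And>t s. z s t = poly (R t) s" using zpoly by metis
    obtain i a where t: "t = (i, a)" by (cases t)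
    show ?thesis
      by (rule exI[of _ "P t - (\<Sum>j<g. \<Sum>k<n. \<Sum>b<d. R (j, i, k) * [:\<alpha> j a b:] * P (k, b))"])
        (simp add: T_def t U_def pencil_op_def R poly_sum mult_ac)
  qed
  have Xrat: "\<exists>R. \<forall>s. poly D s \<noteq> 0 \<longrightarrow> X s t = poly R s / poly D s" for t
  proof -
    obtain j i k where t: "t = (j, i, k)" by (cases t)
    obtain R where R: "\<And>s. z s t = poly R s" using zpoly by metis
    obtain S where S: "\<And>t s. T s t = poly (S t) s" using Tpoly by metis
    have "X s t = poly (R * D + (\<Sum>c<d. \<Sum>b<d. S (i, c) * [:\<beta> j b c:] * C (b, k))) s / poly D s" if "poly D s \<noteq> 0" for s
      using that by (simp add: X_def E_def R[unfolded t] t S poly_sum add_divide_distrib sum_divide_distrib mult_ac)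
    then show ?thesis by blast
  qed
  from entry_polynomial_rational[where f = X and D = D, OF p Xrat]
  obtain R m where "\<forall>s. poly D s \<noteq> 0 \<longrightarrow> p (tup g n (X s)) = poly R s / poly D s ^ m" by (elim exE)
  note R = this[rule_format]
  have "\<forall>\<^sub>F s in at 0. poly D s \<noteq> 0"
    by (rule tendsto_imp_eventually_ne[OF _ D0]) (rule tendsto_poly[OF tendsto_ident_at])
  moreover have "\<forall>\<^sub>F s in at 0. tdist g n (X s) x < e"
  proof -
    have "((\<lambda>s. X s t) \<longlongrightarrow> x t) (at 0)" if t: "t \<in> idx g n" for t
    proof -
      obtain R where R: "\<And>s. poly D s \<noteq> 0 \<Longrightarrow> X s t = poly R s / poly D s" using Xrat by blast
      have "((\<lambda>s. poly R s / poly D s) \<longlongrightarrow> poly R 0 / poly D 0) (at 0)"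
        by (intro tendsto_divide tendsto_poly[OF tendsto_ident_at] D0)
      then have "((\<lambda>s. X s t) \<longlongrightarrow> poly R 0 / poly D 0) (at 0)"
        by (rule Lim_transform_eventually) (use \<open>\<forall>\<^sub>F s in at 0. poly D s \<noteq> 0\<close> R in \<open>auto elim: eventually_mono\<close>)
      moreover have "poly R 0 / poly D 0 = x t" using R[OF D0] X0[of 0 t] t by (simp add: U01)
      ultimately show ?thesis by simp
    qed
    from filterlim_near[OF this] have "filterlim X (near g n x) (at 0)" .
    moreover have "eventually (\<lambda>z. tdist g n z x < e) (near g n x)" using van(1) by (auto simp: eventually_near)
    ultimately show ?thesis unfolding filterlim_iff by blast
  qed
  ultimately have ev: "\<forall>\<^sub>F s in at 0. poly R s = 0"
  proof eventually_elim
    case (elim s)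
    from van(2)[OF elim(2) Xeig[OF elim(1)]] R[OF elim(1)] elim(1) show ?case by simp
  qed
  \<comment> \<open>The numerator of \<open>p\<close> along the curve vanishes near s = 0, hence
    identically, and \<open>D\<close> is nonzero at s = 1.\<close>
  have "R = 0"
  proof (rule ccontr)
    assume "R \<noteq> 0"
    then have "finite {s. poly R s = 0}" by (rule poly_roots_finite)
    then have "\<forall>\<^sub>F s in at 0. s \<notin> {s. poly R s = 0}"
      using islimpt_finite islimpt_iff_eventually by blast
    with ev have "\<forall>\<^sub>F s in at (0::complex). False" by eventually_elim auto
    then show False by simp
  qed
  then have "p (tup g n (X 1)) = 0" using R[OF D1] by simp
  moreover have "tup g n (X 1) = tup g n y" by (rule tup_cong) (simp add: X0 U01)
  ultimately show ?thesis by simp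
qed

section \<open>Boundary points of an irreducible component\<close>

text \<open>Direct sum with a zero block, which carries a tuple to any larger size without changing
  its form on the leading rows.\<close>

definition pad :: "nat \<Rightarrow> tuple \<Rightarrow> tuple" where
  "pad m x = (\<lambda>(j, i, k). if i < m \<and> k < m then x (j, i, k) else 0)"

lemma herm_pad: "herm g m x \<Longrightarrow> herm g n (pad m x)"
  by (auto simp: herm_def pad_def)

lemma sum_restrict_less:
  fixes f :: "nat \<Rightarrow> 'b::comm_monoid_add"
  assumes "m \<le> n" "\<And>i. m \<le> i \<Longrightarrow> i < n \<Longrightarrow> f i = 0"
  shows "sum f {..<n} = sum f {..<m}"
  using assms by (intro sum.mono_neutral_right) auto

lemma frm_pad:
  assumes "m \<le> n"
  shows "frm g d n \<alpha> (pad m x) V W = frm g d m \<alpha> x V W"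
proof -
  have op: "pencil_op g d n \<alpha> (pad m x) V (i, a) = (if i < m then pencil_op g d m \<alpha> x V (i, a) else 0)" for i a
  proof (cases "i < m")
    case True
    have "(\<Sum>k<n. \<Sum>b<d. pad m x (j, i, k) * \<alpha> j a b * V (k, b)) = (\<Sum>k<m. \<Sum>b<d. x (j, i, k) * \<alpha> j a b * V (k, b))" for j
      using True by (subst sum_restrict_less[OF assms]) (auto simp: pad_def)
    then show ?thesis using True by (simp add: pencil_op_def)
  qed (simp add: pencil_op_def pad_def)
  show ?thesis unfolding frm_def ip_def op
    by (subst sum_restrict_less[OF assms]) auto
qed

lemma nrm_mono: "m \<le> n \<Longrightarrow> nrm m d V \<le> nrm n d V"
  unfolding nrm_def by (intro sum_mono2) (auto intro: sum_nonneg)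

lemma herm_scale_real: "herm g n x \<Longrightarrow> herm g n (\<lambda>t. of_real c * x t)"
  by (simp add: herm_def)

lemma rfrm_zero: "nrm n d W = 0 \<Longrightarrow> rfrm g d n \<alpha> x W = 0"
  using frm_bound[of g d n \<alpha> x W] by simp

lemma eigen_rfrm: "eigen g d n \<alpha> x (of_real \<mu>) W \<Longrightarrow> rfrm g d n \<alpha> x W = \<mu> * nrm n d W"
  by (simp add: eigen_frm ip_nrm)

lemma eigen_tuple_scale:
  assumes "\<mu> \<noteq> 0"
  shows "eigen g d n \<alpha> (\<lambda>t. x t / \<mu>) 1 V \<longleftrightarrow> eigen g d n \<alpha> x \<mu> V"
proof -
  have "(\<lambda>t. x t / \<mu>) = (\<lambda>t. (1 / \<mu>) * x t)" by simp
  then have eq: "pencil_op g d n \<alpha> (\<lambda>t. x t / \<mu>) V t = pencil_op g d n \<alpha> x V t / \<mu>" for t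
    by (simp only: pencil_op_tuple_scale) simp
  show ?thesis unfolding eigen_def eq using assms by (simp add: divide_eq_eq mult.commute)
qed

lemma rfrm_tuple_scale: "rfrm g d n \<alpha> (\<lambda>t. x t / of_real \<mu>) W = rfrm g d n \<alpha> x W / \<mu>"
proof -
  have "(\<lambda>t. x t / of_real \<mu>) = (\<lambda>t. of_real (1 / \<mu>) * x t)" by simp
  then show ?thesis by (simp only: frm_tuple_scale) simp
qed

lemma tdist_triangle: "tdist g n x z \<le> tdist g n x y + tdist g n y z"
  unfolding tdist_def sum.distrib[symmetric]
proof (rule sum_mono)
  fix t
  show "cmod (x t - z t) \<le> cmod (x t - y t) + cmod (y t - z t)"
    using norm_triangle_ineq[of "x t - y t" "y t - z t"] by simp
qed

text \<open>A generic centre keeps a whole box off the hypersurface of degenerate tuples, so every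
  top eigenvector met in the box is injective, as \<open>simple_top_point\<close> requires. All
  moves stay within \<delta>, small enough that the complement keeps the slack \<tau> < 1 after
  division by the top eigenvalue.\<close>

lemma exists_boundary_point:
  assumes h1: "herm_coeff g d1 \<alpha>1" and irr: "irred g d1 \<alpha>1"
    and xs: "herm g m xs" "\<And>W. rfrm g d2 m \<alpha>2 xs W \<le> nrm m d2 W" "nrm m d1 Vs < rfrm g d1 m \<alpha>1 xs Vs"
    and n: "m \<le> n" "1 + d1\<^sup>2 + g * d1\<^sup>2 < n"
  shows "\<exists>x V \<tau>. herm g n x \<and> eigen g d1 n \<alpha>1 x 1 V \<and> inj_mat n d1 V \<and> nrm n d1 V = 1 \<and>
    (\<forall>W. eigen g d1 n \<alpha>1 x 1 W \<longrightarrow> (\<exists>c. \<forall>i<n. \<forall>a<d1. W (i, a) = c * V (i, a))) \<and>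
    (\<forall>W. rfrm g d1 n \<alpha>1 x W \<le> nrm n d1 W) \<and> \<tau> < 1 \<and> (\<forall>W. rfrm g d2 n \<alpha>2 x W \<le> \<tau> * nrm n d2 W)"
proof -
  have Vs: "0 < nrm m d1 Vs"
  proof -
    have "nrm m d1 Vs \<noteq> 0" using xs(3) rfrm_zero[of m d1 Vs g \<alpha>1 xs] by auto
    then show ?thesis using nrm_nonneg[of m d1 Vs] by linarith
  qed
  then have d1n: "0 < d1 * n" using n(1) by (auto simp: nrm_pos_iff)
  \<comment> \<open>Scaling by \<open>t\<close> turns the violated inequality into an equality at
    \<open>Vs\<close> and leaves the other one with a factor t < 1.\<close>
  define t where "t = nrm m d1 Vs / rfrm g d1 m \<alpha>1 xs Vs"
  have t: "0 < t" "t < 1" using xs(3) Vs by (auto simp: t_def)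
  define x1 where "x1 = (\<lambda>s. of_real t * pad m xs s)"
  have x1: "herm g n x1" unfolding x1_def by (intro herm_scale_real herm_pad xs)
  have x1f: "rfrm g d n \<alpha> x1 W = t * rfrm g d m \<alpha> xs W" for d \<alpha> W
    by (simp add: x1_def frm_tuple_scale frm_pad[OF n(1)])
  define V1 where "V1 = (\<lambda>(i, a). if i < m then Vs (i, a) else 0)"
  have nV1: "nrm n d1 V1 = nrm m d1 Vs"
    unfolding nrm_def by (subst sum_restrict_less[OF n(1)]) (auto simp: V1_def)
  have "frm g d1 m \<alpha>1 xs V1 V1 = frm g d1 m \<alpha>1 xs Vs Vs" by (rule frm_cong) (simp add: V1_def)
  then have fV1: "rfrm g d1 n \<alpha>1 x1 V1 = nrm n d1 V1"
    using xs(3) Vs by (simp add: x1f nV1 t_def)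
  have f2: "rfrm g d2 n \<alpha>2 x1 W \<le> t * nrm n d2 W" for W
    unfolding x1f using t xs(2)[of W] nrm_mono[OF n(1), of d2 W] by (intro mult_left_mono) auto
  define A where "A = coeff_bound g d1 \<alpha>1 + coeff_bound g d2 \<alpha>2 + 1"
  have A: "0 < A" "coeff_bound g d1 \<alpha>1 \<le> A" "coeff_bound g d2 \<alpha>2 \<le> A"
    unfolding A_def using coeff_bound_nonneg[of g d1 \<alpha>1] coeff_bound_nonneg[of g d2 \<alpha>2] by linarith+
  \<comment> \<open>A quarter of the slack: the perturbation may raise the bound of the complement
    to t + \<eta> and lower the top eigenvalue to 1 - \<eta>, and the quotient is still below
    1.\<close>
  define \<eta> where "\<eta> = (1 - t) / 4"
  have \<eta>: "0 < \<eta>" "t + \<eta> < 1 - \<eta>" "\<eta> < 1" using t by (auto simp: \<eta>_def field_simps)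
  define \<delta> where "\<delta> = \<eta> / A"
  have \<delta>: "0 < \<delta>" "A * \<delta> = \<eta>" using \<eta> A by (auto simp: \<delta>_def)
  have pert: "rfrm g d n \<alpha> x W \<le> rfrm g d n \<alpha> x' W + \<eta> * nrm n d W"
    if "tdist g n x x' \<le> \<delta>" "coeff_bound g d \<alpha> \<le> A" for d \<alpha> x x' W
  proof -
    have "coeff_bound g d \<alpha> * tdist g n x x' \<le> A * \<delta>" using that A by (intro mult_mono) auto
    then have "coeff_bound g d \<alpha> * tdist g n x x' * nrm n d W \<le> \<eta> * nrm n d W"
      unfolding \<delta>(2) by (rule mult_right_mono) simp
    with rfrm_perturb[of g d n \<alpha> x W x'] show ?thesis by simp
  qed
  obtain q y0 where q: "entry_polynomial g n q" "q (tup g n y0) \<noteq> 0"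
    "\<And>x \<mu> V. eigen g d1 n \<alpha>1 x \<mu> V \<Longrightarrow> \<mu> \<noteq> 0 \<Longrightarrow> \<not> inj_mat n d1 V \<Longrightarrow> q (tup g n x) = 0"
    using bad_hypersurface[OF irr n(2)] by blast
  obtain h s1 where h: "herm g n h" "q (tup g n (line x1 h (of_real s1))) \<noteq> 0"
    using herm_nonzero_near[OF q(1,2) x1, of 1] by auto
  obtain R where R: "\<And>s. q (tup g n (line x1 h s)) = poly R s" using entry_polynomial_line[OF q(1)] by blast
  have "R \<noteq> 0" using h(2) R by auto
  moreover have "0 < \<delta> / (2 * (tdist g n h (\<lambda>_. 0) + 1))" using \<delta>(1) by (simp add: add_nonneg_pos)
  ultimately obtain s where s: "0 < s" "s < \<delta> / (2 * (tdist g n h (\<lambda>_. 0) + 1))" "poly R (of_real s) \<noteq> 0"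
    by (rule poly_nonzero_real)
  define c where "c = line x1 h (of_real s)"
  have c: "herm g n c" "q (tup g n c) \<noteq> 0" using s(3) by (auto simp: c_def R intro: herm_line x1 h)
  have cd: "tdist g n c x1 < \<delta> / 2"
  proof -
    have "tdist g n c x1 = s * tdist g n h (\<lambda>_. 0)"
      using s(1) by (simp add: tdist_def c_def line_def norm_mult sum_distrib_left)
    also have "\<dots> \<le> s * (tdist g n h (\<lambda>_. 0) + 1)" using s(1) by simp
    also have "\<dots> < \<delta> / 2" using s(2) tdist_nonneg[of g n h "\<lambda>_. 0"] by (simp add: field_simps add_nonneg_pos)
    finally show ?thesis .
  qed
  have "\<forall>\<^sub>F x in near g n c. q (tup g n x) \<noteq> 0"
    by (rule tendsto_imp_eventually_ne[OF tendsto_near[OF q(1)] c(2)])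
  then obtain e where e: "0 < e" "\<And>x. tdist g n x c < e \<Longrightarrow> q (tup g n x) \<noteq> 0" by (auto simp: eventually_near)
  define M where "M = real (card (idx g n))"
  \<comment> \<open>A box of radius \<open>r\<close> has summed distance at most M r, so it stays
    off the hypersurface and within \<delta> / 2 of \<open>c\<close>. The summand 1 keeps the
    denominator positive.\<close>
  define r where "r = min e (\<delta> / 2) / (M + 1)"
  have M: "0 \<le> M" by (simp add: M_def)
  then have r: "0 < r" using e(1) \<delta>(1) by (simp add: r_def)
  obtain x' V l where x': "herm g n x'" "\<forall>s\<in>idx g n. cmod (x' s - c s) < r" "nrm n d1 V = 1"
    "\<forall>W. rfrm g d1 n \<alpha>1 x' W \<le> rfrm g d1 n \<alpha>1 x' V * nrm n d1 W"
    "\<forall>W E. nrm n d1 W = 1 \<longrightarrow> rfrm g d1 n \<alpha>1 x' W = rfrm g d1 n \<alpha>1 x' V \<longrightarrow> herm g n E \<longrightarrow> rfrm g d1 n \<alpha>1 E W = l E"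
    using smooth_top_point[OF c(1) r d1n, of \<alpha>1] by metis
  have dx': "tdist g n x' c < min e (\<delta> / 2)"
  proof -
    have "tdist g n x' c \<le> M * r"
      unfolding tdist_def M_def using sum_bounded_above[of "idx g n" "\<lambda>s. cmod (x' s - c s)" r] x'(2)
      by (auto intro: less_imp_le)
    also have "\<dots> < (M + 1) * r" using r by simp
    also have "\<dots> = min e (\<delta> / 2)" using M by (simp add: r_def)
    finally show ?thesis .
  qed
  then have qx': "q (tup g n x') \<noteq> 0" using e(2) by simp
  have dx1: "tdist g n x' x1 \<le> \<delta>" "tdist g n x1 x' \<le> \<delta>"
    using tdist_triangle[of g n x' x1 c] dx' cd by (auto simp: tdist_commute[of g n x1])
  define \<mu> where "\<mu> = rfrm g d1 n \<alpha>1 x' V"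
  have "nrm n d1 V1 \<le> rfrm g d1 n \<alpha>1 x' V1 + \<eta> * nrm n d1 V1" using pert[OF dx1(2) A(2), of V1] fV1 by simp
  also have "\<dots> \<le> \<mu> * nrm n d1 V1 + \<eta> * nrm n d1 V1" using x'(4) by (simp add: \<mu>_def)
  finally have "(1 - \<eta>) * nrm n d1 V1 \<le> \<mu> * nrm n d1 V1" by (simp add: algebra_simps)
  then have \<mu>: "1 - \<eta> \<le> \<mu>" using Vs nV1 by simp
  then have \<mu>0: "0 < \<mu>" using \<eta>(3) by linarith
  have inj: "inj_mat n d1 W" if "eigen g d1 n \<alpha>1 x' (of_real \<mu>) W" for W
    using q(3)[OF that] qx' \<mu>0 by auto
  have eV: "eigen g d1 n \<alpha>1 x' (of_real \<mu>) V"
  proof (rule simple_top_point(1)[OF h1 x'(1,3)])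
    show "rfrm g d1 n \<alpha>1 x' Z \<le> rfrm g d1 n \<alpha>1 x' V * nrm n d1 Z" for Z using x'(4) by blast
    show "rfrm g d1 n \<alpha>1 E Z = l E"
      if "nrm n d1 Z = 1" "rfrm g d1 n \<alpha>1 x' Z = rfrm g d1 n \<alpha>1 x' V" "herm g n E" for Z E
      using x'(5) that by blast
    show "\<mu> = rfrm g d1 n \<alpha>1 x' V" "\<mu> \<noteq> 0" using \<mu>0 by (auto simp: \<mu>_def)
    show "inj_mat n d1 Z" if "eigen g d1 n \<alpha>1 x' (of_real \<mu>) Z" for Z by (rule inj[OF that])
  qed
  have uniq: "\<exists>c. \<forall>i<n. \<forall>a<d1. W (i, a) = c * V (i, a)" if W: "eigen g d1 n \<alpha>1 x' (of_real \<mu>) W" for W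
  proof (rule simple_top_point(2)[OF h1 x'(1,3)])
    show "rfrm g d1 n \<alpha>1 x' Z \<le> rfrm g d1 n \<alpha>1 x' V * nrm n d1 Z" for Z using x'(4) by blast
    show "rfrm g d1 n \<alpha>1 E Z = l E"
      if "nrm n d1 Z = 1" "rfrm g d1 n \<alpha>1 x' Z = rfrm g d1 n \<alpha>1 x' V" "herm g n E" for Z E
      using x'(5) that by blast
    show "\<mu> = rfrm g d1 n \<alpha>1 x' V" "\<mu> \<noteq> 0" using \<mu>0 by (auto simp: \<mu>_def)
    show "inj_mat n d1 Z" if "eigen g d1 n \<alpha>1 x' (of_real \<mu>) Z" for Z by (rule inj[OF that])
    show "eigen g d1 n \<alpha>1 x' (of_real \<mu>) W" by (rule W)
  qed
  define x where "x = (\<lambda>s. x' s / of_real \<mu>)"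
  have "herm g n x" using herm_scale_real[OF x'(1), of "1 / \<mu>"] by (simp add: x_def)
  moreover have sc: "eigen g d1 n \<alpha>1 x 1 W \<longleftrightarrow> eigen g d1 n \<alpha>1 x' (of_real \<mu>) W" for W
    unfolding x_def by (rule eigen_tuple_scale) (use \<mu>0 in simp)
  moreover have "rfrm g d1 n \<alpha>1 x W \<le> nrm n d1 W" for W
    unfolding x_def rfrm_tuple_scale using x'(4) \<mu>0 by (simp add: \<mu>_def divide_le_eq mult.commute)
  moreover have "rfrm g d2 n \<alpha>2 x W \<le> (t + \<eta>) / (1 - \<eta>) * nrm n d2 W" for W
  proof -
    have "rfrm g d2 n \<alpha>2 x' W \<le> (t + \<eta>) * nrm n d2 W"
      using pert[OF dx1(1) A(3), of W] f2[of W] by (simp add: algebra_simps)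
    then have "rfrm g d2 n \<alpha>2 x W \<le> (t + \<eta>) * nrm n d2 W / \<mu>"
      unfolding x_def rfrm_tuple_scale using \<mu>0 by (intro divide_right_mono) auto
    also have "\<dots> \<le> (t + \<eta>) * nrm n d2 W / (1 - \<eta>)"
      using \<mu> \<eta> t by (intro divide_left_mono) auto
    finally show ?thesis by simp
  qed
  moreover have "(t + \<eta>) / (1 - \<eta>) < 1" using \<eta> by simp
  ultimately show ?thesis using eV inj[OF eV] x'(3) uniq by blast
qed

text \<open>If the maximum of the form over unit vectors orthogonal to \<open>V\<close> were 1, it
  would be attained at an eigenvector for 1, which would be a multiple of \<open>V\<close>. When no
  nonzero vector is orthogonal to \<open>V\<close>, any gap serves.\<close>

lemma spectral_gap:
  assumes h: "herm_coeff g d \<alpha>" "herm g n x" and V: "nrm n d V = 1"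
    and uniq: "\<And>W. eigen g d n \<alpha> x 1 W \<Longrightarrow> \<exists>c. \<forall>i<n. \<forall>a<d. W (i, a) = c * V (i, a)"
    and le: "\<And>W. rfrm g d n \<alpha> x W \<le> nrm n d W"
  shows "\<exists>\<gamma>>0. \<forall>W. ip n d W V = 0 \<longrightarrow> rfrm g d n \<alpha> x W \<le> (1 - \<gamma>) * nrm n d W"
proof (cases "\<exists>W0. 0 < nrm n d W0 \<and> ip n d W0 V = 0")
  case True
  then obtain U where U: "nrm n d U = 1" "ip n d U V = 0"
    "\<And>W. ip n d W V = 0 \<Longrightarrow> rfrm g d n \<alpha> x W \<le> rfrm g d n \<alpha> x U * nrm n d W"
    using top_exists by metis
  have "rfrm g d n \<alpha> x U \<noteq> 1"
  proof
    assume "rfrm g d n \<alpha> x U = 1"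
    then have "eigen g d n \<alpha> x (of_real 1) U"
      by (intro top_is_eigen[OF h]) (use le U(1) in auto)
    then have "eigen g d n \<alpha> x 1 U" by simp
    from uniq[OF this] obtain c where c: "\<forall>i<n. \<forall>a<d. U (i, a) = c * V (i, a)" ..
    then have "ip n d U V = ip n d (\<lambda>t. c * V t) V" by (intro ip_cong) auto
    then have "c = 0" using U(2) V by (simp add: ip_scale_left ip_nrm)
    with c have "nrm n d U = 0" by (simp add: nrm_zero_iff)
    with U(1) show False by simp
  qed
  then have "rfrm g d n \<alpha> x U < 1" using le[of U] U(1) by simp
  with U(3) show ?thesis by (intro exI[of _ "1 - rfrm g d n \<alpha> x U"]) auto
next
  case False
  have "rfrm g d n \<alpha> x W \<le> (1 - 1) * nrm n d W" if "ip n d W V = 0" for W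
  proof -
    have "nrm n d W = 0" using False that nrm_nonneg[of n d W] by (metis less_eq_real_def)
    then show ?thesis by (simp add: rfrm_zero)
  qed
  then show ?thesis by (intro exI[of _ 1]) auto
qed

text \<open>The points fed to \<open>van\<close> are hermitian tuples near \<open>x0\<close> divided
  by their top eigenvalue. The spectral gap and the slack at \<open>x0\<close> survive small
  perturbations, so the kernel stays one-dimensional and the complement stays strict.\<close>

lemma vanish_on_free_locus:
  assumes h1: "herm_coeff g d1 \<alpha>1" and irr: "irred g d1 \<alpha>1"
    and xs: "herm g m xs" "\<And>W. rfrm g d2 m \<alpha>2 xs W \<le> nrm m d2 W" "nrm m d1 Vs < rfrm g d1 m \<alpha>1 xs Vs"
    and n: "m \<le> n" "1 + d1\<^sup>2 + g * d1\<^sup>2 < n"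
    and p: "entry_polynomial g n p"
    and van: "\<And>x. herm g n x \<Longrightarrow> (\<And>W. rfrm g d1 n \<alpha>1 x W \<le> nrm n d1 W) \<Longrightarrow> simple_kernel g d1 n \<alpha>1 x 1 \<Longrightarrow>
      (\<And>W. 0 < nrm n d2 W \<Longrightarrow> rfrm g d2 n \<alpha>2 x W < nrm n d2 W) \<Longrightarrow> p (tup g n x) = 0"
    and y: "eigen g d1 n \<alpha>1 y 1 U"
  shows "p (tup g n y) = 0"
proof -
  obtain x0 V \<tau> where x0: "herm g n x0" "eigen g d1 n \<alpha>1 x0 1 V" "inj_mat n d1 V" "nrm n d1 V = 1"
    "\<And>W. eigen g d1 n \<alpha>1 x0 1 W \<Longrightarrow> \<exists>c. \<forall>i<n. \<forall>a<d1. W (i, a) = c * V (i, a)"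
    "\<And>W. rfrm g d1 n \<alpha>1 x0 W \<le> nrm n d1 W" and \<tau>: "\<tau> < 1" "\<And>W. rfrm g d2 n \<alpha>2 x0 W \<le> \<tau> * nrm n d2 W"
    using exists_boundary_point[OF h1 irr xs n] by metis
  have "0 < nrm n d1 V" using x0(4) by simp
  then have N: "0 < d1 * n" by (auto simp: nrm_pos_iff)
  obtain \<gamma> where \<gamma>: "0 < \<gamma>" "\<And>W. ip n d1 W V = 0 \<Longrightarrow> rfrm g d1 n \<alpha>1 x0 W \<le> (1 - \<gamma>) * nrm n d1 W"
    using spectral_gap[OF h1 x0(1,4,5,6)] by blast
  define A where "A = coeff_bound g d1 \<alpha>1 + coeff_bound g d2 \<alpha>2 + 1"
  have A: "0 < A" "coeff_bound g d1 \<alpha>1 \<le> A" "coeff_bound g d2 \<alpha>2 \<le> A"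
    unfolding A_def using coeff_bound_nonneg[of g d1 \<alpha>1] coeff_bound_nonneg[of g d2 \<alpha>2] by linarith+
  have simple: "simple_kernel g d1 n \<alpha>1 x0 1" using x0(2,5) by (auto simp: simple_kernel_def)
  have root: "poly (chp g d1 n \<alpha>1 x0) 1 = 0" using x0(2) by (auto simp: chp_root_iff)
  have "poly (pderiv (chp g d1 n \<alpha>1 x0)) 1 \<noteq> 0" by (rule chp_simple_root[OF h1 x0(1) simple]) simp
  then have "\<exists>e>0. \<forall>x. tdist g n x x0 < e \<longrightarrow> poly (chp g d1 n \<alpha>1 x) 1 = 0 \<longrightarrow> p (tup g n x) = 0"
  proof (rule vanish_near_hermitian[OF N x0(1) root _ p])
    fix r :: real assume r: "0 < r"
    \<comment> \<open>The four bounds serve in turn positivity of \<mu>, membership of \<mu> in the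
      ball, survival of the spectral gap, and strictness for the complement.\<close>
    define \<epsilon> where "\<epsilon> = Min {1/2, r/2, \<gamma>/3, (1 - \<tau>)/4}"
    have le: "\<epsilon> \<le> 1/2" "\<epsilon> \<le> r/2" "\<epsilon> \<le> \<gamma>/3" "\<epsilon> \<le> (1 - \<tau>)/4" unfolding \<epsilon>_def by (intro Min_le; simp)+
    have "4 * \<epsilon> \<le> 1 - \<tau>" using le(4) by simp
    moreover have "0 < \<epsilon>" unfolding \<epsilon>_def using r \<gamma>(1) \<tau>(1) by simp
    ultimately
    have \<epsilon>: "0 < \<epsilon>" "\<epsilon> \<le> 1/2" "\<epsilon> < r" "2 * \<epsilon> < \<gamma>" "\<tau> + \<epsilon> < 1 - \<epsilon>"
      using le(1-3) r \<gamma>(1) \<tau>(1) by linarith+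
    show "\<exists>e>0. \<forall>x. herm g n x \<longrightarrow> tdist g n x x0 < e \<longrightarrow>
       (\<exists>\<mu>\<in>ball 1 r. poly (chp g d1 n \<alpha>1 x) \<mu> = 0 \<and> p (tup g n (\<lambda>t. x t / \<mu>)) = 0)"
    proof (intro exI[of _ "\<epsilon> / A"] conjI allI impI)
      show "0 < \<epsilon> / A" using \<epsilon> A by simp
      fix x assume x: "herm g n x" "tdist g n x x0 < \<epsilon> / A"
      have pert: "rfrm g d n \<alpha> z W \<le> rfrm g d n \<alpha> z' W + \<epsilon> * nrm n d W"
        if "tdist g n z z' < \<epsilon> / A" "coeff_bound g d \<alpha> \<le> A" for d \<alpha> z z' W
      proof -
        have "coeff_bound g d \<alpha> * tdist g n z z' \<le> A * (\<epsilon> / A)" using that A by (intro mult_mono) auto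
        then have "coeff_bound g d \<alpha> * tdist g n z z' * nrm n d W \<le> \<epsilon> * nrm n d W"
          using A by (intro mult_right_mono) auto
        with rfrm_perturb[of g d n \<alpha> z W z'] show ?thesis by simp
      qed
      have x': "tdist g n x0 x < \<epsilon> / A" using x(2) by (simp add: tdist_commute)
      obtain T where T: "nrm n d1 T = 1" "\<And>W. rfrm g d1 n \<alpha>1 x W \<le> rfrm g d1 n \<alpha>1 x T * nrm n d1 W"
        using top_exists[of n d1 V "\<lambda>_. 0" g \<alpha>1 x] x0(4) by (auto simp: ip_def)
      define \<mu> where "\<mu> = rfrm g d1 n \<alpha>1 x T"
      have V1: "rfrm g d1 n \<alpha>1 x0 V = 1" using eigen_rfrm[of g d1 n \<alpha>1 x0 1 V] x0(2,4) by simp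
      have \<mu>: "1 - \<epsilon> \<le> \<mu>" "\<mu> \<le> 1 + \<epsilon>"
        using pert[OF x' A(2), of V] T(2)[of V] V1 x0(4) pert[OF x(2) A(2), of T] x0(6)[of T] T(1)
        by (auto simp: \<mu>_def)
      have \<mu>0: "0 < \<mu>" using \<mu> \<epsilon> by linarith
      have eT: "eigen g d1 n \<alpha>1 x (of_real \<mu>) T"
        by (rule top_is_eigen[OF h1 x(1)]) (use T in \<open>auto simp: \<mu>_def\<close>)
      \<comment> \<open>Orthogonally to \<open>V\<close> the form is at most 1 - \<gamma> +
        \<epsilon> times the squared norm, below the top eigenvalue. A combination of two top
        eigenvectors that is orthogonal to \<open>V\<close> must therefore vanish.\<close>
      have orth0: "nrm n d1 Z = 0" if Z: "ip n d1 Z V = 0" "rfrm g d1 n \<alpha>1 x Z = \<mu> * nrm n d1 Z" for Z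
      proof (rule ccontr)
        assume "nrm n d1 Z \<noteq> 0"
        then have pos: "0 < nrm n d1 Z" using nrm_nonneg[of n d1 Z] by linarith
        have "\<mu> * nrm n d1 Z \<le> (1 - \<gamma> + \<epsilon>) * nrm n d1 Z"
          using pert[OF x(2) A(2), of Z] \<gamma>(2)[OF Z(1)] Z(2) by (simp add: algebra_simps)
        then have "\<mu> \<le> 1 - \<gamma> + \<epsilon>" using pos by simp
        with \<mu>(1) \<epsilon>(4) show False by linarith
      qed
      define b where "b = ip n d1 T V"
      have b: "b \<noteq> 0"
        using orth0[of T] T(1) by (auto simp: b_def \<mu>_def)
      have uniq: "\<exists>c. \<forall>i<n. \<forall>a<d1. W (i, a) = c * T (i, a)" if W: "eigen g d1 n \<alpha>1 x (of_real \<mu>) W" for W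
      proof -
        define a where "a = ip n d1 W V / b"
        define Z where "Z t = W t + (- a) * T t" for t
        have "ip n d1 Z V = 0" unfolding Z_def[abs_def] ip_lin_left using b by (simp add: a_def b_def)
        moreover have "rfrm g d1 n \<alpha>1 x Z = \<mu> * nrm n d1 Z"
        proof -
          have op: "pencil_op g d1 n \<alpha>1 x Z (i, a) = of_real \<mu> * Z (i, a)" if "i < n" "a < d1" for i a
            using W eT that unfolding Z_def[abs_def] pencil_op_lin by (simp add: eigen_def algebra_simps)
          have "frm g d1 n \<alpha>1 x Z Z = ip n d1 (\<lambda>t. of_real \<mu> * Z t) Z"
            unfolding frm_def by (rule ip_cong) (use op in auto)
          then show ?thesis by (simp add: ip_scale_left ip_nrm)
        qed
        ultimately have "nrm n d1 Z = 0" by (rule orth0)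
        then show ?thesis by (intro exI[of _ a]) (simp add: nrm_zero_iff Z_def)
      qed
      have sc: "eigen g d1 n \<alpha>1 (\<lambda>t. x t / of_real \<mu>) 1 W \<longleftrightarrow> eigen g d1 n \<alpha>1 x (of_real \<mu>) W" for W
        by (rule eigen_tuple_scale) (use \<mu>0 in simp)
      have "p (tup g n (\<lambda>t. x t / of_real \<mu>)) = 0"
      proof (rule van)
        show "herm g n (\<lambda>t. x t / of_real \<mu>)" using herm_scale_real[OF x(1), of "1 / \<mu>"] by simp
        show "rfrm g d1 n \<alpha>1 (\<lambda>t. x t / of_real \<mu>) W \<le> nrm n d1 W" for W
          unfolding rfrm_tuple_scale using T(2)[of W] \<mu>0 by (simp add: \<mu>_def divide_le_eq mult.commute)
        show "simple_kernel g d1 n \<alpha>1 (\<lambda>t. x t / of_real \<mu>) 1"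
          unfolding simple_kernel_def sc using eT uniq by blast
        show "rfrm g d2 n \<alpha>2 (\<lambda>t. x t / of_real \<mu>) W < nrm n d2 W" if W: "0 < nrm n d2 W" for W
        proof -
          have "rfrm g d2 n \<alpha>2 x W \<le> (\<tau> + \<epsilon>) * nrm n d2 W"
            using pert[OF x(2) A(3), of W] \<tau>(2)[of W] by (simp add: algebra_simps)
          also have "\<dots> < \<mu> * nrm n d2 W" using \<mu>(1) \<epsilon>(5) W by (intro mult_strict_right_mono) auto
          finally show ?thesis unfolding rfrm_tuple_scale using \<mu>0 by (simp add: divide_less_eq mult.commute)
        qed
      qed
      moreover have "poly (chp g d1 n \<alpha>1 x) (of_real \<mu>) = 0" using eT by (auto simp: chp_root_iff)
      moreover have "complex_of_real \<mu> \<in> ball 1 r"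
      proof -
        have "dist 1 (complex_of_real \<mu>) = \<bar>1 - \<mu>\<bar>"
          using norm_of_real[of "1 - \<mu>", where 'a = complex] by (simp add: dist_norm)
        then show ?thesis using \<mu> \<epsilon>(3) by simp
      qed
      ultimately show "\<exists>\<mu>\<in>ball 1 r. poly (chp g d1 n \<alpha>1 x) \<mu> = 0 \<and> p (tup g n (\<lambda>t. x t / \<mu>)) = 0" by blast
    qed
  qed
  then obtain e where e: "0 < e" "\<And>x. tdist g n x x0 < e \<Longrightarrow> poly (chp g d1 n \<alpha>1 x) 1 = 0 \<Longrightarrow> p (tup g n x) = 0"
    by blast
  have inj: "p (tup g n z) = 0" if "eigen g d1 n \<alpha>1 z 1 W" "inj_mat n d1 W" for z W
  proof (rule free_locus_curve[OF irr x0(2,3) that p e(1)])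
    fix z' U assume "tdist g n z' x0 < e" "eigen g d1 n \<alpha>1 z' 1 U"
    then show "p (tup g n z') = 0" using e(2) chp_root_iff by blast
  qed
  obtain q y0 where q: "entry_polynomial g n q" "q (tup g n y0) \<noteq> 0"
    "\<And>x \<mu> V. eigen g d1 n \<alpha>1 x \<mu> V \<Longrightarrow> \<mu> \<noteq> 0 \<Longrightarrow> \<not> inj_mat n d1 V \<Longrightarrow> q (tup g n x) = 0"
    using bad_hypersurface[OF irr n(2)] by blast
  show ?thesis
  proof (rule ccontr)
    assume py: "p (tup g n y) \<noteq> 0"
    \<comment> \<open>The line meets the hypersurface of degenerate tuples in finitely many points
      only. Dividing nearby points by an eigenvalue close to 1 returns them to the locus, now with
      injective kernel vectors, and they approach \<open>y\<close>.\<close>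
    let ?l = "line y (\<lambda>t. y0 t - y t)"
    obtain R where R: "\<And>s. q (tup g n (?l s)) = poly R s" using entry_polynomial_line[OF q(1)] by blast
    have "?l 1 = y0" by (auto simp: line_def)
    then have "R \<noteq> 0" using q(2) R[of 1] by auto
    then have "finite {s. poly R s = 0}" by (rule poly_roots_finite)
    then have ev1: "\<forall>\<^sub>F s in at 0. s \<notin> {s. poly R s = 0}" using islimpt_finite islimpt_iff_eventually by blast
    have "((\<lambda>z. p (tup g n (\<lambda>t. fst z t / snd z))) \<longlongrightarrow> p (tup g n (\<lambda>t. y t / 1))) (near g n y \<times>\<^sub>F nhds 1)"
      by (rule entry_polynomial_tendsto[OF p])
        (intro tendsto_divide filterlim_compose[OF tendsto_near_coord filterlim_fst] filterlim_snd, auto)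
    then have "\<forall>\<^sub>F z in near g n y \<times>\<^sub>F nhds 1. p (tup g n (\<lambda>t. fst z t / snd z)) \<noteq> 0"
      by (rule tendsto_imp_eventually_ne) (use py in simp)
    from this[THEN eventually_prod_filter[THEN iffD1]]
    obtain P Q where P: "eventually P (near g n y)" and Q: "eventually Q (nhds (1::complex))"
      and PQ: "\<And>x \<mu>. P x \<Longrightarrow> Q \<mu> \<Longrightarrow> p (tup g n (\<lambda>t. x t / \<mu>)) \<noteq> 0" by auto
    obtain r where r: "0 < r" "\<And>\<mu>. dist \<mu> 1 < r \<Longrightarrow> Q \<mu>" using Q unfolding eventually_nhds_metric by blast
    define r' where "r' = min r 1"
    have r': "0 < r'" using r(1) by (simp add: r'_def)
    have root: "poly (chp g d1 n \<alpha>1 y) 1 = 0" using y by (auto simp: chp_root_iff)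
    have "filterlim ?l (near g n y) (at 0)"
    proof (rule filterlim_near)
      fix t
      have "((\<lambda>s. ?l s t) \<longlongrightarrow> y t + 0 * (y0 t - y t)) (at 0)"
        unfolding line_def by (intro tendsto_intros)
      then show "((\<lambda>s. ?l s t) \<longlongrightarrow> y t) (at 0)" by simp
    qed
    then have "\<forall>\<^sub>F s in at 0. P (?l s) \<and> (\<exists>\<mu>. cmod (1 - \<mu>) < r' \<and> poly (chp g d1 n \<alpha>1 (?l s)) \<mu> = 0)"
      using eventually_conj[OF P chp_root_near_eventually[OF N root r']] unfolding filterlim_iff by blast
    with ev1 have "\<forall>\<^sub>F s in at (0::complex). False"
    proof eventually_elim
      case (elim s)
      then obtain \<mu> where \<mu>: "cmod (1 - \<mu>) < r'" "poly (chp g d1 n \<alpha>1 (?l s)) \<mu> = 0" by blast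
      have \<mu>0: "\<mu> \<noteq> 0" using \<mu>(1) by (auto simp: r'_def)
      obtain W where W: "eigen g d1 n \<alpha>1 (?l s) \<mu> W" using \<mu>(2) chp_root_iff by blast
      have "inj_mat n d1 W" using q(3)[OF W \<mu>0] R[of s] elim(1) by auto
      then have "p (tup g n (\<lambda>t. ?l s t / \<mu>)) = 0"
        using inj[of "\<lambda>t. ?l s t / \<mu>" W] W eigen_tuple_scale[OF \<mu>0] by blast
      moreover have "Q \<mu>" using \<mu>(1) r(2)[of \<mu>] by (simp add: r'_def dist_norm norm_minus_commute)
      ultimately show False using PQ elim(2) by blast
    qed
    then show False by simp
  qed
qed

section \<open>Pencils as matrices\<close>

definition coef :: "complex mat list \<Rightarrow> nat \<Rightarrow> nat \<Rightarrow> nat \<Rightarrow> complex" where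
  "coef A j a b = untup A (j, a, b)"

lemma hermitian_mats_iff:
  "A \<in> hermitian_mats n \<longleftrightarrow> A \<in> carrier_mat n n \<and> (\<forall>r<n. \<forall>c<n. cnj (A $$ (r, c)) = A $$ (c, r))"
proof -
  have entry: "mat_adjoint A $$ (r, c) = cnj (A $$ (c, r))" if "A \<in> carrier_mat n n" "r < n" "c < n" for r c
    using that by (auto simp: mat_adjoint_def mat_of_rows_def)
  have dim: "mat_adjoint A \<in> carrier_mat n n" if "A \<in> carrier_mat n n"
    using that by (auto simp: mat_adjoint_def)
  show ?thesis
  proof
    assume A: "A \<in> hermitian_mats n"
    then have "cnj (A $$ (r, c)) = A $$ (c, r)" if "r < n" "c < n" for r c
      using entry[of c r] that by (simp add: hermitian_mats_def)
    with A show "A \<in> carrier_mat n n \<and> (\<forall>r<n. \<forall>c<n. cnj (A $$ (r, c)) = A $$ (c, r))"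
      by (simp add: hermitian_mats_def)
  next
    assume A: "A \<in> carrier_mat n n \<and> (\<forall>r<n. \<forall>c<n. cnj (A $$ (r, c)) = A $$ (c, r))"
    then have "mat_adjoint A = A"
      using dim entry by (intro eq_matI) auto
    with A show "A \<in> hermitian_mats n" by (simp add: hermitian_mats_def)
  qed
qed

lemma hermitian_tuples_iff: "X \<in> hermitian_tuples g n \<longleftrightarrow> X \<in> mat_tuples g n \<and> herm g n (untup X)"
  by (auto simp: hermitian_tuples_def mat_tuples_def herm_def untup_def hermitian_mats_iff subset_iff in_set_conv_nth)

lemma herm_coeff_coef: "A \<in> hermitian_tuples g d \<Longrightarrow> herm_coeff g d (coef A)"
  by (simp add: hermitian_tuples_iff herm_coeff_def coef_def herm_def)

lemma herm_untup_tup: "herm g n x \<Longrightarrow> herm g n (untup (tup g n x))"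
  by (simp add: herm_def untup_tup)

lemma foldr_add_entry:
  assumes "\<And>M. M \<in> set Ms \<Longrightarrow> M \<in> carrier_mat N N" "r < N" "c < N"
  shows "foldr (+) Ms (0\<^sub>m N N) \<in> carrier_mat N N \<and>
    foldr (+) Ms (0\<^sub>m N N) $$ (r, c) = (\<Sum>j<length Ms. Ms ! j $$ (r, c) :: complex)"
  using assms
proof (induction Ms)
  case (Cons M Ms)
  then have "M \<in> carrier_mat N N" "foldr (+) Ms (0\<^sub>m N N) \<in> carrier_mat N N"
    "foldr (+) Ms (0\<^sub>m N N) $$ (r, c) = (\<Sum>j<length Ms. Ms ! j $$ (r, c))" by auto
  then show ?case using Cons(3,4) by (simp add: sum.lessThan_Suc_shift del: sum.lessThan_Suc)
qed simp

lemma foldr_add_carrier: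
  assumes "\<And>M. M \<in> set Ms \<Longrightarrow> M \<in> carrier_mat N N"
  shows "foldr (+) Ms (0\<^sub>m N N :: complex mat) \<in> carrier_mat N N"
  using assms by (induction Ms) auto

lemma pencil_eval_pmat:
  assumes A: "A \<in> mat_tuples g d" and X: "X \<in> mat_tuples g n"
  shows "pencil_eval d A n X = 1\<^sub>m (d * n) - pmat g d n (coef A) (untup X)"
proof -
  let ?Ms = "map2 kronecker A X"
  have len: "length A = g" "length X = g" using A X by (auto simp: mat_tuples_def)
  have car: "A ! j \<in> carrier_mat d d" "X ! j \<in> carrier_mat n n" if "j < g" for j
    using A X that by (auto simp: mat_tuples_def)
  have Ms: "M \<in> carrier_mat (d * n) (d * n)" if M: "M \<in> set ?Ms" for M
  proof -
    obtain j where "j < g" "M = kronecker (A ! j) (X ! j)" using M len by (auto simp: in_set_conv_nth)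
    then show ?thesis using car[of j] by (auto simp: kronecker_def)
  qed
  have foldr: "foldr (+) ?Ms (0\<^sub>m (d * n) (d * n)) \<in> carrier_mat (d * n) (d * n)"
    by (rule foldr_add_carrier[OF Ms])
  have "foldr (+) ?Ms (0\<^sub>m (d * n) (d * n)) = pmat g d n (coef A) (untup X)"
  proof (rule eq_matI)
    fix r c assume "r < dim_row (pmat g d n (coef A) (untup X))" "c < dim_col (pmat g d n (coef A) (untup X))"
    then have rc: "r < d * n" "c < d * n" by (auto simp: pmat_def)
    have "foldr (+) ?Ms (0\<^sub>m (d * n) (d * n)) $$ (r, c) = (\<Sum>j<length ?Ms. ?Ms ! j $$ (r, c))"
      using foldr_add_entry[OF Ms rc] by blast
    also have "\<dots> = (\<Sum>j<g. coef A j (r div n) (c div n) * untup X (j, r mod n, c mod n))"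
    proof (rule sum.cong)
      show "{..<length ?Ms} = {..<g}" using len by simp
      fix j assume "j \<in> {..<g}"
      then have j: "j < g" by simp
      have "?Ms ! j = kronecker (A ! j) (X ! j)" using j len by simp
      then show "?Ms ! j $$ (r, c) = coef A j (r div n) (c div n) * untup X (j, r mod n, c mod n)"
        using rc carrier_matD[OF car(1)[OF j]] carrier_matD[OF car(2)[OF j]]
        by (simp add: kronecker_def coef_def untup_def)
    qed
    finally show "foldr (+) ?Ms (0\<^sub>m (d * n) (d * n)) $$ (r, c) = pmat g d n (coef A) (untup X) $$ (r, c)"
      using rc by (simp add: pmat_def)
  qed (use carrier_matD[OF foldr] in \<open>auto simp: pmat_def\<close>)
  then show ?thesis by (simp add: pencil_eval_def)
qed

abbreviation lmat :: "nat \<Rightarrow> nat \<Rightarrow> nat \<Rightarrow> (nat \<Rightarrow> nat \<Rightarrow> nat \<Rightarrow> complex) \<Rightarrow> tuple \<Rightarrow> complex mat" where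
  "lmat g d n \<alpha> x \<equiv> 1\<^sub>m (d * n) - pmat g d n \<alpha> x"

lemma lmat_carrier [simp]: "lmat g d n \<alpha> x \<in> carrier_mat (d * n) (d * n)"
  by (rule minus_carrier_mat) simp

lemma lmat_mult_flat: "lmat g d n \<alpha> x *\<^sub>v flat d n V = flat d n (\<lambda>t. V t - pencil_op g d n \<alpha> x V t)"
proof -
  have "lmat g d n \<alpha> x *\<^sub>v flat d n V = 1\<^sub>m (d * n) *\<^sub>v flat d n V - pmat g d n \<alpha> x *\<^sub>v flat d n V"
    by (rule minus_mult_distrib_mat_vec[of _ "d * n" "d * n"]) simp_all
  also have "\<dots> = flat d n V - flat d n (pencil_op g d n \<alpha> x V)"
    by (simp add: pmat_mult_flat)
  also have "\<dots> = flat d n (\<lambda>t. V t - pencil_op g d n \<alpha> x V t)" by (auto simp: flat_def)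
  finally show ?thesis .
qed

lemma lmat_kernel_iff: "lmat g d n \<alpha> x *\<^sub>v flat d n V = 0\<^sub>v (d * n) \<longleftrightarrow>
    (\<forall>i<n. \<forall>a<d. pencil_op g d n \<alpha> x V (i, a) = V (i, a))"
  unfolding lmat_mult_flat flat_zero_iff by auto

lemma det_lmat_zero_iff: "det (lmat g d n \<alpha> x) = 0 \<longleftrightarrow> (\<exists>V. eigen g d n \<alpha> x 1 V)"
proof -
  have "det (lmat g d n \<alpha> x) = 0 \<longleftrightarrow>
      (\<exists>v. v \<in> carrier_vec (d * n) \<and> v \<noteq> 0\<^sub>v (d * n) \<and> lmat g d n \<alpha> x *\<^sub>v v = 0\<^sub>v (d * n))"
    by (rule det_0_iff_vec_prod_zero[OF lmat_carrier])
  also have "\<dots> \<longleftrightarrow> (\<exists>V. eigen g d n \<alpha> x 1 V)"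
  proof
    assume "\<exists>v. v \<in> carrier_vec (d * n) \<and> v \<noteq> 0\<^sub>v (d * n) \<and> lmat g d n \<alpha> x *\<^sub>v v = 0\<^sub>v (d * n)"
    then obtain v where v: "v \<in> carrier_vec (d * n)" "v \<noteq> 0\<^sub>v (d * n)" "lmat g d n \<alpha> x *\<^sub>v v = 0\<^sub>v (d * n)" by blast
    have "flat d n (unflat n v) = v" by (rule flat_unflat[OF v(1)])
    then have "eigen g d n \<alpha> x 1 (unflat n v)"
      using v lmat_kernel_iff[of d n g \<alpha> x "unflat n v"] flat_zero_iff[of d n "unflat n v"]
      by (auto simp: eigen_def)
    then show "\<exists>V. eigen g d n \<alpha> x 1 V" by blast
  next
    assume "\<exists>V. eigen g d n \<alpha> x 1 V"
    then obtain V where "eigen g d n \<alpha> x 1 V" by blast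
    then have "lmat g d n \<alpha> x *\<^sub>v flat d n V = 0\<^sub>v (d * n)" "flat d n V \<noteq> 0\<^sub>v (d * n)"
      using lmat_kernel_iff[of d n g \<alpha> x V] flat_zero_iff[of d n V] by (auto simp: eigen_def)
    then show "\<exists>v. v \<in> carrier_vec (d * n) \<and> v \<noteq> 0\<^sub>v (d * n) \<and> lmat g d n \<alpha> x *\<^sub>v v = 0\<^sub>v (d * n)"
      using flat_carrier by blast
  qed
  finally show ?thesis .
qed

lemma hermitian_lmat:
  assumes "herm_coeff g d \<alpha>" "herm g n x"
  shows "lmat g d n \<alpha> x \<in> hermitian_mats (d * n)"
  unfolding hermitian_mats_iff
proof (intro conjI allI impI lmat_carrier)
  fix r c assume rc: "r < d * n" "c < d * n"
  then show "cnj (lmat g d n \<alpha> x $$ (r, c)) = lmat g d n \<alpha> x $$ (c, r)"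
    using div_mod_bounds[OF rc(1)] div_mod_bounds[OF rc(2)] assms
    by (auto simp: pmat_def herm_coeff_def herm_def)
qed

lemma psd_lmat_iff:
  assumes h: "herm_coeff g d \<alpha>" "herm g n x"
  shows "psd (lmat g d n \<alpha> x) \<longleftrightarrow> (\<forall>V. rfrm g d n \<alpha> x V \<le> nrm n d V)"
proof -
  have q: "(lmat g d n \<alpha> x *\<^sub>v flat d n V) \<bullet>c flat d n V = of_real (nrm n d V) - frm g d n \<alpha> x V V" for V
  proof -
    have "(lmat g d n \<alpha> x *\<^sub>v flat d n V) \<bullet>c flat d n V = ip n d (\<lambda>t. V t + (- 1) * pencil_op g d n \<alpha> x V t) V"
      unfolding lmat_mult_flat ip_flat by simp
    then show ?thesis unfolding ip_lin_left by (simp add: ip_nrm frm_def)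
  qed
  have im: "Im (frm g d n \<alpha> x V V) = 0" for V
    using arg_cong[OF frm_herm[OF h, of V V], of Im] by simp
  have nn: "0 \<le> (lmat g d n \<alpha> x *\<^sub>v flat d n V) \<bullet>c flat d n V \<longleftrightarrow> rfrm g d n \<alpha> x V \<le> nrm n d V" for V
    unfolding q by (auto simp: less_eq_complex_def im)
  have dim: "dim_row (lmat g d n \<alpha> x) = d * n" by (simp add: pmat_def)
  show ?thesis
  proof
    assume "psd (lmat g d n \<alpha> x)"
    then show "\<forall>V. rfrm g d n \<alpha> x V \<le> nrm n d V"
      unfolding psd_def dim using nn flat_carrier by blast
  next
    assume le: "\<forall>V. rfrm g d n \<alpha> x V \<le> nrm n d V"
    have "0 \<le> (lmat g d n \<alpha> x *\<^sub>v v) \<bullet>c v" if v: "v \<in> carrier_vec (d * n)" for v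
      using nn[of "unflat n v"] le unfolding flat_unflat[OF v] by blast
    then show "psd (lmat g d n \<alpha> x)" unfolding psd_def dim using hermitian_lmat[OF h] by blast
  qed
qed

lemma kernel_dim_lmat_one:
  assumes "simple_kernel g d n \<alpha> x 1"
  shows "kernel_dim (lmat g d n \<alpha> x) = 1"
proof -
  let ?N = "d * n" and ?L = "lmat g d n \<alpha> x"
  obtain V where V: "eigen g d n \<alpha> x 1 V"
    "\<And>W. eigen g d n \<alpha> x 1 W \<Longrightarrow> \<exists>c. \<forall>i<n. \<forall>a<d. W (i, a) = c * V (i, a)"
    using assms by (auto simp: simple_kernel_def)
  interpret K: kernel ?N ?N ?L by unfold_locales (rule lmat_carrier)
  let ?v = "flat d n V"
  have v0: "?v \<noteq> 0\<^sub>v ?N" using V(1) by (auto simp: eigen_def flat_zero_iff)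
  have vk: "?v \<in> mat_kernel ?L"
    using V(1) lmat_kernel_iff[of d n g \<alpha> x V] by (auto simp: mat_kernel[OF lmat_carrier] eigen_def)
  have mult: "\<exists>c. w = c \<cdot>\<^sub>v ?v" if w: "w \<in> mat_kernel ?L" for w
  proof (cases "w = 0\<^sub>v ?N")
    case True
    then show ?thesis by (intro exI[of _ 0]) (auto simp: flat_def)
  next
    case False
    have wc: "w \<in> carrier_vec ?N" "?L *\<^sub>v w = 0\<^sub>v ?N" using mat_kernelD[OF lmat_carrier w] by auto
    have fw: "flat d n (unflat n w) = w" by (rule flat_unflat[OF wc(1)])
    have "eigen g d n \<alpha> x 1 (unflat n w)"
      using wc(2) False lmat_kernel_iff[of d n g \<alpha> x "unflat n w"] flat_zero_iff[of d n "unflat n w"] fw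
      by (auto simp: eigen_def)
    then obtain c where "\<forall>i<n. \<forall>a<d. unflat n w (i, a) = c * V (i, a)" using V(2) by blast
    then have "flat d n (unflat n w) = c \<cdot>\<^sub>v ?v" unfolding smult_flat by (auto intro: flat_cong)
    then show ?thesis using fw by auto
  qed
  have "K.Ker.span {?v} = mat_kernel ?L"
  proof -
    have sub: "{?v} \<subseteq> mat_kernel ?L" using vk by simp
    have "K.Ker.span {?v} \<subseteq> mat_kernel ?L" using K.Ker.span_is_subset2[of "{?v}"] sub by auto
    moreover have "mat_kernel ?L \<subseteq> K.Ker.span {?v}"
    proof
      fix w assume "w \<in> mat_kernel ?L"
      then obtain c where c: "w = c \<cdot>\<^sub>v ?v" using mult by blast
      have "K.Ker.lincomb (\<lambda>_. c) {?v} = c \<cdot>\<^sub>v ?v"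
        by (subst K.Ker.lincomb_insert2[of "{}" "\<lambda>_. c" ?v, simplified]) (use vk in \<open>auto simp: K.Ker.lincomb_def\<close>)
      then have "w = K.Ker.lincomb (\<lambda>_. c) {?v}" using c by simp
      then show "w \<in> K.Ker.span {?v}" unfolding K.Ker.span_def
        by (intro CollectI exI[of _ "\<lambda>_. c"] exI[of _ "{?v}"]) simp
    qed
    ultimately show ?thesis by auto
  qed
  then have "K.Ker.dim = 1" by (rule K.Ker.dim1I) (use v0 vk in auto)
  then show ?thesis by simp
qed

lemma det_zero_if_kernel_dim:
  assumes "kernel_dim (lmat g d n \<alpha> x) = 1"
  shows "det (lmat g d n \<alpha> x) = 0"
proof (rule ccontr)
  let ?N = "d * n" and ?L = "lmat g d n \<alpha> x"
  assume "det ?L \<noteq> 0"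
  then have 0: "\<not> (\<exists>v. v \<in> carrier_vec ?N \<and> v \<noteq> 0\<^sub>v ?N \<and> ?L *\<^sub>v v = 0\<^sub>v ?N)"
    using det_0_iff_vec_prod_zero[OF lmat_carrier] by blast
  interpret K: kernel ?N ?N ?L by unfold_locales (rule lmat_carrier)
  have ker: "mat_kernel ?L = {0\<^sub>v ?N}"
  proof -
    have z: "0\<^sub>v ?N = flat d n (\<lambda>_. 0)" by (auto simp: flat_def)
    have "?L *\<^sub>v flat d n (\<lambda>_. 0) = 0\<^sub>v ?N"
      unfolding lmat_kernel_iff by (simp add: pencil_op_def)
    then have "?L *\<^sub>v 0\<^sub>v ?N = 0\<^sub>v ?N" unfolding z[symmetric] .
    then show ?thesis using 0 by (auto simp: mat_kernel[OF lmat_carrier])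
  qed
  have "K.Ker.basis {}"
    unfolding K.Ker.basis_def
  proof (intro conjI)
    show "K.Ker.lin_indpt {}" by (rule K.Ker.finite_lin_indpt2) auto
    show "K.Ker.span {} = mat_kernel ?L" by (rule trans[OF K.Ker.span_empty ker[symmetric]])
  qed simp
  then have "K.Ker.dim = 0" using K.Ker.dim_basis[of "{}"] by simp
  then show False using assms by simp
qed

text \<open>The closure of \<open>S\<close> is the common zero set of some polynomials; each of them
  vanishes on \<open>S\<close>, hence by \<open>van\<close> on \<open>Z\<close>.\<close>

lemma zariski_dense_inI:
  assumes sub: "S \<subseteq> Z" and Z: "Z \<subseteq> mat_tuples g n"
    and van: "\<And>p X. entry_polynomial g n p \<Longrightarrow> (\<And>Y. Y \<in> S \<Longrightarrow> p Y = 0) \<Longrightarrow> X \<in> Z \<Longrightarrow> p X = 0"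
  shows "zariski_dense_in g n S Z"
proof -
  let ?T = "zariski_topology g n"
  have "closedin ?T (?T closure_of S)" by simp
  then obtain P where P: "P \<subseteq> Collect (entry_polynomial g n)" "?T closure_of S = zero_set g n P"
    unfolding closedin_zariski by blast
  have "S \<subseteq> ?T closure_of S" using sub Z by (intro closure_of_subset) simp
  then have "p Y = 0" if "p \<in> P" "Y \<in> S" for p Y using that P(2) by (auto simp: zero_set_def)
  then have "Z \<subseteq> ?T closure_of S"
    unfolding P(2) zero_set_def using van P(1) Z by blast
  then have "subtopology ?T Z closure_of S = Z"
    using sub by (simp add: closure_of_subtopology Int_absorb1 Int_absorb2)
  then show ?thesis using sub by (simp add: zariski_dense_in_def)
qed

section \<open>Splitting off an invariant subspace\<close>

text \<open>For an orthonormal list, \<open>coords\<close> applies the adjoint of the isometry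
  \<open>lift us\<close> to every row, and \<open>embed\<close> applies the isometry itself.\<close>

definition coords :: "nat \<Rightarrow> (nat \<Rightarrow> complex) list \<Rightarrow> (nat \<times> nat \<Rightarrow> complex) \<Rightarrow> nat \<times> nat \<Rightarrow> complex" where
  "coords d us V = (\<lambda>(i, c). \<Sum>a<d. V (i, a) * cnj ((us ! c) a))"

definition embed :: "(nat \<Rightarrow> complex) list \<Rightarrow> (nat \<times> nat \<Rightarrow> complex) \<Rightarrow> nat \<times> nat \<Rightarrow> complex" where
  "embed us V = (\<lambda>(i, a). \<Sum>c<length us. V (i, c) * (us ! c) a)"

definition rowv :: "nat \<Rightarrow> (nat \<times> nat \<Rightarrow> complex) \<Rightarrow> nat \<Rightarrow> nat \<Rightarrow> complex" where
  "rowv d V i = (\<lambda>a. if a < d then V (i, a) else 0)"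

lemma rowv_vecs [simp]: "rowv d V i \<in> vecs d"
  by (simp add: rowv_def vecs_def)

lemma coords_cinner: "coords d us V (i, c) = cinner d (rowv d V i) (us ! c)"
  by (simp add: coords_def cinner_def rowv_def)

lemma rowv_pencil_op:
  "rowv d (pencil_op g d n \<alpha> x V) i = (\<Sum>j<g. \<Sum>k<n. scale_fun (x (j, i, k)) (act d (\<alpha> j) (rowv d V k)))"
  by (auto simp: fun_eq_iff rowv_def pencil_op_def sum_fun_apply scale_fun_def act_def sum_distrib_left mult.assoc)

text \<open>Projection to \<open>W\<close> commutes with the coefficients: A_j is hermitian, so it
  can be moved onto the basis vector \<open>us ! c\<close>, and invariance keeps the result in
  \<open>W\<close>.\<close>

lemma coords_pencil_op:
  assumes h: "herm_coeff g d \<alpha>" and us: "onb d us W" and W: "invariant g d \<alpha> W" and c: "c < length us"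
  shows "coords d us (pencil_op g d n \<alpha> x V) (i, c) =
    pencil_op g (length us) n (compress d us \<alpha>) x (coords d us V) (i, c)"
proof -
  have usW: "us ! c \<in> W" using us c by (auto simp: onb_def)
  have step: "cinner d (act d (\<alpha> j) v) (us ! c) = (\<Sum>e<length us. compress d us \<alpha> j c e * cinner d v (us ! e))"
    if j: "j < g" for j v
  proof -
    have "act d (\<alpha> j) (us ! c) \<in> W" using W usW j by (auto simp: invariant_def)
    then have "act d (\<alpha> j) (us ! c) = proj d us (act d (\<alpha> j) (us ! c))" using us by (auto simp: onb_def)
    then have "cinner d (act d (\<alpha> j) (us ! c)) v = cinner d (proj d us (act d (\<alpha> j) (us ! c))) v" by simp
    also have "\<dots> = (\<Sum>e<length us. compress d us \<alpha> j e c * cinner d (us ! e) v)"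
      by (simp add: proj_def cinner_sum_left cinner_scale_left compress_def)
    finally have "cinner d v (act d (\<alpha> j) (us ! c)) = (\<Sum>e<length us. cnj (compress d us \<alpha> j e c) * cnj (cinner d (us ! e) v))"
      by (subst cinner_commute) simp
    also have "\<dots> = (\<Sum>e<length us. compress d us \<alpha> j c e * cinner d v (us ! e))"
    proof (rule sum.cong[OF refl])
      fix e assume "e \<in> {..<length us}"
      then have "cnj (compress d us \<alpha> j e c) = compress d us \<alpha> j c e"
        using herm_compress[OF h, of us] j c by (simp add: herm_coeff_def)
      then show "cnj (compress d us \<alpha> j e c) * cnj (cinner d (us ! e) v) = compress d us \<alpha> j c e * cinner d v (us ! e)"
        using cinner_commute[of d v "us ! e"] by simp
    qed
    finally show ?thesis using cinner_act_herm[OF h j] by simp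
  qed
  have "coords d us (pencil_op g d n \<alpha> x V) (i, c)
      = (\<Sum>j<g. \<Sum>k<n. x (j, i, k) * cinner d (act d (\<alpha> j) (rowv d V k)) (us ! c))"
    unfolding coords_cinner rowv_pencil_op by (simp add: cinner_sum_left cinner_scale_left)
  also have "\<dots> = (\<Sum>j<g. \<Sum>k<n. x (j, i, k) * (\<Sum>e<length us. compress d us \<alpha> j c e * coords d us V (k, e)))"
    using step by (simp add: coords_cinner)
  finally show ?thesis by (simp add: pencil_op_def sum_distrib_left mult.assoc)
qed

text \<open>\<open>\<alpha>1\<close> is the component under study and \<open>\<alpha>2\<close>
  collects everything orthogonal to it. The complement may be zero, with
  \<open>d2 = 0\<close>.\<close>

locale splitting =
  fixes g d :: nat and \<alpha> :: "nat \<Rightarrow> nat \<Rightarrow> nat \<Rightarrow> complex" and W :: "(nat \<Rightarrow> complex) set"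
    and us us' :: "(nat \<Rightarrow> complex) list"
  assumes h: "herm_coeff g d \<alpha>" and W: "invariant g d \<alpha> W"
    and us: "onb d us W" and us': "onb d us' (perp d W)"
begin

abbreviation "d1 \<equiv> length us"
abbreviation "d2 \<equiv> length us'"
abbreviation "\<alpha>1 \<equiv> compress d us \<alpha>"
abbreviation "\<alpha>2 \<equiv> compress d us' \<alpha>"

lemma W': "invariant g d \<alpha> (perp d W)"
  by (rule invariant_perp[OF h W])

lemma h1: "herm_coeff g d1 \<alpha>1" and h2: "herm_coeff g d2 \<alpha>2"
  by (rule herm_compress[OF h])+

lemma usd: "set us \<subseteq> W" "W \<subseteq> vecs d" "set us' \<subseteq> perp d W" "onf d us" "onf d us'" "fv.subspace W"
  using us us' W by (auto simp: onb_def invariant_def)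

lemma orth: "c < d1 \<Longrightarrow> c' < d2 \<Longrightarrow> cinner d (us' ! c') (us ! c) = 0"
proof -
  assume "c < d1" "c' < d2"
  then have "us ! c \<in> W" "us' ! c' \<in> perp d W" using usd(1,3) nth_mem by blast+
  then show ?thesis by (simp add: perp_def)
qed

lemma orth': "c < d1 \<Longrightarrow> c' < d2 \<Longrightarrow> cinner d (us ! c) (us' ! c') = 0"
  using orth by (subst cinner_commute) simp

lemma decompose:
  assumes v: "v \<in> vecs d"
  shows "v = proj d us v + proj d us' v"
proof -
  define r where "r = v - proj d us v"
  have pW: "proj d us v \<in> W" by (rule proj_in[OF usd(6,1)])
  have rv: "r \<in> vecs d" unfolding r_def using v pW usd(2) subspace_vecs by (intro fv.subspace_diff) auto
  have r0: "cinner d r (us ! c) = 0" if "c < d1" for c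
    using cinner_proj[OF usd(4) that] by (simp add: r_def cinner_diff_left)
  have "cinner d r w = 0" if w: "w \<in> W" for w
  proof -
    have "cinner d w r = cinner d (proj d us w) r" using us w by (auto simp: onb_def intro: arg_cong)
    also have "\<dots> = (\<Sum>c<d1. cinner d w (us ! c) * cinner d (us ! c) r)"
      by (simp add: proj_def cinner_sum_left cinner_scale_left)
    also have "\<dots> = 0"
    proof (rule sum.neutral, clarify)
      fix c assume "c < d1"
      then have "cinner d (us ! c) r = 0" using r0 by (subst cinner_commute) simp
      then show "cinner d w (us ! c) * cinner d (us ! c) r = 0" by simp
    qed
    finally show ?thesis by (subst cinner_commute) simp
  qed
  then have "r \<in> perp d W" using rv by (simp add: perp_def)
  then have "r = proj d us' r" using us' by (auto simp: onb_def)
  moreover have "cinner d r (us' ! c) = cinner d v (us' ! c)" if "c < d2" for c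
  proof -
    have "us' ! c \<in> perp d W" using usd(3) that by auto
    then have "cinner d (us' ! c) (proj d us v) = 0" using pW by (auto simp: perp_def)
    then have "cinner d (proj d us v) (us' ! c) = 0" by (subst cinner_commute) simp
    then show ?thesis by (simp add: r_def cinner_diff_left)
  qed
  then have "proj d us' r = proj d us' v" unfolding proj_def by (intro sum.cong) auto
  ultimately have "r = proj d us' v" by simp
  then show ?thesis by (simp add: r_def algebra_simps)
qed

lemma parseval: "ip n d V U = ip n d1 (coords d us V) (coords d us U) + ip n d2 (coords d us' V) (coords d us' U)"
proof -
  have row: "cinner d (rowv d V i) (rowv d U i) =
      (\<Sum>c<d1. coords d us V (i, c) * cnj (coords d us U (i, c))) + (\<Sum>c<d2. coords d us' V (i, c) * cnj (coords d us' U (i, c)))" for i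
  proof -
    have "cinner d (rowv d V i) (rowv d U i) = cinner d (proj d us (rowv d V i) + proj d us' (rowv d V i)) (rowv d U i)"
      by (rule arg_cong[OF decompose]) simp
    also have "\<dots> = (\<Sum>c<d1. cinner d (rowv d V i) (us ! c) * cinner d (us ! c) (rowv d U i)) +
        (\<Sum>c<d2. cinner d (rowv d V i) (us' ! c) * cinner d (us' ! c) (rowv d U i))"
      by (simp add: cinner_add_left proj_def cinner_sum_left cinner_scale_left)
    finally show ?thesis unfolding coords_cinner cinner_commute[of d "us ! _" "rowv d U i"] cinner_commute[of d "us' ! _" "rowv d U i"] .
  qed
  have "ip n d V U = (\<Sum>i<n. cinner d (rowv d V i) (rowv d U i))"
    by (simp add: ip_def cinner_def rowv_def)
  then show ?thesis by (simp add: row sum.distrib ip_def)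
qed

lemma nrm_split: "nrm n d V = nrm n d1 (coords d us V) + nrm n d2 (coords d us' V)"
proof -
  have "complex_of_real (nrm n d V) = of_real (nrm n d1 (coords d us V) + nrm n d2 (coords d us' V))"
    unfolding of_real_add ip_nrm[symmetric] by (rule parseval)
  then show ?thesis by (simp only: of_real_eq_iff)
qed

lemma rfrm_split: "rfrm g d n \<alpha> x V = rfrm g d1 n \<alpha>1 x (coords d us V) + rfrm g d2 n \<alpha>2 x (coords d us' V)"
proof -
  have "ip n d1 (coords d us (pencil_op g d n \<alpha> x V)) (coords d us V) = frm g d1 n \<alpha>1 x (coords d us V) (coords d us V)"
    unfolding frm_def by (rule ip_cong) (simp_all add: coords_pencil_op[OF h us W])
  moreover have "ip n d2 (coords d us' (pencil_op g d n \<alpha> x V)) (coords d us' V) = frm g d2 n \<alpha>2 x (coords d us' V) (coords d us' V)"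
    unfolding frm_def by (rule ip_cong) (simp_all add: coords_pencil_op[OF h us' W'])
  ultimately show ?thesis unfolding frm_def[of g d] parseval by simp
qed

lemma rowv_embed: "set us0 \<subseteq> vecs d \<Longrightarrow> rowv d (embed us0 V) i = lift us0 (\<lambda>c. V (i, c))"
proof
  fix a assume us0: "set us0 \<subseteq> vecs d"
  show "rowv d (embed us0 V) i a = lift us0 (\<lambda>c. V (i, c)) a"
  proof (cases "a < d")
    case False
    then have "(us0 ! c) a = 0" if "c < length us0" for c using us0 nth_mem[OF that] by (auto simp: vecs_def)
    then show ?thesis using False by (simp add: rowv_def lift_def sum_fun_apply scale_fun_def)
  qed (simp add: rowv_def embed_def lift_def sum_fun_apply scale_fun_def)
qed

lemma us_vecs: "set us \<subseteq> vecs d" "set us' \<subseteq> vecs d"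
  using usd(1-3) by (auto simp: perp_def)

lemma coords_embed: "c < d1 \<Longrightarrow> coords d us (embed us V) (i, c) = V (i, c)"
  "c < d2 \<Longrightarrow> coords d us' (embed us V) (i, c) = 0"
  "c < d2 \<Longrightarrow> coords d us' (embed us' V) (i, c) = V (i, c)"
  "c < d1 \<Longrightarrow> coords d us (embed us' V) (i, c) = 0"
  unfolding coords_cinner rowv_embed[OF us_vecs(1)] rowv_embed[OF us_vecs(2)]
  using cinner_lift[OF usd(4)] cinner_lift[OF usd(5)] orth orth'
  by (auto simp: lift_def cinner_sum_left cinner_scale_left)

lemma rfrm_embed2: "rfrm g d n \<alpha> x (embed us' V) = rfrm g d2 n \<alpha>2 x V" "nrm n d (embed us' V) = nrm n d2 V"
proof -
  have "nrm n d1 (coords d us (embed us' V)) = 0" by (simp add: nrm_zero_iff coords_embed)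
  moreover have "nrm n d2 (coords d us' (embed us' V)) = nrm n d2 V" by (rule nrm_cong) (simp add: coords_embed)
  moreover have "frm g d2 n \<alpha>2 x (coords d us' (embed us' V)) (coords d us' (embed us' V)) = frm g d2 n \<alpha>2 x V V"
    by (rule frm_cong) (simp add: coords_embed)
  ultimately show "rfrm g d n \<alpha> x (embed us' V) = rfrm g d2 n \<alpha>2 x V" "nrm n d (embed us' V) = nrm n d2 V"
    by (simp_all add: rfrm_split[of n x "embed us' V"] nrm_split[of n "embed us' V"] rfrm_zero)
qed

lemma eq_if_coords_eq:
  assumes "\<And>i c. i < n \<Longrightarrow> c < d1 \<Longrightarrow> coords d us V (i, c) = coords d us U (i, c)"
    and "\<And>i c. i < n \<Longrightarrow> c < d2 \<Longrightarrow> coords d us' V (i, c) = coords d us' U (i, c)" and ia: "i < n" "a < d"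
  shows "V (i, a) = U (i, a)"
proof -
  have "rowv d V i = proj d us (rowv d V i) + proj d us' (rowv d V i)" by (rule decompose) simp
  also have "\<dots> = proj d us (rowv d U i) + proj d us' (rowv d U i)"
    using assms(1,2)[OF ia(1)] by (simp add: proj_def coords_cinner)
  also have "\<dots> = rowv d U i" by (rule decompose[symmetric]) simp
  finally have "rowv d V i a = rowv d U i a" by simp
  then show ?thesis using ia by (simp add: rowv_def)
qed

lemma eigen_embed:
  assumes V: "eigen g d1 n \<alpha>1 x 1 V"
  shows "eigen g d n \<alpha> x 1 (embed us V)"
proof -
  have "pencil_op g d n \<alpha> x (embed us V) (i, a) = embed us V (i, a)" if "i < n" "a < d" for i a
  proof (rule eq_if_coords_eq[OF _ _ that])
    fix i c assume "i < n" "c < d1"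
    have "pencil_op g d1 n \<alpha>1 x (coords d us (embed us V)) = pencil_op g d1 n \<alpha>1 x V"
      by (rule pencil_op_cong) (simp add: coords_embed)
    then show "coords d us (pencil_op g d n \<alpha> x (embed us V)) (i, c) = coords d us (embed us V) (i, c)"
      using V \<open>i < n\<close> \<open>c < d1\<close> by (simp add: coords_pencil_op[OF h us W] coords_embed eigen_def)
  next
    fix i c assume "i < n" "c < d2"
    have "pencil_op g d2 n \<alpha>2 x (coords d us' (embed us V)) = pencil_op g d2 n \<alpha>2 x (\<lambda>_. 0)"
      by (rule pencil_op_cong) (simp add: coords_embed)
    then show "coords d us' (pencil_op g d n \<alpha> x (embed us V)) (i, c) = coords d us' (embed us V) (i, c)"
      using \<open>c < d2\<close> by (simp add: coords_pencil_op[OF h us' W'] coords_embed) (simp add: pencil_op_def)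
  qed
  moreover have "\<exists>i<n. \<exists>a<d. embed us V (i, a) \<noteq> 0"
  proof (rule ccontr)
    assume n: "\<not> ?thesis"
    obtain i c where ic: "i < n" "c < d1" "V (i, c) \<noteq> 0" using V by (auto simp: eigen_def)
    have "coords d us (embed us V) (i, c) = 0" using n ic(1) by (simp add: coords_def)
    then show False using coords_embed(1)[OF ic(2), of V i] ic(3) by simp
  qed
  ultimately show ?thesis by (simp add: eigen_def)
qed

lemma eigen_coords:
  assumes V: "eigen g d n \<alpha> x 1 V" and nz: "i < n" "c < d1" "coords d us V (i, c) \<noteq> 0"
  shows "eigen g d1 n \<alpha>1 x 1 (coords d us V)"
proof -
  have "pencil_op g d1 n \<alpha>1 x (coords d us V) (i, c) = coords d us V (i, c)" if "i < n" "c < d1" for i c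
  proof -
    have "coords d us (pencil_op g d n \<alpha> x V) (i, c) = coords d us V (i, c)"
      using V that by (simp add: coords_def eigen_def)
    then show ?thesis using that by (simp add: coords_pencil_op[OF h us W])
  qed
  then show ?thesis using nz by (auto simp: eigen_def)
qed

text \<open>At a kernel vector of the whole pencil the form equals the squared norm, whereas a
  component in the complement would make it strictly smaller. So all kernel vectors come from the
  first component.\<close>

lemma boundary_of_splitting:
  assumes x: "herm g n x" and le: "\<And>V. rfrm g d1 n \<alpha>1 x V \<le> nrm n d1 V" and s: "simple_kernel g d1 n \<alpha>1 x 1"
    and lt: "\<And>V. 0 < nrm n d2 V \<Longrightarrow> rfrm g d2 n \<alpha>2 x V < nrm n d2 V"
  shows "rfrm g d n \<alpha> x V \<le> nrm n d V" "simple_kernel g d n \<alpha> x 1"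
proof -
  have le2: "rfrm g d2 n \<alpha>2 x V \<le> nrm n d2 V" for V
    using lt[of V] rfrm_zero[of n d2 V] nrm_nonneg[of n d2 V] by (metis less_eq_real_def)
  show "rfrm g d n \<alpha> x V \<le> nrm n d V" for V
    unfolding rfrm_split nrm_split by (intro add_mono le le2)
  obtain V0 where V0: "eigen g d1 n \<alpha>1 x 1 V0"
    "\<And>U. eigen g d1 n \<alpha>1 x 1 U \<Longrightarrow> \<exists>c. \<forall>i<n. \<forall>a<d1. U (i, a) = c * V0 (i, a)"
    using s by (auto simp: simple_kernel_def)
  have "\<exists>c. \<forall>i<n. \<forall>a<d. U (i, a) = c * embed us V0 (i, a)" if U: "eigen g d n \<alpha> x 1 U" for U
  proof -
    have "nrm n d2 (coords d us' U) = 0"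
    proof (rule ccontr)
      assume "nrm n d2 (coords d us' U) \<noteq> 0"
      then have "0 < nrm n d2 (coords d us' U)" using nrm_nonneg[of n d2 "coords d us' U"] by linarith
      from lt[OF this] le[of "coords d us U"] have "rfrm g d n \<alpha> x U < nrm n d U"
        unfolding rfrm_split nrm_split by linarith
      moreover have "rfrm g d n \<alpha> x U = nrm n d U" using eigen_rfrm[of g d n \<alpha> x 1 U] U by simp
      ultimately show False by simp
    qed
    then have U2: "coords d us' U (i, c) = 0" if "i < n" "c < d2" for i c using that by (simp add: nrm_zero_iff)
    have "\<exists>i<n. \<exists>c<d1. coords d us U (i, c) \<noteq> 0"
    proof (rule ccontr)
      assume n: "\<not> ?thesis"
      then have "nrm n d1 (coords d us U) = 0" by (simp add: nrm_zero_iff)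
      moreover have "nrm n d2 (coords d us' U) = 0" using U2 by (simp add: nrm_zero_iff)
      ultimately have "nrm n d U = 0" by (simp add: nrm_split)
      then show False using U by (auto simp: eigen_def nrm_zero_iff)
    qed
    then obtain c where c: "\<forall>i<n. \<forall>a<d1. coords d us U (i, a) = c * V0 (i, a)"
      using V0(2) eigen_coords[OF U] by blast
    have "U (i, a) = (\<lambda>t. c * embed us V0 t) (i, a)" if "i < n" "a < d" for i a
    proof (rule eq_if_coords_eq[OF _ _ that])
      have sc: "coords d vs (\<lambda>t. c * embed us V0 t) (i, e) = c * coords d vs (embed us V0) (i, e)" for vs i e
        by (simp add: coords_def sum_distrib_left mult.assoc)
      show "coords d us U (i, e) = coords d us (\<lambda>t. c * embed us V0 t) (i, e)" if "i < n" "e < d1" for i e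
        unfolding sc using that c by (simp add: coords_embed)
      show "coords d us' U (i, e) = coords d us' (\<lambda>t. c * embed us V0 t) (i, e)" if "i < n" "e < d2" for i e
        unfolding sc using that U2 by (simp add: coords_embed)
    qed
    then show ?thesis by blast
  qed
  then show "simple_kernel g d n \<alpha> x 1" using eigen_embed[OF V0(1)] by (auto simp: simple_kernel_def)
qed

text \<open>Both lists together are orthonormal. For positive \<open>d1\<close> the complement is
  thus strictly smaller than the given pencil, which is what minimality is played against.\<close>

lemma dims: "d1 + d2 \<le> d"
proof -
  have "onf d (us @ us')"
    unfolding onf_def
  proof (intro allI impI)
    fix i j assume ij: "i < length (us @ us')" "j < length (us @ us')"
    then show "cinner d ((us @ us') ! i) ((us @ us') ! j) = (if i = j then 1 else 0)"
      using usd(4,5) orth orth' by (auto simp: nth_append onf_def)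
  qed
  moreover have "set (us @ us') \<subseteq> vecs d" using us_vecs by auto
  ultimately show ?thesis using onf_length_le[of d "us @ us'"] by simp
qed

end

section \<open>Density of the boundary\<close>

text \<open>Polarisation: the form at V + \<theta> U for \<theta> = 1 and \<theta> = \<i> isolates
  the real and the imaginary part of the mixed term.\<close>

lemma herm_form_zero:
  assumes h: "herm_coeff g d \<alpha>" "herm g n x" and z: "\<And>V. rfrm g d n \<alpha> x V = 0"
  shows "frm g d n \<alpha> x U V = 0"
proof -
  have "Re (\<theta> * frm g d n \<alpha> x U V) = 0" for \<theta>
  proof -
    have "frm g d n \<alpha> x (\<lambda>t. V t + \<theta> * U t) (\<lambda>t. V t + \<theta> * U t) =
      frm g d n \<alpha> x V V + (\<theta> * cnj \<theta>) * frm g d n \<alpha> x U U + \<theta> * frm g d n \<alpha> x U V + cnj (\<theta> * frm g d n \<alpha> x U V)"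
      unfolding frm_lin_left frm_lin_right using frm_herm[OF h, of V U] by (simp add: algebra_simps)
    also have "\<theta> * cnj \<theta> = of_real ((cmod \<theta>)\<^sup>2)" by (simp only: complex_norm_square)
    finally show ?thesis using z[of "\<lambda>t. V t + \<theta> * U t"] z[of U] z[of V] by simp
  qed
  from this[of 1] this[of "\<i>"] show ?thesis by (simp add: complex_eq_iff)
qed

text \<open>If all hermitian tuples of size 1 satisfied the inequality, scaling a unit tuple by
  arbitrary reals would force its form to vanish, and with it the coefficient. This supplies the
  violating tuple when there is no complement.\<close>

lemma nonzero_coeff_violation:
  assumes h: "herm_coeff g d \<alpha>" and nz: "j < g" "a < d" "b < d" "\<alpha> j a b \<noteq> 0"
  shows "\<exists>x V. herm g 1 x \<and> nrm 1 d V < rfrm g d 1 \<alpha> x V"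
proof (rule ccontr)
  assume "\<not> ?thesis"
  then have le: "rfrm g d 1 \<alpha> x V \<le> nrm 1 d V" if "herm g 1 x" for x V
    using that linorder_not_less by blast
  define e :: tuple where "e t = (if t = (j, 0, 0) then 1 else 0)" for t
  have e: "herm g 1 e" by (simp add: herm_def e_def)
  have z: "rfrm g d 1 \<alpha> e V = 0" for V
  proof (rule ccontr)
    assume n: "rfrm g d 1 \<alpha> e V \<noteq> 0"
    define s where "s = (nrm 1 d V + 1) / rfrm g d 1 \<alpha> e V"
    have "rfrm g d 1 \<alpha> (\<lambda>t. of_real s * e t) V = nrm 1 d V + 1"
      unfolding frm_tuple_scale using n by (simp add: s_def)
    with le[OF herm_scale_real[OF e], of s V] show False by simp
  qed
  define u :: "nat \<Rightarrow> nat \<times> nat \<Rightarrow> complex" where "u c t = (if t = (0, c) then 1 else 0)" for c t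
  have "pencil_op g d 1 \<alpha> e (u b) (0, a') = \<alpha> j a' b" for a'
  proof -
    have "pencil_op g d 1 \<alpha> e (u b) (0, a') = (\<Sum>j'<g. \<Sum>b'<d. e (j', 0, 0) * \<alpha> j' a' b' * u b (0, b'))"
      by (simp add: pencil_op_def)
    also have "\<dots> = (\<Sum>j'<g. if j' = j then \<Sum>b'<d. if b' = b then \<alpha> j a' b else 0 else 0)"
    proof (rule sum.cong[OF refl])
      fix j'
      show "(\<Sum>b'<d. e (j', 0, 0) * \<alpha> j' a' b' * u b (0, b')) =
          (if j' = j then \<Sum>b'<d. if b' = b then \<alpha> j a' b else 0 else 0)"
      proof (cases "j' = j")
        case True
        show ?thesis unfolding True if_P[OF refl] by (rule sum.cong) (auto simp: e_def u_def)
      qed (simp add: e_def)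
    qed
    finally show ?thesis using nz by simp
  qed
  then have "frm g d 1 \<alpha> e (u b) (u a) = (\<Sum>a'<d. \<alpha> j a' b * cnj (u a (0, a')))"
    by (simp add: frm_def ip_def)
  also have "\<dots> = (\<Sum>a'<d. if a' = a then \<alpha> j a b else 0)"
    by (rule sum.cong) (auto simp: u_def)
  also have "\<dots> = \<alpha> j a b" using nz by simp
  finally show False using herm_form_zero[OF h e z, of "u b" "u a"] nz by simp
qed

lemma psd_pencil_iff:
  assumes "A \<in> hermitian_tuples g d" "X \<in> hermitian_tuples g n"
  shows "psd (pencil_eval d A n X) \<longleftrightarrow> (\<forall>V. rfrm g d n (coef A) (untup X) V \<le> nrm n d V)"
proof -
  have "A \<in> mat_tuples g d" "X \<in> mat_tuples g n" "herm g n (untup X)"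
    using assms by (auto simp: hermitian_tuples_iff)
  then show ?thesis
    using psd_lmat_iff[OF herm_coeff_coef[OF assms(1)]] by (simp only: pencil_eval_pmat)
qed

lemma rfrm_coeff_cong:
  assumes "\<And>j a b. j < g \<Longrightarrow> a < d \<Longrightarrow> b < d \<Longrightarrow> \<alpha> j a b = \<beta> j a b"
  shows "rfrm g d n \<alpha> x V = rfrm g d n \<beta> x V"
proof -
  have "frm g d n \<alpha> x V V = frm g d n \<beta> x V V"
    unfolding frm_def pencil_op_def by (rule ip_cong) (auto simp: assms intro!: sum.cong)
  then show ?thesis by simp
qed

lemma rfrm_tuple_cong:
  assumes "\<And>t. t \<in> idx g n \<Longrightarrow> x t = y t"
  shows "rfrm g d n \<alpha> x V = rfrm g d n \<alpha> y V"
proof -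
  have "frm g d n \<alpha> x V V = frm g d n \<alpha> y V V"
    unfolding frm_def pencil_op_def by (rule ip_cong) (auto simp: assms intro!: sum.cong)
  then show ?thesis by simp
qed

text \<open>The complement is a smaller pencil whose domain contains the given one; by minimality
  the inclusion is strict. At a tuple in the difference the form splits, and only the first
  component can be violated. Positivity of \<open>d2\<close> makes the complement an admissible
  pencil.\<close>

lemma (in splitting) minimality_violation:
  assumes A: "hermitian_monic_pencil g d A" and min: "lmi_minimal g d A" and \<alpha>: "\<alpha> = coef A"
    and d2: "0 < d2" and d1: "0 < d1"
  shows "\<exists>m x. herm g m x \<and> (\<forall>V. rfrm g d2 m \<alpha>2 x V \<le> nrm m d2 V) \<and> (\<exists>V. nrm m d1 V < rfrm g d1 m \<alpha>1 x V)"
proof -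
  have At: "A \<in> hermitian_tuples g d" using A by (simp add: hermitian_monic_pencil_def)
  define A2 where "A2 = tup g d2 (\<lambda>(j, a, b). \<alpha>2 j a b)"
  have coef2: "coef A2 j a b = \<alpha>2 j a b" if "j < g" "a < d2" "b < d2" for j a b
    using that by (simp add: A2_def coef_def untup_tup)
  have "herm g d2 (\<lambda>(j, a, b). \<alpha>2 j a b)" using h2 by (simp add: herm_def herm_coeff_def)
  then have A2t: "A2 \<in> hermitian_tuples g d2"
    unfolding A2_def hermitian_tuples_iff by (simp add: herm_untup_tup)
  then have A2p: "hermitian_monic_pencil g d2 A2" using d2 by (simp add: hermitian_monic_pencil_def)
  have psd2: "psd (pencil_eval d2 A2 n X) \<longleftrightarrow> (\<forall>V. rfrm g d2 n \<alpha>2 (untup X) V \<le> nrm n d2 V)"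
    if "X \<in> hermitian_tuples g n" for n X
    unfolding psd_pencil_iff[OF A2t that] using rfrm_coeff_cong[of g d2 "coef A2" \<alpha>2] coef2 by simp
  have sub: "lmi_domain_level g d A n \<subseteq> lmi_domain_level g d2 A2 n" for n
  proof
    fix X assume X: "X \<in> lmi_domain_level g d A n"
    then have Xh: "X \<in> hermitian_tuples g n" by (simp add: lmi_domain_level_def)
    have le: "rfrm g d n \<alpha> (untup X) V \<le> nrm n d V" for V
      using X psd_pencil_iff[OF At Xh] by (simp add: lmi_domain_level_def \<alpha>)
    have "rfrm g d2 n \<alpha>2 (untup X) V \<le> nrm n d2 V" for V
      using le[of "embed us' V"] by (simp add: rfrm_embed2)
    then show "X \<in> lmi_domain_level g d2 A2 n" using Xh psd2[OF Xh] by (simp add: lmi_domain_level_def)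
  qed
  have "lmi_domain g d2 A2 \<noteq> lmi_domain g d A"
  proof
    assume "lmi_domain g d2 A2 = lmi_domain g d A"
    then have "d \<le> d2" using min A2p by (auto simp: lmi_minimal_def)
    then show False using dims d1 by simp
  qed
  moreover have "lmi_domain g d A \<subseteq> lmi_domain g d2 A2" using sub by (auto simp: lmi_domain_def)
  ultimately obtain X where X: "X \<in> lmi_domain g d2 A2" "X \<notin> lmi_domain g d A" by blast
  then obtain m where m: "1 \<le> m" "X \<in> lmi_domain_level g d2 A2 m" by (auto simp: lmi_domain_def)
  then have Xh: "X \<in> hermitian_tuples g m" by (simp add: lmi_domain_level_def)
  have le2: "rfrm g d2 m \<alpha>2 (untup X) V \<le> nrm m d2 V" for V
    using m(2) psd2[OF Xh] by (simp add: lmi_domain_level_def)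
  have "X \<notin> lmi_domain_level g d A m" using X(2) m(1) by (auto simp: lmi_domain_def)
  then have "\<not> psd (pencil_eval d A m X)" using Xh by (simp add: lmi_domain_level_def)
  then obtain V where V: "nrm m d V < rfrm g d m \<alpha> (untup X) V"
    unfolding psd_pencil_iff[OF At Xh] \<alpha> using linorder_not_less by blast
  have "nrm m d1 (coords d us V) < rfrm g d1 m \<alpha>1 (untup X) (coords d us V)"
    using V le2[of "coords d us' V"] unfolding rfrm_split nrm_split by linarith
  moreover have "herm g m (untup X)" using Xh by (simp add: hermitian_tuples_iff)
  ultimately show ?thesis using le2 by blast
qed

lemma free_locus_iff:
  assumes "A \<in> mat_tuples g d"
  shows "X \<in> free_locus g d A n \<longleftrightarrow> X \<in> mat_tuples g n \<and> (\<exists>V. eigen g d n (coef A) (untup X) 1 V)"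
  unfolding free_locus_def using assms by (auto simp: pencil_eval_pmat det_lmat_zero_iff)

lemma boundary_subset_free_locus:
  assumes A: "A \<in> hermitian_tuples g d"
  shows "lmi_boundary1 g d A n \<subseteq> free_locus g d A n"
proof
  fix X assume X: "X \<in> lmi_boundary1 g d A n"
  have At: "A \<in> mat_tuples g d" using A by (simp add: hermitian_tuples_iff)
  have Xt: "X \<in> mat_tuples g n"
    using X by (auto simp: lmi_boundary1_def lmi_domain_level_def hermitian_tuples_iff)
  have "kernel_dim (lmat g d n (coef A) (untup X)) = 1"
    using X by (simp add: lmi_boundary1_def pencil_eval_pmat[OF At Xt])
  then have "det (lmat g d n (coef A) (untup X)) = 0" by (rule det_zero_if_kernel_dim)
  then show "X \<in> free_locus g d A n" using Xt by (simp add: free_locus_def pencil_eval_pmat[OF At Xt])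
qed

text \<open>Minimality gives a violating tuple unless the complement is zero, and then any nonzero
  coefficient gives one of size 1. If all coefficients vanish as well, the component is the identity
  and its locus is empty.\<close>

lemma (in splitting) component_dense:
  assumes A: "hermitian_monic_pencil g d A" and min: "lmi_minimal g d A" and \<alpha>: "\<alpha> = coef A"
    and irr: "irred g d1 \<alpha>1"
  shows "\<exists>n\<^sub>0. \<forall>n\<ge>n\<^sub>0. \<forall>p y V. entry_polynomial g n p \<longrightarrow> (\<forall>X\<in>lmi_boundary1 g d A n. p X = 0) \<longrightarrow>
    eigen g d1 n \<alpha>1 y 1 V \<longrightarrow> p (tup g n y) = 0"
proof (cases "\<exists>m x Vs. herm g m x \<and> (\<forall>V. rfrm g d2 m \<alpha>2 x V \<le> nrm m d2 V) \<and> nrm m d1 Vs < rfrm g d1 m \<alpha>1 x Vs")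
  case True
  then obtain m xs Vs where xs: "herm g m xs" "\<And>V. rfrm g d2 m \<alpha>2 xs V \<le> nrm m d2 V"
    "nrm m d1 Vs < rfrm g d1 m \<alpha>1 xs Vs" by blast
  have At: "A \<in> hermitian_tuples g d" using A by (simp add: hermitian_monic_pencil_def)
  show ?thesis
  \<comment> \<open>The size of the violating tuple and the bound of the parameter count, with 2 for
    1 because the latter is strict.\<close>
  proof (intro exI[of _ "max m (2 + d1\<^sup>2 + g * d1\<^sup>2)"] allI impI)
    fix n p y V
    assume n: "max m (2 + d1\<^sup>2 + g * d1\<^sup>2) \<le> n" and p: "entry_polynomial g n p"
      and van: "\<forall>X\<in>lmi_boundary1 g d A n. p X = 0" and y: "eigen g d1 n \<alpha>1 y 1 V"
    have n1: "m \<le> n" and n2: "1 + d1\<^sup>2 + g * d1\<^sup>2 < n" using n by auto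
    show "p (tup g n y) = 0"
    proof (rule vanish_on_free_locus[OF h1 irr xs n1 n2 p _ y])
      fix x assume x: "herm g n x" "\<And>W. rfrm g d1 n \<alpha>1 x W \<le> nrm n d1 W" "simple_kernel g d1 n \<alpha>1 x 1"
        "\<And>W. 0 < nrm n d2 W \<Longrightarrow> rfrm g d2 n \<alpha>2 x W < nrm n d2 W"
      note bd = boundary_of_splitting[OF x]
      let ?X = "tup g n x"
      have Xh: "?X \<in> hermitian_tuples g n" using x(1) by (simp add: hermitian_tuples_iff herm_untup_tup)
      have "rfrm g d n \<alpha> (untup ?X) W = rfrm g d n \<alpha> x W" for W
        by (rule rfrm_tuple_cong) (simp add: untup_tup)
      then have "psd (pencil_eval d A n ?X)" unfolding psd_pencil_iff[OF At Xh] using bd(1) by (simp add: \<alpha>)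
      moreover have "pencil_eval d A n ?X = lmat g d n \<alpha> x"
      proof -
        have "pmat g d n \<alpha> (untup ?X) = pmat g d n \<alpha> x" by (rule pmat_cong) (simp add: untup_tup)
        moreover have "A \<in> mat_tuples g d" using At by (simp add: hermitian_tuples_iff)
        ultimately show ?thesis by (simp only: pencil_eval_pmat[OF _ tup_in] \<alpha>)
      qed
      then have "kernel_dim (pencil_eval d A n ?X) = 1" using kernel_dim_lmat_one[OF bd(2)] by simp
      ultimately have "?X \<in> lmi_boundary1 g d A n" using Xh by (simp add: lmi_boundary1_def lmi_domain_level_def)
      then show "p ?X = 0" using van by blast
    qed
  qed
next
  case False
  have "\<not> eigen g d1 n \<alpha>1 y 1 V" for n y V
  proof
    assume y: "eigen g d1 n \<alpha>1 y 1 V"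
    then have d1: "0 < d1" by (auto simp: eigen_def)
    have "d2 = 0" using False minimality_violation[OF A min \<alpha> _ d1] by blast
    then have le2: "rfrm g d2 m \<alpha>2 x U \<le> nrm m d2 U" for m x U
      using rfrm_zero[of m d2 U g \<alpha>2 x] by (simp add: nrm_def)
    have zero: "\<alpha>1 j a b = 0" if "j < g" "a < d1" "b < d1" for j a b
      using nonzero_coeff_violation[OF h1 that] False le2 by blast
    obtain i a where ia: "i < n" "a < d1" "V (i, a) \<noteq> 0" using y by (auto simp: eigen_def)
    then have "V (i, a) = pencil_op g d1 n \<alpha>1 y V (i, a)" using y by (simp add: eigen_def)
    also have "\<dots> = 0" using zero ia by (simp add: pencil_op_def)
    finally show False using ia by simp
  qed
  then show ?thesis by blast
qed

theorem theorem5: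
  fixes g d :: nat and A :: "complex mat list"
  assumes "hermitian_monic_pencil g d A"
    and "lmi_minimal g d A"
  shows "\<exists>n\<^sub>0. \<forall>n\<ge>n\<^sub>0. zariski_dense_in g n (lmi_boundary1 g d A n) (free_locus g d A n)"
proof -
  let ?\<alpha> = "coef A"
  have At: "A \<in> hermitian_tuples g d" "A \<in> mat_tuples g d"
    using assms(1) by (auto simp: hermitian_monic_pencil_def hermitian_tuples_iff)
  have h: "herm_coeff g d ?\<alpha>" by (rule herm_coeff_coef[OF At(1)])
  from finite_minimal_cover[OF h] obtain F where F: "finite F" "\<forall>W\<in>F. minimal_inv g d ?\<alpha> W"
    "\<forall>v\<in>vecs d. v \<noteq> 0 \<longrightarrow> (\<exists>W\<in>F. v \<notin> perp d W)" by (elim exE conjE)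
  define good where "good us m \<longleftrightarrow> (\<forall>n\<ge>m. \<forall>p y V. entry_polynomial g n p \<longrightarrow>
    (\<forall>X\<in>lmi_boundary1 g d A n. p X = 0) \<longrightarrow> eigen g (length us) n (compress d us ?\<alpha>) y 1 V \<longrightarrow> p (tup g n y) = 0)"
    for us and m :: nat
  have "\<exists>us us' m. splitting g d ?\<alpha> W us us' \<and> good us m" if WF: "W \<in> F" for W
  proof -
    have Wi: "invariant g d ?\<alpha> W" using F(2) WF by (simp add: minimal_inv_def)
    then have Ws: "fv.subspace W" "W \<subseteq> vecs d" by (auto simp: invariant_def)
    obtain us where us: "onb d us W" using onb_exists[OF Ws] unfolding onb_def by metis
    have "perp d W \<subseteq> vecs d" by (auto simp: perp_def)
    then obtain us' where us': "onb d us' (perp d W)"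
      using onb_exists[OF subspace_perp] unfolding onb_def by metis
    interpret splitting g d ?\<alpha> W us us' by unfold_locales (fact h Wi us us')+
    have "\<exists>m. good us m" unfolding good_def
      by (rule component_dense[OF assms refl irred_compress[OF F(2)[rule_format, OF WF] us]])
    then show ?thesis using splitting_axioms by blast
  qed
  then obtain us us' m where sp: "\<And>W. W \<in> F \<Longrightarrow> splitting g d ?\<alpha> W (us W) (us' W)"
    and m: "\<And>W. W \<in> F \<Longrightarrow> good (us W) (m W)" by metis
  show ?thesis
  \<comment> \<open>A sum of thresholds dominates each of them and makes sense for an empty family
    too.\<close>
  proof (intro exI[of _ "\<Sum>W\<in>F. m W"] allI impI)
    fix n assume n: "(\<Sum>W\<in>F. m W) \<le> n"
    show "zariski_dense_in g n (lmi_boundary1 g d A n) (free_locus g d A n)"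
    proof (rule zariski_dense_inI[OF boundary_subset_free_locus[OF At(1)]])
      show "free_locus g d A n \<subseteq> mat_tuples g n" by (auto simp: free_locus_def)
      fix p X
      assume p: "entry_polynomial g n p" "\<And>Y. Y \<in> lmi_boundary1 g d A n \<Longrightarrow> p Y = 0"
        and "X \<in> free_locus g d A n"
      then obtain V where X: "X \<in> mat_tuples g n" and V: "eigen g d n ?\<alpha> (untup X) 1 V"
        using free_locus_iff[OF At(2)] by blast
      obtain i a where ia: "i < n" "a < d" "V (i, a) \<noteq> 0" using V by (auto simp: eigen_def)
      then have "rowv d V i a \<noteq> 0" by (simp add: rowv_def)
      then have "rowv d V i \<noteq> 0" by auto
      then obtain W where WF: "W \<in> F" "rowv d V i \<notin> perp d W" using F(3) rowv_vecs by blast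
      interpret splitting g d ?\<alpha> W "us W" "us' W" by (rule sp[OF WF(1)])
      \<comment> \<open>\<open>us W\<close> spans \<open>W\<close>, so a row with all coordinates
        zero would be orthogonal to \<open>W\<close>.\<close>
      have "\<exists>c<length (us W). coords d (us W) V (i, c) \<noteq> 0"
      proof (rule ccontr)
        assume n: "\<not> ?thesis"
        obtain w where w: "w \<in> W" "cinner d (rowv d V i) w \<noteq> 0" using WF(2) by (auto simp: perp_def)
        have "cinner d w (rowv d V i) = cinner d (proj d (us W) w) (rowv d V i)"
          using us w(1) by (auto simp: onb_def intro: arg_cong)
        also have "\<dots> = (\<Sum>c<length (us W). cinner d w (us W ! c) * cinner d (us W ! c) (rowv d V i))"
          by (simp add: proj_def cinner_sum_left cinner_scale_left)
        also have "\<dots> = 0"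
        proof (rule sum.neutral, clarify)
          fix c assume "c < length (us W)"
          then have "cinner d (rowv d V i) (us W ! c) = 0" using n by (simp add: coords_cinner)
          then have "cinner d (us W ! c) (rowv d V i) = 0" by (subst cinner_commute) simp
          then show "cinner d w (us W ! c) * cinner d (us W ! c) (rowv d V i) = 0" by simp
        qed
        finally have "cinner d (rowv d V i) w = 0" by (subst cinner_commute) simp
        with w(2) show False by simp
      qed
      then obtain c where "c < length (us W)" "coords d (us W) V (i, c) \<noteq> 0" by blast
      from eigen_coords[OF V ia(1) this]
      have "eigen g (length (us W)) n (compress d (us W) ?\<alpha>) (untup X) 1 (coords d (us W) V)" .
      moreover have "m W \<le> n" using member_le_sum[OF WF(1), of m] F(1) n by simp
      ultimately have "p (tup g n (untup X)) = 0"
        using m[OF WF(1)] p unfolding good_def by blast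
      then show "p X = 0" by (simp add: tup_untup[OF X])
    qed
  qed
qed

end
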